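(* Let $s>0$, $t>0$, $u=s+it$, let $L$ be the operator in $L^2((0,\pi),\mathbb{C}^2)$ defined in the context, with eigenvalues $\lambda_n=(s^2+t^2)n/t$ and eigenfunctions $f_n$, $n\in\mathbb{Z}$, and let $P_n$ be the spectral projection associated with the eigenvalue $\lambda_n$ of $L$. Then $\|P_n\|$ diverges at an exponential rate as $n\to\infty$ (that is, there are constants $C,c>0$ such that $\|P_n\|\ge Ce^{cn}$ for all sufficiently large $n$). Consequently the eigenfunctions $\{f_n\}_{n\in\mathbb{Z}}$ do not constitute a (Schauder) basis of $L^2((0,\pi),\mathbb{C}^2)$.
   Context: $L$ is defined by $(Lf)_1(x)=uf_1'(x)$, $(Lf)_2(x)=\overline{u}f_2'(x)$ for all $f\in W^{1,2}((0,\pi),\mathbb{C}^2)$ subject to the boundary conditions $f_1(0)=f_2(0)$ and $f_1(\pi)=f_2(\pi)$. Its eigenvalues are $\lambda_n=(s^2+t^2)n/t$, $n\in\mathbb{Z}$, with corresponding eigenfunctions $f_n=(f_{n,1},f_{n,2})$, $f_{n,1}(x)=e^{x\lambda_n/u}$, $f_{n,2}(x)=e^{x\lambda_n/\overline{u}}$. *)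

theory Defs
  imports "HOL-Complex_Analysis.Complex_Analysis"
begin

abbreviation I_meas :: "real measure" where
  "I_meas \<equiv> lebesgue_on {0<..<pi}"

definition square_integrable :: "(real \<Rightarrow> complex \<times> complex) \<Rightarrow> bool" where
  "square_integrable f \<longleftrightarrow>
     f \<in> borel_measurable I_meas \<and> integrable I_meas (\<lambda>x. (norm (f x))\<^sup>2)"

lemma square_integrable_measurable [measurable_dest]:
  "square_integrable f \<Longrightarrow> f \<in> borel_measurable I_meas"
  by (simp add: square_integrable_def)

lemma square_integrable_zero: "square_integrable (\<lambda>_. 0)"
  by (simp add: square_integrable_def)

lemma square_integrable_bound:
  assumes "square_integrable f" and [measurable]: "g \<in> borel_measurable I_meas"
    and "\<And>x. norm (g x) \<le> c * norm (f x)"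
  shows "square_integrable g"
proof -
  have "integrable I_meas (\<lambda>x. c\<^sup>2 * (norm (f x))\<^sup>2)"
    using assms(1) by (simp add: square_integrable_def)
  then have "integrable I_meas (\<lambda>x. (norm (g x))\<^sup>2)"
  proof (rule Bochner_Integration.integrable_bound)
    show "AE x in I_meas. norm ((norm (g x))\<^sup>2) \<le> norm (c\<^sup>2 * (norm (f x))\<^sup>2)"
    proof (rule AE_I2)
      fix x
      have "(norm (g x))\<^sup>2 \<le> (c * norm (f x))\<^sup>2"
        by (rule power_mono[OF assms(3)]) simp
      then show "norm ((norm (g x))\<^sup>2) \<le> norm (c\<^sup>2 * (norm (f x))\<^sup>2)"
        by (simp add: power_mult_distrib)
    qed
  qed measurable
  then show ?thesis
    by (simp add: square_integrable_def)
qed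

lemma square_integrable_add:
  assumes "square_integrable f" "square_integrable g"
  shows "square_integrable (\<lambda>x. f x + g x)"
proof -
  note [measurable] = square_integrable_measurable[OF assms(1)] square_integrable_measurable[OF assms(2)]
  have "integrable I_meas (\<lambda>x. 2 * (norm (f x))\<^sup>2 + 2 * (norm (g x))\<^sup>2)"
    using assms by (simp add: square_integrable_def)
  then have "integrable I_meas (\<lambda>x. (norm (f x + g x))\<^sup>2)"
  proof (rule Bochner_Integration.integrable_bound)
    show "AE x in I_meas. norm ((norm (f x + g x))\<^sup>2)
            \<le> norm (2 * (norm (f x))\<^sup>2 + 2 * (norm (g x))\<^sup>2)"
    proof (rule AE_I2)
      fix x
      have "(norm (f x + g x))\<^sup>2 \<le> (norm (f x) + norm (g x))\<^sup>2"
        by (simp add: norm_triangle_ineq power_mono)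
      also have "\<dots> \<le> 2 * (norm (f x))\<^sup>2 + 2 * (norm (g x))\<^sup>2"
        using sum_squares_bound[of "norm (f x)" "norm (g x)"] by (simp add: power2_sum)
      finally show "norm ((norm (f x + g x))\<^sup>2)
            \<le> norm (2 * (norm (f x))\<^sup>2 + 2 * (norm (g x))\<^sup>2)"
        by simp
    qed
  qed measurable
  then show ?thesis
    by (simp add: square_integrable_def)
qed

lemma norm_diag_le:
  fixes a b :: complex
  shows "norm (a * fst p, b * snd p) \<le> max (cmod a) (cmod b) * norm p"
proof -
  let ?m = "max (cmod a) (cmod b)"
  have "(cmod a * cmod (fst p))\<^sup>2 + (cmod b * cmod (snd p))\<^sup>2
      \<le> (?m * cmod (fst p))\<^sup>2 + (?m * cmod (snd p))\<^sup>2"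
    by (intro add_mono power_mono mult_right_mono) auto
  also have "\<dots> = (?m * norm p)\<^sup>2"
    by (simp add: norm_prod_def power_mult_distrib algebra_simps)
  finally show ?thesis
    by (auto simp: norm_prod_def norm_mult le_max_iff_disj intro!: real_le_lsqrt)
qed

lemma diag_measurable:
  assumes [measurable]: "f \<in> borel_measurable I_meas"
  shows "(\<lambda>x. (a * fst (f x), b * snd (f x)) :: complex \<times> complex) \<in> borel_measurable I_meas"
proof -
  have "continuous_on UNIV (\<lambda>p :: complex \<times> complex. (a * fst p, b * snd p))"
    by (intro continuous_intros)
  then show ?thesis
    using assms by (rule borel_measurable_continuous_on)
qed

lemma square_integrable_diag:
  "square_integrable f \<Longrightarrow> square_integrable (\<lambda>x. (a * fst (f x), b * snd (f x)))"
  by (rule square_integrable_bound[OF _ diag_measurable norm_diag_le])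
     (auto dest: square_integrable_measurable)

lemma square_integrable_scaleR:
  assumes "square_integrable f"
  shows "square_integrable (\<lambda>x. r *\<^sub>R f x)"
  by (rule square_integrable_bound[OF assms, where c = "\<bar>r\<bar>"])
     (use square_integrable_measurable[OF assms] in auto)

lemma square_integrable_inner:
  assumes "square_integrable f" "square_integrable g"
  shows "integrable I_meas (\<lambda>x. f x \<bullet> g x)"
proof -
  note [measurable] = square_integrable_measurable[OF assms(1)] square_integrable_measurable[OF assms(2)]
  have "integrable I_meas (\<lambda>x. (norm (f x))\<^sup>2 + (norm (g x))\<^sup>2)"
    using assms by (simp add: square_integrable_def)
  then show ?thesis
  proof (rule Bochner_Integration.integrable_bound)
    show "AE x in I_meas. norm (f x \<bullet> g x) \<le> norm ((norm (f x))\<^sup>2 + (norm (g x))\<^sup>2)"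
    proof (rule AE_I2)
      fix x
      have "\<bar>f x \<bullet> g x\<bar> \<le> norm (f x) * norm (g x)"
        by (rule Cauchy_Schwarz_ineq2)
      also have "\<dots> \<le> 2 * norm (f x) * norm (g x)"
        by simp
      also have "\<dots> \<le> (norm (f x))\<^sup>2 + (norm (g x))\<^sup>2"
        by (rule sum_squares_bound)
      finally show "norm (f x \<bullet> g x) \<le> norm ((norm (f x))\<^sup>2 + (norm (g x))\<^sup>2)"
        by simp
    qed
  qed measurable
qed

quotient_type L2 = "real \<Rightarrow> complex \<times> complex" / partial:
  "\<lambda>f g. square_integrable f \<and> square_integrable g \<and> (AE x in I_meas. f x = g x)"
proof (rule part_equivpI)
  show "\<exists>f. square_integrable f \<and> square_integrable f \<and> (AE x in I_meas. f x = f x)"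
    using square_integrable_zero by auto
  show "symp (\<lambda>f g. square_integrable f \<and> square_integrable g \<and> (AE x in I_meas. f x = g x))"
    by (auto intro!: sympI elim!: eventually_mono)
  show "transp (\<lambda>f g. square_integrable f \<and> square_integrable g \<and> (AE x in I_meas. f x = g x))"
  proof (rule transpI, elim conjE, intro conjI)
    fix f g h :: "real \<Rightarrow> complex \<times> complex"
    assume "AE x in I_meas. f x = g x" "AE x in I_meas. g x = h x"
    then show "AE x in I_meas. f x = h x"
      by eventually_elim simp
  qed
qed

text \<open>The class of a square integrable function (a junk value for other functions).\<close>

abbreviation L2_of :: "(real \<Rightarrow> complex \<times> complex) \<Rightarrow> L2" where
  "L2_of \<equiv> abs_L2"

text \<open>The real inner product below is the real part of the Hermitian one, so that the norm is the
  usual norm of \<open>L\<^sup>2((0,\<pi>), \<complex>\<^sup>2)\<close>.\<close>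

instantiation L2 :: real_inner
begin

lift_definition zero_L2 :: L2 is "\<lambda>_. 0"
  by (simp add: square_integrable_zero)

lift_definition plus_L2 :: "L2 \<Rightarrow> L2 \<Rightarrow> L2" is "\<lambda>f g x. f x + g x"
proof (elim conjE, intro conjI)
  fix f1 f2 g1 g2 :: "real \<Rightarrow> complex \<times> complex"
  assume "AE x in I_meas. f1 x = f2 x" "AE x in I_meas. g1 x = g2 x"
  then show "AE x in I_meas. f1 x + g1 x = f2 x + g2 x"
    by eventually_elim simp
qed (simp_all add: square_integrable_add)

lift_definition scaleR_L2 :: "real \<Rightarrow> L2 \<Rightarrow> L2" is "\<lambda>r f x. r *\<^sub>R f x"
  by (auto simp: square_integrable_scaleR elim!: eventually_mono)

lift_definition inner_L2 :: "L2 \<Rightarrow> L2 \<Rightarrow> real" is "\<lambda>f g. \<integral>x. f x \<bullet> g x \<partial>I_meas"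
proof -
  fix f1 f2 g1 g2 :: "real \<Rightarrow> complex \<times> complex"
  assume f: "square_integrable f1 \<and> square_integrable f2 \<and> (AE x in I_meas. f1 x = f2 x)"
    and g: "square_integrable g1 \<and> square_integrable g2 \<and> (AE x in I_meas. g1 x = g2 x)"
  show "(\<integral>x. f1 x \<bullet> g1 x \<partial>I_meas) = (\<integral>x. f2 x \<bullet> g2 x \<partial>I_meas)"
  proof (rule integral_cong_AE)
    show "(\<lambda>x. f1 x \<bullet> g1 x) \<in> borel_measurable I_meas" "(\<lambda>x. f2 x \<bullet> g2 x) \<in> borel_measurable I_meas"
      using f g square_integrable_inner by (blast intro: borel_measurable_integrable)+
    show "AE x in I_meas. f1 x \<bullet> g1 x = f2 x \<bullet> g2 x"
      using conjunct2[OF conjunct2[OF f]] conjunct2[OF conjunct2[OF g]] by eventually_elim simp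
  qed
qed

definition uminus_L2 :: "L2 \<Rightarrow> L2" where "- f = (- 1 :: real) *\<^sub>R f" for f :: L2
definition minus_L2 :: "L2 \<Rightarrow> L2 \<Rightarrow> L2" where "f - g = f + (- g)" for f g :: L2
definition norm_L2 :: "L2 \<Rightarrow> real" where "norm f = sqrt (f \<bullet> f)" for f :: L2
definition sgn_L2 :: "L2 \<Rightarrow> L2" where "sgn f = inverse (norm f) *\<^sub>R f" for f :: L2
definition dist_L2 :: "L2 \<Rightarrow> L2 \<Rightarrow> real" where "dist f g = norm (f - g)" for f g :: L2
definition uniformity_L2 :: "(L2 \<times> L2) filter" where
  "uniformity_L2 = (INF e\<in>{0<..}. principal {(x, y). dist x y < e})"
definition open_L2 :: "L2 set \<Rightarrow> bool" where
  "open_L2 U \<longleftrightarrow> (\<forall>x\<in>U. eventually (\<lambda>(x', y). x' = x \<longrightarrow> y \<in> U) uniformity)"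

instance
proof
  fix a b c :: L2 and r r' :: real
  show "a + b + c = a + (b + c)"
    by transfer (auto simp: add.assoc square_integrable_add)
  show "a + b = b + a"
    by transfer (auto simp: add.commute square_integrable_add)
  show "0 + a = a"
    by transfer auto
  show "- a + a = 0"
    unfolding uminus_L2_def
  proof transfer
    fix f :: "real \<Rightarrow> complex \<times> complex"
    assume "square_integrable f \<and> square_integrable f \<and> (AE x in I_meas. f x = f x)"
    then have "square_integrable (\<lambda>x. - 1 *\<^sub>R f x + f x)"
      by (intro square_integrable_add square_integrable_scaleR) auto
    then show "square_integrable (\<lambda>x. - 1 *\<^sub>R f x + f x) \<and> square_integrable (\<lambda>_. 0) \<and>
        (AE x in I_meas. - 1 *\<^sub>R f x + f x = 0)"
      by (simp add: square_integrable_zero)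
  qed
  show "a - b = a + - b"
    by (simp add: minus_L2_def)
  show "r *\<^sub>R (a + b) = r *\<^sub>R a + r *\<^sub>R b"
    by transfer (auto simp: scaleR_add_right intro!: square_integrable_add square_integrable_scaleR)
  show "(r + r') *\<^sub>R a = r *\<^sub>R a + r' *\<^sub>R a"
    by transfer (auto simp: scaleR_add_left intro!: square_integrable_add square_integrable_scaleR)
  show "r *\<^sub>R r' *\<^sub>R a = (r * r') *\<^sub>R a"
    by transfer (auto intro!: square_integrable_scaleR)
  show "1 *\<^sub>R a = a"
    by transfer auto
  show "sgn a = inverse (norm a) *\<^sub>R a"
    by (simp add: sgn_L2_def)
  show "dist a b = norm (a - b)"
    by (simp add: dist_L2_def)
  show "uniformity = (INF e\<in>{0<..}. principal {(x, y). dist (x::L2) y < e})"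
    by (simp add: uniformity_L2_def)
  show "open U \<longleftrightarrow> (\<forall>x\<in>U. eventually (\<lambda>(x', y). x' = x \<longrightarrow> y \<in> U) uniformity)" for U :: "L2 set"
    by (simp add: open_L2_def)
  show "a \<bullet> b = b \<bullet> a"
    by transfer (simp add: inner_commute)
  show "(a + b) \<bullet> c = a \<bullet> c + b \<bullet> c"
    by transfer (simp add: inner_add_left Bochner_Integration.integral_add square_integrable_inner)
  show "(r *\<^sub>R a) \<bullet> b = r * (a \<bullet> b)"
    by transfer simp
  show "0 \<le> a \<bullet> a"
    by transfer (simp add: Bochner_Integration.integral_nonneg)
  show "a \<bullet> a = 0 \<longleftrightarrow> a = 0"
  proof transfer
    fix f :: "real \<Rightarrow> complex \<times> complex"
    assume "square_integrable f \<and> square_integrable f \<and> (AE x in I_meas. f x = f x)"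
    then have f: "square_integrable f" by simp
    have "(\<integral>x. f x \<bullet> f x \<partial>I_meas) = 0 \<longleftrightarrow> (AE x in I_meas. f x \<bullet> f x = 0)"
      by (rule integral_nonneg_eq_0_iff_AE) (auto intro: square_integrable_inner[OF f f])
    then show "((\<integral>x. f x \<bullet> f x \<partial>I_meas) = 0) \<longleftrightarrow>
        (square_integrable f \<and> square_integrable (\<lambda>_. 0) \<and> (AE x in I_meas. f x = 0))"
      using f square_integrable_zero by simp
  qed
  show "norm a = sqrt (a \<bullet> a)"
    by (simp add: norm_L2_def)
qed

end

lift_definition diag_mult :: "complex \<Rightarrow> complex \<Rightarrow> L2 \<Rightarrow> L2"
  is "\<lambda>a b f x. (a * fst (f x), b * snd (f x))"
proof (elim conjE, intro conjI)
  fix a b and f g :: "real \<Rightarrow> complex \<times> complex"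
  assume "AE x in I_meas. f x = g x"
  then show "AE x in I_meas. (a * fst (f x), b * snd (f x)) = (a * fst (g x), b * snd (g x))"
    by eventually_elim simp
qed (simp_all only: square_integrable_diag)

definition scaleC :: "complex \<Rightarrow> L2 \<Rightarrow> L2" (infixr "*\<^sub>C" 75) where
  "c *\<^sub>C f = diag_mult c c f"

lemma bounded_linear_scaleC: "bounded_linear (scaleC c)"
proof (rule bounded_linear_intro)
  fix f g :: L2 and r :: real
  show "c *\<^sub>C (f + g) = c *\<^sub>C f + c *\<^sub>C g"
    unfolding scaleC_def
  proof transfer
    fix c and f g :: "real \<Rightarrow> complex \<times> complex"
    assume "square_integrable f \<and> square_integrable f \<and> (AE x in I_meas. f x = f x)"
      and "square_integrable g \<and> square_integrable g \<and> (AE x in I_meas. g x = g x)"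
    then have "square_integrable (\<lambda>x. (c * fst (f x + g x), c * snd (f x + g x)))"
      and "square_integrable (\<lambda>x. (c * fst (f x), c * snd (f x)) + (c * fst (g x), c * snd (g x)))"
      by (auto simp only: intro!: square_integrable_add square_integrable_diag)
    then show "square_integrable (\<lambda>x. (c * fst (f x + g x), c * snd (f x + g x))) \<and>
       square_integrable (\<lambda>x. (c * fst (f x), c * snd (f x)) + (c * fst (g x), c * snd (g x))) \<and>
       (AE x in I_meas. (c * fst (f x + g x), c * snd (f x + g x)) =
          (c * fst (f x), c * snd (f x)) + (c * fst (g x), c * snd (g x)))"
      by (simp add: distrib_left)
  qed
  show "c *\<^sub>C (r *\<^sub>R f) = r *\<^sub>R (c *\<^sub>C f)"
    unfolding scaleC_def
  proof transfer
    fix c r and f :: "real \<Rightarrow> complex \<times> complex"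
    assume "square_integrable f \<and> square_integrable f \<and> (AE x in I_meas. f x = f x)"
    then show "square_integrable (\<lambda>x. (c * fst (r *\<^sub>R f x), c * snd (r *\<^sub>R f x))) \<and>
       square_integrable (\<lambda>x. r *\<^sub>R (c * fst (f x), c * snd (f x))) \<and>
       (AE x in I_meas. (c * fst (r *\<^sub>R f x), c * snd (r *\<^sub>R f x)) = r *\<^sub>R (c * fst (f x), c * snd (f x)))"
      using square_integrable_diag[OF square_integrable_scaleR] square_integrable_scaleR[OF square_integrable_diag]
      by auto
  qed
  show "norm (c *\<^sub>C f) \<le> norm f * cmod c"
  proof -
    have "(c *\<^sub>C f) \<bullet> (c *\<^sub>C f) = (cmod c)\<^sup>2 * (f \<bullet> f)"
      unfolding scaleC_def
      by transfer (simp add: inner_prod_def norm_mult power_mult_distrib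
          flip: power2_norm_eq_inner distrib_left)
    then show ?thesis
      by (simp add: norm_eq_sqrt_inner real_sqrt_mult)
  qed
qed

lift_definition scaleC_blinfun :: "complex \<Rightarrow> L2 \<Rightarrow>\<^sub>L L2" is scaleC
  by (rule bounded_linear_scaleC)

text \<open>Test functions are the \<open>C\<^sup>1\<close> functions with compact support in \<open>(0,\<pi>)\<close> (as in Brezis);
  by mollification, \<open>C\<^sup>\<infinity>\<close> test functions yield the same weak derivatives.
  The second argument is the derivative of the first.\<close>

definition test_function :: "(real \<Rightarrow> real) \<Rightarrow> (real \<Rightarrow> real) \<Rightarrow> bool" where
  "test_function \<phi> \<phi>' \<longleftrightarrow>
     (\<forall>x. (\<phi> has_real_derivative \<phi>' x) (at x)) \<and> continuous_on UNIV \<phi>' \<and>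
     (\<exists>a b. 0 < a \<and> a < b \<and> b < pi \<and> (\<forall>x. x \<notin> {a..b} \<longrightarrow> \<phi> x = 0))"

lemma test_function_measurable:
  assumes "test_function \<phi> \<phi>'"
  shows "\<phi> \<in> borel_measurable I_meas" "\<phi>' \<in> borel_measurable I_meas"
proof -
  have "continuous_on {0<..<pi} \<phi>"
    using assms unfolding test_function_def
    by (intro continuous_at_imp_continuous_on ballI) (blast intro: DERIV_isCont)
  then show "\<phi> \<in> borel_measurable I_meas"
    by (rule continuous_imp_measurable_on_sets_lebesgue) simp
  have "continuous_on {0<..<pi} \<phi>'"
    using assms unfolding test_function_def by (blast intro: continuous_on_subset)
  then show "\<phi>' \<in> borel_measurable I_meas"
    by (rule continuous_imp_measurable_on_sets_lebesgue) simp
qed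

lift_definition has_weak_deriv :: "L2 \<Rightarrow> L2 \<Rightarrow> bool"
  is "\<lambda>f g. \<forall>\<phi> \<phi>'. test_function \<phi> \<phi>' \<longrightarrow>
        (\<integral>x. \<phi>' x *\<^sub>R f x \<partial>I_meas) = - (\<integral>x. \<phi> x *\<^sub>R g x \<partial>I_meas)"
proof -
  fix f1 f2 g1 g2 :: "real \<Rightarrow> complex \<times> complex"
  assume f: "square_integrable f1 \<and> square_integrable f2 \<and> (AE x in I_meas. f1 x = f2 x)"
    and g: "square_integrable g1 \<and> square_integrable g2 \<and> (AE x in I_meas. g1 x = g2 x)"
  have cong: "(\<integral>x. \<psi> x *\<^sub>R h1 x \<partial>I_meas) = (\<integral>x. \<psi> x *\<^sub>R h2 x \<partial>I_meas)"
    if [measurable]: "\<psi> \<in> borel_measurable I_meas"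
      and h: "square_integrable h1 \<and> square_integrable h2 \<and> (AE x in I_meas. h1 x = h2 x)"
    for \<psi> :: "real \<Rightarrow> real" and h1 h2 :: "real \<Rightarrow> complex \<times> complex"
  proof (rule integral_cong_AE)
    have [measurable]: "h1 \<in> borel_measurable I_meas" "h2 \<in> borel_measurable I_meas"
      using h by (auto dest: square_integrable_measurable)
    show "(\<lambda>x. \<psi> x *\<^sub>R h1 x) \<in> borel_measurable I_meas" "(\<lambda>x. \<psi> x *\<^sub>R h2 x) \<in> borel_measurable I_meas"
      by measurable
    show "AE x in I_meas. \<psi> x *\<^sub>R h1 x = \<psi> x *\<^sub>R h2 x"
      using h by (auto elim!: eventually_mono)
  qed
  have "(\<integral>x. \<phi>' x *\<^sub>R f1 x \<partial>I_meas) = (\<integral>x. \<phi>' x *\<^sub>R f2 x \<partial>I_meas)"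
    and "(\<integral>x. \<phi> x *\<^sub>R g1 x \<partial>I_meas) = (\<integral>x. \<phi> x *\<^sub>R g2 x \<partial>I_meas)"
    if "test_function \<phi> \<phi>'" for \<phi> \<phi>'
    using that f g by (blast intro: cong test_function_measurable)+
  then show "(\<forall>\<phi> \<phi>'. test_function \<phi> \<phi>' \<longrightarrow>
        (\<integral>x. \<phi>' x *\<^sub>R f1 x \<partial>I_meas) = - (\<integral>x. \<phi> x *\<^sub>R g1 x \<partial>I_meas)) =
    (\<forall>\<phi> \<phi>'. test_function \<phi> \<phi>' \<longrightarrow>
        (\<integral>x. \<phi>' x *\<^sub>R f2 x \<partial>I_meas) = - (\<integral>x. \<phi> x *\<^sub>R g2 x \<partial>I_meas))"
    by (simp cong: imp_cong)
qed

definition W12 :: "L2 set" where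
  "W12 = {f. \<exists>g. has_weak_deriv f g}"

definition weak_deriv :: "L2 \<Rightarrow> L2" where
  "weak_deriv f = (THE g. has_weak_deriv f g)"

text \<open>The boundary values of \<open>f \<in> W\<^sup>1\<^sup>,\<^sup>2\<close> are those of its continuous representative on \<open>[0,\<pi>]\<close>.\<close>

definition L_dom :: "L2 set" where
  "L_dom = {f \<in> W12. \<exists>F. continuous_on {0..pi} F \<and> f = L2_of F \<and>
              fst (F 0) = snd (F 0) \<and> fst (F pi) = snd (F pi)}"

definition L_op :: "complex \<Rightarrow> L2 \<Rightarrow> L2" where
  "L_op u f = diag_mult u (cnj u) (weak_deriv f)"

definition eigval :: "real \<Rightarrow> real \<Rightarrow> int \<Rightarrow> real" where
  "eigval s t n = (s\<^sup>2 + t\<^sup>2) * of_int n / t"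

definition eigfun :: "real \<Rightarrow> real \<Rightarrow> int \<Rightarrow> L2" where
  "eigfun s t n = (let u = Complex s t; \<mu> = complex_of_real (eigval s t n) in
     L2_of (\<lambda>x. (exp (of_real x * \<mu> / u), exp (of_real x * \<mu> / cnj u))))"

text \<open>\<open>D\<close> and \<open>A\<close> are the domain and the action of a complex-linear, possibly unbounded operator.
  The inverse of \<open>z - A\<close> is then automatically complex-linear.\<close>

definition resolvent_set :: "L2 set \<Rightarrow> (L2 \<Rightarrow> L2) \<Rightarrow> complex set" where
  "resolvent_set D A = {z. bij_betw (\<lambda>f. z *\<^sub>C f - A f) D UNIV \<and>
                           bounded_linear (the_inv_into D (\<lambda>f. z *\<^sub>C f - A f))}"

definition spectrum :: "L2 set \<Rightarrow> (L2 \<Rightarrow> L2) \<Rightarrow> complex set" where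
  "spectrum D A = - resolvent_set D A"

definition resolvent :: "L2 set \<Rightarrow> (L2 \<Rightarrow> L2) \<Rightarrow> complex \<Rightarrow> L2 \<Rightarrow>\<^sub>L L2" where
  "resolvent D A z = Blinfun (the_inv_into D (\<lambda>f. z *\<^sub>C f - A f))"

definition op_contour_integral :: "(real \<Rightarrow> complex) \<Rightarrow> (complex \<Rightarrow> L2 \<Rightarrow>\<^sub>L L2) \<Rightarrow> L2 \<Rightarrow>\<^sub>L L2" where
  "op_contour_integral \<gamma> R =
     integral {0..1} (\<lambda>x. scaleC_blinfun (vector_derivative \<gamma> (at x within {0..1})) o\<^sub>L R (\<gamma> x))"

text \<open>The Riesz projection \<open>(2\<pi>i)\<^sup>-\<^sup>1 \<integral> (z - A)\<^sup>-\<^sup>1 dz\<close> over a positively oriented circle around \<open>\<mu>\<close> that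
  separates \<open>\<mu>\<close> from the rest of the spectrum; it is meaningful for isolated \<open>\<mu>\<close>.\<close>

definition spectral_projection :: "L2 set \<Rightarrow> (L2 \<Rightarrow> L2) \<Rightarrow> complex \<Rightarrow> L2 \<Rightarrow>\<^sub>L L2" where
  "spectral_projection D A \<mu> =
     (let r = (SOME r. r > 0 \<and> cball \<mu> r \<inter> spectrum D A \<subseteq> {\<mu>}) in
       scaleC_blinfun (1 / (2 * of_real pi * \<i>)) o\<^sub>L
         op_contour_integral (circlepath \<mu> r) (resolvent D A))"

definition schauder_basis :: "(nat \<Rightarrow> L2) \<Rightarrow> bool" where
  "schauder_basis e \<longleftrightarrow> (\<forall>f. \<exists>!a :: nat \<Rightarrow> complex. (\<lambda>k. a k *\<^sub>C e k) sums f)"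

end

theory Submission
  imports Defs "HOL-Real_Asymp.Real_Asymp"
begin

text \<open>
  Write \<open>q = s \<pi> / t\<close>. The eigenfunction \<open>f\<^sub>n = e\<^bsup>sn x/t\<^esup> (e\<^bsup>-inx\<^esup>, e\<^bsup>inx\<^esup>)\<close> lives near \<open>x = \<pi>\<close>,
  where it has size \<open>e\<^bsup>qn\<^esup>\<close>, while the eigenfunctions of the adjoint operator live near \<open>x = 0\<close>.
  The two are therefore almost orthogonal compared with their norms, and the projection onto the span
  of \<open>f\<^sub>n\<close> along the other eigenfunctions is large. The constant function \<open>(1, 0)\<close> makes this visible:
  it violates the boundary condition \<open>f\<^sub>1(0) = f\<^sub>2(0)\<close> exactly where the adjoint eigenfunctions live,
  so its component along \<open>f\<^sub>n\<close> has a coefficient \<open>a\<^sub>n\<close> of order \<open>1/n\<close> only. Since \<open>\<parallel>f\<^sub>n\<parallel>\<close> is of order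
  \<open>e\<^bsup>qn\<^esup> n\<^bsup>-1/2\<^esup>\<close>, the component \<open>a\<^sub>n f\<^sub>n\<close> of a fixed function grows exponentially. The lower bounds
  below pair this component with the bounded function \<open>(0, e\<^bsup>inx\<^esup>)\<close>, which costs a further factor
  \<open>n\<^bsup>-1/2\<^esup>\<close>; the resulting quantity is \<open>growth s t n\<close>.

  For the spectral projections, the resolvent has to be understood first. Weak derivatives are
  identified with derivatives of absolutely continuous functions
  (\<open>integration_by_parts_primitive\<close>, \<open>weak_derivative_imp_primitive\<close>); then \<open>z - L\<close> is inverted by
  variation of constants, which succeeds exactly when
  \<open>\<Delta>(z) = e\<^bsup>\<pi>z/u\<^esup> - e\<^bsup>\<pi>z/cnj u\<^esup>\<close> does not vanish (\<open>resolvent_set_L\<close>, \<open>char_det_eq_0_iff\<close>). On the circle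
  of the Riesz integral the resolvent is continuous in operator norm, and the operator space is complete
  because \<open>L\<^sup>2\<close> is; so the operator-valued integral exists and commutes with bounded functionals
  (\<open>cinner_spectral_projection\<close>). Applied to \<open>(1, 0)\<close> and tested against \<open>(0, e\<^bsup>inx\<^esup>)\<close> it becomes the
  integral of an explicit meromorphic function with a simple zero of \<open>\<Delta>\<close> in the denominator, and its
  residue gives the required lower bound (\<open>cinner_probe_spectral_projection\<close>).

  For the basis property, the adjoint eigenfunctions are biorthogonal to the \<open>f\<^sub>n\<close> (\<open>eigfun_biorthogonal\<close>), so they fix the coefficients of every
  convergent expansion. The terms of an expansion of \<open>(1, 0)\<close>, in whatever order, would have to be the
  \<open>a\<^sub>n f\<^sub>n\<close> above, whose norms do not tend to zero (\<open>eigfun_expansion_diverges\<close>).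
\<close>

section \<open>Integration over the interval\<close>

lemma finite_measure_I_meas: "finite_measure I_meas"
  by (intro finite_measure_lebesgue_on) (metis box_real(1) lmeasurable_box)

lemma id_measurable_I_meas [measurable]: "(\<lambda>x. x) \<in> borel_measurable I_meas"
  by (rule continuous_imp_measurable_on_sets_lebesgue) auto

lemma AE_I_meas_mem: "AE x in I_meas. x \<in> {0<..<pi}"
  by (metis AE_space space_lebesgue_on)

lemma measurable_I_meas_continuous:
  fixes f :: "real \<Rightarrow> 'b::euclidean_space"
  assumes "continuous_on {0..pi} f"
  shows "f \<in> borel_measurable I_meas"
  by (rule continuous_imp_measurable_on_sets_lebesgue)
     (auto intro: continuous_on_subset[OF assms])

lemma continuous_bounded_interval:
  fixes f :: "real \<Rightarrow> 'b::real_normed_vector"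
  assumes "continuous_on {0..pi} f"
  obtains K where "K > 0" "\<And>x. x \<in> {0..pi} \<Longrightarrow> norm (f x) \<le> K"
  using compact_imp_bounded[OF compact_continuous_image[OF assms compact_Icc]]
  by (auto simp: bounded_pos)

lemma integrable_I_meas_continuous_bilinear:
  fixes f :: "real \<Rightarrow> 'a::euclidean_space" and h :: "real \<Rightarrow> 'b::euclidean_space"
    and m :: "'a \<Rightarrow> 'b \<Rightarrow> 'c::euclidean_space"
  assumes m: "bounded_bilinear m" and f: "continuous_on {0..pi} f" and h: "integrable I_meas h"
  shows "integrable I_meas (\<lambda>x. m (f x) (h x))"
proof -
  obtain K where K: "\<And>x. x \<in> {0..pi} \<Longrightarrow> norm (f x) \<le> K"
    using continuous_bounded_interval[OF f] by blast
  obtain B where B: "B > 0" "\<And>a b. norm (m a b) \<le> norm a * norm b * B"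
    using bounded_bilinear.pos_bounded[OF m] by blast
  have "integrable I_meas (\<lambda>x. (K * B) *\<^sub>R h x)"
    using h by simp
  then show ?thesis
  proof (rule Bochner_Integration.integrable_bound)
    have "continuous_on UNIV (\<lambda>p. m (fst p) (snd p))"
      by (rule bounded_bilinear.continuous_on[OF m continuous_on_fst[OF continuous_on_id]
            continuous_on_snd[OF continuous_on_id]])
    then show "(\<lambda>x. m (f x) (h x)) \<in> borel_measurable I_meas"
      by (rule borel_measurable_continuous_Pair[OF measurable_I_meas_continuous[OF f]
            borel_measurable_integrable[OF h]])
    show "AE x in I_meas. norm (m (f x) (h x)) \<le> norm ((K * B) *\<^sub>R h x)"
      using AE_I_meas_mem
    proof eventually_elim
      case (elim x)
      then have "norm (f x) \<le> \<bar>K\<bar>"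
        using K[of x] by simp
      then have "norm (f x) * norm (h x) * B \<le> \<bar>K\<bar> * norm (h x) * B"
        using B(1) by (intro mult_right_mono) auto
      with B(2)[of "f x" "h x"] have "norm (m (f x) (h x)) \<le> \<bar>K\<bar> * norm (h x) * B"
        by (rule order_trans)
      with B(1) show ?case
        by (simp add: abs_mult mult_ac)
    qed
  qed
qed

lemmas integrable_I_meas_continuous_mult =
  integrable_I_meas_continuous_bilinear[OF bounded_bilinear_mult]

lemmas integrable_I_meas_continuous_scaleR =
  integrable_I_meas_continuous_bilinear[OF bounded_bilinear_scaleR]

lemma integrable_I_meas_continuous:
  fixes f :: "real \<Rightarrow> complex"
  assumes "continuous_on {0..pi} f"
  shows "integrable I_meas f"
proof -
  interpret finite_measure I_meas by (rule finite_measure_I_meas)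
  show ?thesis
    using integrable_I_meas_continuous_mult[OF assms, of "\<lambda>_. 1"] by simp
qed

lemma I_meas_integral_eq:
  fixes f :: "real \<Rightarrow> 'b::euclidean_space"
  assumes "integrable I_meas f"
  shows "(\<integral>x. f x \<partial>I_meas) = integral {0..pi} f"
  using lebesgue_integral_eq_integral[OF assms]
  by (metis box_real(1) box_real(2) integral_open_interval lebesgue_on_mono lmeasurable_box fmeasurableD)

lemma integrable_I_meas_imp_integrable_on:
  fixes f :: "real \<Rightarrow> 'b::euclidean_space"
  assumes "integrable I_meas f" "0 \<le> a" "b \<le> pi"
  shows "f integrable_on {a..b}"
proof -
  have "(f has_integral (\<integral>x. f x \<partial>I_meas)) {0<..<pi}"
    using assms(1) by (intro has_integral_integral_lebesgue_on) auto
  then have "f integrable_on {0..pi}"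
    by (metis box_real(1) box_real(2) has_integral_Icc_iff_Ioo integrable_on_def)
  then show ?thesis
    by (rule integrable_subinterval_real) (use assms in auto)
qed

lemma continuous_on_primitive:
  fixes h :: "real \<Rightarrow> complex"
  assumes "integrable I_meas h"
  shows "continuous_on {0..pi} (\<lambda>x. integral {0..x} h)"
  by (intro indefinite_integral_continuous_1 integrable_I_meas_imp_integrable_on[OF assms]) auto

text \<open>The form in which Fubini's theorem meets the gauge integral: the variable endpoint moves into the
  integrand, and all integrals are over the fixed measure \<open>I_meas\<close>.\<close>

lemma primitive_eq_lebesgue_integral:
  fixes h :: "real \<Rightarrow> complex"
  assumes "integrable I_meas h" and x: "x \<in> {0<..<pi}"
  shows "(\<integral>y. (if y \<le> x then h y else 0) \<partial>I_meas) = integral {0..x} h"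
    and "(\<integral>y. (if x \<le> y then h y else 0) \<partial>I_meas) = integral {x..pi} h"
proof -
  have *: "integrable I_meas (\<lambda>y. if P y then h y else 0)" if "Measurable.pred I_meas P" for P
    by (rule Bochner_Integration.integrable_bound[OF assms(1)]) (use assms(1) that in auto)
  have "integral {0..pi} (\<lambda>y. if y \<in> {..x} then h y else 0) = integral ({..x} \<inter> {0..pi}) h"
    by (rule Henstock_Kurzweil_Integration.integral_restrict_Int)
  moreover have "{..x} \<inter> {0..pi} = {0..x}"
    using x by auto
  ultimately show "(\<integral>y. (if y \<le> x then h y else 0) \<partial>I_meas) = integral {0..x} h"
    by (subst I_meas_integral_eq) (auto intro!: *)
  have "integral {0..pi} (\<lambda>y. if y \<in> {x..} then h y else 0) = integral ({x..} \<inter> {0..pi}) h"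
    by (rule Henstock_Kurzweil_Integration.integral_restrict_Int)
  moreover have "{x..} \<inter> {0..pi} = {x..pi}"
    using x by auto
  ultimately show "(\<integral>y. (if x \<le> y then h y else 0) \<partial>I_meas) = integral {x..pi} h"
    by (subst I_meas_integral_eq) (auto intro!: *)
qed

text \<open>Both sides are the two iterated integrals of \<open>\<Phi>'(x) h(y)\<close> over the triangle \<open>y \<le> x\<close>. The
  function \<open>\<Phi>\<close> is complex-valued so that exponential factors can be absorbed into it.\<close>

lemma integration_by_parts_primitive:
  fixes h \<Phi> \<Phi>' :: "real \<Rightarrow> complex"
  assumes h: "integrable I_meas h"
    and deriv: "\<And>x. x \<in> {0..pi} \<Longrightarrow> (\<Phi> has_vector_derivative \<Phi>' x) (at x within {0..pi})"
    and cont: "continuous_on {0..pi} \<Phi>'"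
    and \<Phi>: "\<Phi> 0 = 0" "\<Phi> pi = 0"
  shows "(\<integral>x. \<Phi>' x * (c + integral {0..x} h) \<partial>I_meas) = - (\<integral>x. \<Phi> x * h x \<partial>I_meas)"
proof -
  interpret I: finite_measure I_meas by (rule finite_measure_I_meas)
  interpret II: pair_sigma_finite I_meas I_meas ..
  have \<Phi>'_int: "integrable I_meas \<Phi>'"
    by (rule integrable_I_meas_continuous[OF cont])
  note [measurable] = h[THEN borel_measurable_integrable] \<Phi>'_int[THEN borel_measurable_integrable]
  have ftc: "(\<Phi>' has_integral (\<Phi> b - \<Phi> a)) {a..b}" if "0 \<le> a" "a \<le> b" "b \<le> pi" for a b
    using that
    by (intro fundamental_theorem_of_calculus has_vector_derivative_within_subset[OF deriv]) auto
  define k where "k x y = \<Phi>' x * (if y \<le> x then h y else 0)" for x y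
  have k_int: "integrable (I_meas \<Otimes>\<^sub>M I_meas) (\<lambda>(x, y). k x y)"
  proof (rule Bochner_Integration.integrable_bound)
    show "integrable (I_meas \<Otimes>\<^sub>M I_meas) (\<lambda>p. \<Phi>' (fst p) * h (snd p))"
    proof (rule II.Fubini_integrable)
      show "integrable I_meas (\<lambda>x. \<integral>y. norm (\<Phi>' (fst (x, y)) * h (snd (x, y))) \<partial>I_meas)"
        using \<Phi>'_int h by (simp add: norm_mult)
      show "AE x in I_meas. integrable I_meas (\<lambda>y. \<Phi>' (fst (x, y)) * h (snd (x, y)))"
        using h by simp
    qed measurable
    show "(\<lambda>(x, y). k x y) \<in> borel_measurable (I_meas \<Otimes>\<^sub>M I_meas)"
      unfolding k_def by measurable
  qed (auto simp: k_def norm_mult)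
  have inner: "(\<integral>x. k x y \<partial>I_meas) = - (\<Phi> y * h y)" if y: "y \<in> {0<..<pi}" for y
  proof -
    have "(\<integral>x. k x y \<partial>I_meas) = (\<integral>x. (if y \<le> x then \<Phi>' x else 0) * h y \<partial>I_meas)"
      by (rule Bochner_Integration.integral_cong) (auto simp: k_def)
    also have "\<dots> = (\<Phi> pi - \<Phi> y) * h y"
      using primitive_eq_lebesgue_integral(2)[OF \<Phi>'_int y] ftc[of y pi] y
      by (simp add: integral_unique)
    finally show ?thesis
      by (simp add: \<Phi>)
  qed
  have "(\<integral>x. \<Phi>' x * integral {0..x} h \<partial>I_meas) = (\<integral>x. \<integral>y. k x y \<partial>I_meas \<partial>I_meas)"
    by (rule Bochner_Integration.integral_cong)
       (auto simp: k_def primitive_eq_lebesgue_integral(1)[OF h])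
  also have "\<dots> = (\<integral>y. \<integral>x. k x y \<partial>I_meas \<partial>I_meas)"
    using k_int by (rule II.Fubini_integral[symmetric])
  also have "\<dots> = (\<integral>y. - (\<Phi> y * h y) \<partial>I_meas)"
    by (rule Bochner_Integration.integral_cong) (auto simp: inner)
  finally have main: "(\<integral>x. \<Phi>' x * integral {0..x} h \<partial>I_meas) = - (\<integral>x. \<Phi> x * h x \<partial>I_meas)"
    by simp
  have "(\<integral>x. \<Phi>' x * c \<partial>I_meas) = 0"
    using ftc[of 0 pi] \<Phi> by (simp add: I_meas_integral_eq[OF \<Phi>'_int] integral_unique)
  moreover have "integrable I_meas (\<lambda>x. \<Phi>' x * integral {0..x} h)"
    by (intro integrable_I_meas_continuous continuous_intros cont continuous_on_primitive h)
  ultimately show ?thesis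
    using main \<Phi>'_int by (simp add: distrib_left)
qed

section \<open>Weak derivatives of scalar functions\<close>

text \<open>The scalar counterpart of \<open>has_weak_deriv\<close>, stated for functions instead of classes.\<close>

definition weak_derivative :: "(real \<Rightarrow> complex) \<Rightarrow> (real \<Rightarrow> complex) \<Rightarrow> bool" where
  "weak_derivative f g \<longleftrightarrow> (\<forall>\<phi> \<phi>'. test_function \<phi> \<phi>' \<longrightarrow>
      (\<integral>x. \<phi>' x *\<^sub>R f x \<partial>I_meas) = - (\<integral>x. \<phi> x *\<^sub>R g x \<partial>I_meas))"

lemma test_function_continuous:
  assumes "test_function \<phi> \<phi>'"
  shows "continuous_on S \<phi>" "continuous_on S \<phi>'"
  using assms unfolding test_function_def
  by (blast intro: continuous_at_imp_continuous_on DERIV_isCont continuous_on_subset)+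

lemma test_function_ends:
  assumes "test_function \<phi> \<phi>'"
  shows "\<phi> 0 = 0" "\<phi> pi = 0"
proof -
  obtain a b where "0 < a" "b < pi" "\<And>x. x \<notin> {a..b} \<Longrightarrow> \<phi> x = 0"
    using assms unfolding test_function_def by blast
  then show "\<phi> 0 = 0" "\<phi> pi = 0"
    by auto
qed

text \<open>This is the product rule for a smooth factor and an absolutely continuous one. Instead of
  differentiating the product, the exponential is moved onto the test function, which reduces the
  claim to integration by parts for the primitive alone.\<close>

lemma weak_derivative_exp_primitive:
  fixes h :: "real \<Rightarrow> complex" and a \<alpha> :: complex
  assumes h: "integrable I_meas h"
  defines "F \<equiv> \<lambda>x. exp (\<alpha> * of_real x) * (a + integral {0..x} h)"
  shows "weak_derivative F (\<lambda>x. \<alpha> * F x + exp (\<alpha> * of_real x) * h x)"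
  unfolding weak_derivative_def
proof (intro allI impI)
  fix \<phi> \<phi>' assume \<phi>: "test_function \<phi> \<phi>'"
  define e where "e x = exp (\<alpha> * complex_of_real x)" for x
  have e_cont: "continuous_on S e" for S
    unfolding e_def by (intro continuous_intros)
  have e_deriv: "(e has_vector_derivative \<alpha> * e x) (at x within S)" for x S
    unfolding e_def by (rule has_vector_derivative_real_field) (auto intro!: derivative_eq_intros)
  define \<Phi> where "\<Phi> x = complex_of_real (\<phi> x) * e x" for x
  define \<Phi>' where "\<Phi>' x = complex_of_real (\<phi>' x) * e x + \<alpha> * (complex_of_real (\<phi> x) * e x)" for x
  note cont = test_function_continuous[OF \<phi>, of "{0..pi}"]
  have F_cont: "continuous_on {0..pi} F"
    unfolding F_def by (intro continuous_intros continuous_on_primitive h)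
  have eh: "integrable I_meas (\<lambda>x. e x * h x)"
    by (rule integrable_I_meas_continuous_mult[OF e_cont h])
  have deriv: "(\<Phi> has_vector_derivative \<Phi>' x) (at x within {0..pi})" for x
  proof -
    have "(\<phi> has_vector_derivative \<phi>' x) (at x within {0..pi})"
      using \<phi> unfolding test_function_def
      by (metis has_field_derivative_at_within has_real_derivative_iff_has_vector_derivative)
    then have "((\<lambda>x. complex_of_real (\<phi> x)) has_vector_derivative of_real (\<phi>' x)) (at x within {0..pi})"
      by (rule bounded_linear.has_vector_derivative[OF bounded_linear_of_real])
    from has_vector_derivative_mult[OF this e_deriv]
    show ?thesis
      by (simp add: \<Phi>_def[abs_def] \<Phi>'_def algebra_simps)
  qed
  have "(\<integral>x. \<Phi>' x * (a + integral {0..x} h) \<partial>I_meas) = - (\<integral>x. \<Phi> x * h x \<partial>I_meas)"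
  proof (rule integration_by_parts_primitive[OF h deriv])
    show "continuous_on {0..pi} \<Phi>'"
      unfolding \<Phi>'_def by (intro continuous_intros cont e_cont)
  qed (simp_all add: \<Phi>_def test_function_ends[OF \<phi>])
  also have "(\<lambda>x. \<Phi>' x * (a + integral {0..x} h)) = (\<lambda>x. \<phi>' x *\<^sub>R F x + \<phi> x *\<^sub>R (\<alpha> * F x))"
    by (auto simp: \<Phi>'_def F_def e_def scaleR_conv_of_real algebra_simps)
  also have "(\<lambda>x. \<Phi> x * h x) = (\<lambda>x. \<phi> x *\<^sub>R (e x * h x))"
    by (auto simp: \<Phi>_def scaleR_conv_of_real)
  finally have "(\<integral>x. \<phi>' x *\<^sub>R F x + \<phi> x *\<^sub>R (\<alpha> * F x) \<partial>I_meas) = - (\<integral>x. \<phi> x *\<^sub>R (e x * h x) \<partial>I_meas)" .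
  moreover have "integrable I_meas (\<lambda>x. \<phi>' x *\<^sub>R F x)" "integrable I_meas (\<lambda>x. \<phi> x *\<^sub>R (\<alpha> * F x))"
    by (intro integrable_I_meas_continuous continuous_intros cont F_cont)+
  moreover have "integrable I_meas (\<lambda>x. \<phi> x *\<^sub>R (e x * h x))"
    by (rule integrable_I_meas_continuous_scaleR[OF cont(1) eh])
  ultimately have "(\<integral>x. \<phi>' x *\<^sub>R F x \<partial>I_meas)
      = - (\<integral>x. \<phi> x *\<^sub>R (\<alpha> * F x) + \<phi> x *\<^sub>R (e x * h x) \<partial>I_meas)"
    by (simp add: eq_neg_iff_add_eq_0 add.assoc del: minus_add_distrib)
  then show "(\<integral>x. \<phi>' x *\<^sub>R F x \<partial>I_meas)
      = - (\<integral>x. \<phi> x *\<^sub>R (\<alpha> * F x + exp (\<alpha> * complex_of_real x) * h x) \<partial>I_meas)"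
    by (simp add: scaleR_add_right e_def)
qed

lemma weak_derivative_primitive:
  assumes "integrable I_meas h"
  shows "weak_derivative (\<lambda>x. integral {0..x} h) h"
  using weak_derivative_exp_primitive[OF assms, of 0 0] by simp

lemma DERIV_squared_positive_part:
  "((\<lambda>x::real. (max 0 x)\<^sup>2) has_real_derivative 2 * max 0 x) (at x)"
proof (cases x "0::real" rule: linorder_cases)
  case less
  have "((\<lambda>_. 0) has_real_derivative 2 * max 0 x) (at x)"
    using less by simp
  then show ?thesis
    by (rule has_field_derivative_transform_within_open[of _ _ _ "{..<0}"]) (use less in auto)
next
  case greater
  have "((\<lambda>x. x\<^sup>2) has_real_derivative 2 * max 0 x) (at x)"
    using greater by (auto intro!: derivative_eq_intros)
  then show ?thesis
    by (rule has_field_derivative_transform_within_open[of _ _ _ "{0<..}"]) (use greater in auto)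
next
  case equal
  have "((\<lambda>y::real. max 0 y) \<longlongrightarrow> 0) (at 0)"
    using tendsto_max[OF tendsto_const[of 0] tendsto_ident_at[of "0::real" UNIV]] by simp
  then have "((\<lambda>y::real. ((max 0 y)\<^sup>2 - (max 0 0)\<^sup>2) / (y - 0)) \<longlongrightarrow> 0) (at 0)"
    by (rule Lim_transform_eventually)
       (auto simp: eventually_at_filter max_def power2_eq_square)
  then show ?thesis
    using equal by (simp add: has_field_derivative_iff)
qed

text \<open>The functions \<open>k\<psi> / (1 + k\<psi>)\<close> saturate to the indicator of the set where \<open>\<psi> > 0\<close>. Here
  \<open>\<psi>(x) = (x - a)\<^sub>+\<^sup>2 (b - x)\<^sub>+\<^sup>2\<close> is a \<open>C\<^sup>1\<close> bump.\<close>

lemma test_functions_approximating_indicator: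
  assumes ab: "0 < a" "a < b" "b < pi"
  obtains \<phi> \<phi>' where "\<And>k::nat. test_function (\<phi> k) (\<phi>' k)"
    "\<And>k x. \<bar>\<phi> k x\<bar> \<le> 1" "\<And>x. (\<lambda>k. \<phi> k x) \<longlonglongrightarrow> indicator {a<..<b} x"
proof -
  define \<psi> where "\<psi> x = (max 0 (x - a))\<^sup>2 * (max 0 (b - x))\<^sup>2" for x
  define \<psi>' where "\<psi>' x = 2 * max 0 (x - a) * (max 0 (b - x))\<^sup>2 - (max 0 (x - a))\<^sup>2 * (2 * max 0 (b - x))" for x
  define \<phi> where "\<phi> k x = 1 - 1 / (1 + real k * \<psi> x)" for k x
  define \<phi>' where "\<phi>' k x = real k * \<psi>' x / (1 + real k * \<psi> x)\<^sup>2" for k x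
  have \<psi>_nonneg: "\<psi> x \<ge> 0" for x
    by (simp add: \<psi>_def)
  have denom: "1 + real k * \<psi> x > 0" for k x
    using \<psi>_nonneg[of x] by (simp add: add_pos_nonneg)
  have \<psi>_deriv: "(\<psi> has_real_derivative \<psi>' x) (at x)" for x
    unfolding \<psi>_def \<psi>'_def
    by (rule derivative_eq_intros DERIV_chain'[OF _ DERIV_squared_positive_part] refl | simp)+
  have deriv: "(\<phi> k has_real_derivative \<phi>' k x) (at x)" for k x
    unfolding \<phi>_def \<phi>'_def using denom[of k x]
    by (auto intro!: derivative_eq_intros \<psi>_deriv simp: power2_eq_square)
  have "continuous_on UNIV \<psi>" "continuous_on UNIV \<psi>'"
    unfolding \<psi>_def \<psi>'_def by (intro continuous_intros)+
  then have cont: "continuous_on UNIV (\<phi>' k)" for k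
    unfolding \<phi>'_def using denom[of k] by (intro continuous_intros) (auto simp: less_le)
  have supp: "\<phi> k x = 0" if "x \<notin> {a..b}" for k x
    using that by (auto simp: \<phi>_def \<psi>_def max_def)
  show ?thesis
  proof (rule that[of \<phi> \<phi>'])
    show "test_function (\<phi> k) (\<phi>' k)" for k
      unfolding test_function_def using deriv cont supp ab by blast
    show "\<bar>\<phi> k x\<bar> \<le> 1" for k x
      using denom[of k x] \<psi>_nonneg[of x] by (simp add: \<phi>_def field_simps)
    show "(\<lambda>k. \<phi> k x) \<longlonglongrightarrow> indicator {a<..<b} x" for x
    proof (cases "x \<in> {a<..<b}")
      case True
      then have "\<psi> x > 0"
        by (auto simp: \<psi>_def)
      then have "filterlim (\<lambda>k. 1 + real k * \<psi> x) at_top sequentially"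
        by real_asymp
      then have "(\<lambda>k. 1 - 1 / (1 + real k * \<psi> x)) \<longlonglongrightarrow> 1 - 0"
        by (intro tendsto_intros tendsto_divide_0[OF tendsto_const] filterlim_at_top_imp_at_infinity)
      with True show ?thesis
        by (simp add: \<phi>_def)
    next
      case False
      then have "\<psi> x = 0"
        by (auto simp: \<psi>_def max_def)
      with False show ?thesis
        by (simp add: \<phi>_def)
    qed
  qed
qed

text \<open>Almost every point is a point where the means over short intervals converge to the value of the
  function.\<close>

lemma AE_zero_if_integrals_zero:
  fixes g :: "real \<Rightarrow> complex"
  assumes g: "integrable I_meas g"
    and zero: "\<And>a b. 0 < a \<Longrightarrow> a < b \<Longrightarrow> b < pi \<Longrightarrow> integral {a..b} g = 0"
  shows "AE x in I_meas. g x = 0"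
proof -
  define G where "G x = (if x \<in> {0..pi} then g x else 0)" for x
  have "G integrable_on UNIV"
    unfolding G_def integrable_restrict_UNIV
    by (rule integrable_I_meas_imp_integrable_on[OF g]) auto
  then have "G integrable_on cbox a b" for a b
    by (rule integrable_on_subcbox) auto
  then obtain N where N: "negligible N"
    and lim: "\<And>x e. x \<notin> N \<Longrightarrow> 0 < e \<Longrightarrow> \<exists>d>0. \<forall>h. 0 < h \<and> h < d \<longrightarrow>
       norm (integral (cbox x (x + h *\<^sub>R One)) G /\<^sub>R h ^ DIM(real) - G x) < e"
    using integrable_ccontinuous_explicit[of G] by metis
  have off_N: "g x = 0" if x: "x \<in> {0<..<pi}" "x \<notin> N" for x
  proof (rule ccontr)
    assume "g x \<noteq> 0"
    with lim[OF x(2), of "norm (g x)"] obtain d where d: "d > 0"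
      "\<And>h. 0 < h \<Longrightarrow> h < d \<Longrightarrow> norm (integral {x..x + h} G /\<^sub>R h - G x) < norm (g x)"
      by auto
    define h where "h = min (d / 2) ((pi - x) / 2)"
    have h: "0 < h" "h < d" "x + h < pi"
      using d(1) x(1) by (auto simp: h_def min_def field_simps)
    have "integral {x..x + h} G = integral {x..x + h} g"
      using x h by (intro Henstock_Kurzweil_Integration.integral_cong) (auto simp: G_def)
    also have "\<dots> = 0"
      using zero[of x "x + h"] x h by simp
    finally show False
      using d(2)[OF h(1,2)] x by (simp add: G_def)
  qed
  have "AE x in I_meas. x \<notin> N"
    using AE_not_in[of N lebesgue] N by (auto simp: AE_restrict_space_iff negligible_iff_null_sets elim: eventually_mono)
  with AE_I_meas_mem show ?thesis
    by eventually_elim (rule off_N)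
qed

text \<open>Letting the test functions approach an indicator turns the assumption into the vanishing of the
  integral over that interval.\<close>

lemma fundamental_lemma_calculus_of_variations:
  assumes g: "integrable I_meas g"
    and zero: "\<And>\<phi> \<phi>'. test_function \<phi> \<phi>' \<Longrightarrow> (\<integral>x. \<phi> x *\<^sub>R g x \<partial>I_meas) = 0"
  shows "AE x in I_meas. g x = (0 :: complex)"
proof (rule AE_zero_if_integrals_zero[OF g])
  fix a b :: real assume ab: "0 < a" "a < b" "b < pi"
  obtain \<phi> \<phi>' where \<phi>: "\<And>k::nat. test_function (\<phi> k) (\<phi>' k)"
    "\<And>k x. \<bar>\<phi> k x\<bar> \<le> 1" "\<And>x. (\<lambda>k. \<phi> k x) \<longlonglongrightarrow> indicator {a<..<b} x"
    using test_functions_approximating_indicator[OF ab] by blast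
  note [measurable] = test_function_measurable(1)[OF \<phi>(1)] borel_measurable_integrable[OF g]
  have "(\<lambda>k. \<integral>x. \<phi> k x *\<^sub>R g x \<partial>I_meas) \<longlonglongrightarrow> (\<integral>x. indicator {a<..<b} x *\<^sub>R g x \<partial>I_meas)"
  proof (rule integral_dominated_convergence)
    show "integrable I_meas (\<lambda>x. norm (g x))"
      using g by simp
    show "AE x in I_meas. (\<lambda>k. \<phi> k x *\<^sub>R g x) \<longlonglongrightarrow> indicator {a<..<b} x *\<^sub>R g x"
      by (intro AE_I2 tendsto_intros \<phi>(3))
    show "AE x in I_meas. norm (\<phi> k x *\<^sub>R g x) \<le> norm (g x)" for k
      using \<phi>(2)[of k] by (auto intro!: AE_I2 mult_left_le_one_le)
  qed measurable
  then have "(\<integral>x. indicator {a<..<b} x *\<^sub>R g x \<partial>I_meas) = 0"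
    using zero[OF \<phi>(1)] by (simp add: LIMSEQ_const_iff)
  moreover have "integrable I_meas (\<lambda>x. indicator {a<..<b} x *\<^sub>R g x)"
    by (rule Bochner_Integration.integrable_bound[OF g]) (auto simp: indicator_def)
  ultimately have "integral {0..pi} (\<lambda>x. indicator {a<..<b} x *\<^sub>R g x) = 0"
    using I_meas_integral_eq by metis
  also have "(\<lambda>x. indicator {a<..<b} x *\<^sub>R g x) = (\<lambda>x. if x \<in> {a<..<b} then g x else 0)"
    by (auto simp: indicator_def)
  also have "integral {0..pi} \<dots> = integral ({a<..<b} \<inter> {0..pi}) g"
    by (rule Henstock_Kurzweil_Integration.integral_restrict_Int)
  also have "{a<..<b} \<inter> {0..pi} = {a<..<b}"
    using ab by auto
  finally show "integral {a..b} g = 0"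
    by (metis box_real(1) box_real(2) integral_open_interval)
qed

lemma test_function_antiderivative:
  fixes \<eta> :: "real \<Rightarrow> real"
  assumes cont: "continuous_on UNIV \<eta>" and ab: "0 < a" "a < b" "b < pi"
    and supp: "\<And>x. x \<notin> {a..b} \<Longrightarrow> \<eta> x = 0" and mean: "integral {0..pi} \<eta> = 0"
  shows "\<exists>\<phi>. test_function \<phi> \<eta>"
proof -
  define \<phi> where "\<phi> x = integral {0..x} \<eta>" for x
  have int: "\<eta> integrable_on {c..d}" for c d
    by (rule integrable_continuous_real) (rule continuous_on_subset[OF cont], simp)
  have left: "\<phi> x = 0" if "x < a" for x
  proof -
    have "integral {0..x} \<eta> = integral {0..x} (\<lambda>_. 0)"
      by (rule Henstock_Kurzweil_Integration.integral_cong) (use that supp in auto)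
    then show ?thesis
      by (simp add: \<phi>_def)
  qed
  have tail: "integral {c..d} \<eta> = 0" if "c > b" for c d
  proof -
    have "integral {c..d} \<eta> = integral {c..d} (\<lambda>_. 0)"
      by (rule Henstock_Kurzweil_Integration.integral_cong) (use that supp in auto)
    then show ?thesis
      by simp
  qed
  have right: "\<phi> x = 0" if "x > b" for x
  proof (cases "x \<le> pi")
    case True
    have "integral {0..x} \<eta> + integral {x..pi} \<eta> = integral {0..pi} \<eta>"
      by (rule Henstock_Kurzweil_Integration.integral_combine) (use True that ab int in auto)
    then show ?thesis
      using tail[OF that] mean by (simp add: \<phi>_def)
  next
    case False
    have "integral {0..pi} \<eta> + integral {pi..x} \<eta> = integral {0..x} \<eta>"
      by (rule Henstock_Kurzweil_Integration.integral_combine) (use False int in auto)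
    then show ?thesis
      using tail[OF ab(3)] mean by (simp add: \<phi>_def)
  qed
  have deriv: "(\<phi> has_real_derivative \<eta> x) (at x)" for x
  proof (cases "x < a")
    case True
    have "((\<lambda>_. 0) has_real_derivative \<eta> x) (at x)"
      using True supp by simp
    then show ?thesis
      by (rule has_field_derivative_transform_within_open[of _ _ _ "{..<a}"])
         (use True left in auto)
  next
    case False
    have "(\<phi> has_real_derivative \<eta> x) (at x within {0..x + 1})"
      unfolding \<phi>_def using False ab
      by (intro integral_has_real_derivative continuous_on_subset[OF cont]) auto
    moreover have "at x within {0..x + 1} = at x"
      using False ab by (intro at_within_interior) auto
    ultimately show ?thesis
      by simp
  qed
  have "test_function \<phi> \<eta>"
    unfolding test_function_def using deriv cont left right ab
    by (metis atLeastAtMost_iff linorder_not_less)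
  then show ?thesis
    by blast
qed

text \<open>The du Bois-Reymond argument: every test function becomes the derivative of a test function after
  subtracting a multiple of a fixed \<open>\<psi>0\<close> with nonzero integral, so \<open>h\<close> minus its \<open>\<psi>0\<close>-mean is
  annihilated by all test functions.\<close>

lemma AE_const_if_weak_derivative_zero:
  assumes h: "integrable I_meas h" and weak: "weak_derivative h (\<lambda>_. 0)"
  shows "\<exists>c. AE x in I_meas. h x = c"
proof -
  interpret finite_measure I_meas by (rule finite_measure_I_meas)
  have int1: "integrable I_meas \<psi>" if "test_function \<psi> \<psi>'" for \<psi> \<psi>'
    using integrable_I_meas_continuous_mult[OF test_function_continuous(1)[OF that], of "\<lambda>_. 1"]
    by simp
  have int2: "integrable I_meas (\<lambda>x. \<psi> x *\<^sub>R f x)" 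
    if "test_function \<psi> \<psi>'" "integrable I_meas f" for \<psi> \<psi>' and f :: "real \<Rightarrow> complex"
    by (rule integrable_I_meas_continuous_scaleR[OF test_function_continuous(1)[OF that(1)] that(2)])
  \<comment> \<open>If all test functions had integral zero, then the constant 1 would vanish almost everywhere.\<close>
  obtain \<psi>0 \<psi>0' where \<psi>0: "test_function \<psi>0 \<psi>0'" "(\<integral>x. \<psi>0 x \<partial>I_meas) \<noteq> 0"
  proof (rule ccontr, goal_cases)
    case 1
    have *: "(\<integral>x. \<psi> x \<partial>I_meas) = 0" if "test_function \<psi> \<psi>'" for \<psi> \<psi>'
      using that 1 by blast
    have "AE x in I_meas. (1 :: complex) = 0"
    proof (rule fundamental_lemma_calculus_of_variations)
      fix \<psi> \<psi>' assume "test_function \<psi> \<psi>'"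
      then show "(\<integral>x. \<psi> x *\<^sub>R (1 :: complex) \<partial>I_meas) = 0"
        using *[of \<psi> \<psi>'] int1[of \<psi> \<psi>'] by simp
    qed simp
    then have "ae_filter I_meas = bot"
      by (simp add: trivial_limit_def)
    then have "emeasure I_meas (space I_meas) = 0"
      unfolding ae_filter_eq_bot_iff .
    then show False
      by (simp add: emeasure_restrict_space)
  qed
  define m0 where "m0 = (\<integral>x. \<psi>0 x \<partial>I_meas)"
  define c where "c = (\<integral>x. \<psi>0 x *\<^sub>R h x \<partial>I_meas) /\<^sub>R m0"
  have "AE x in I_meas. h x - c = 0"
  proof (rule fundamental_lemma_calculus_of_variations)
    show "integrable I_meas (\<lambda>x. h x - c)"
      using h by simp
    fix \<psi> \<psi>' assume \<psi>: "test_function \<psi> \<psi>'"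
    define m where "m = (\<integral>x. \<psi> x \<partial>I_meas)"
    define \<eta> where "\<eta> x = \<psi> x - m / m0 * \<psi>0 x" for x
    obtain a b where ab: "0 < a" "a < b" "b < pi" "\<And>x. x \<notin> {a..b} \<Longrightarrow> \<psi> x = 0"
      using \<psi> unfolding test_function_def by blast
    obtain a0 b0 where ab0: "0 < a0" "a0 < b0" "b0 < pi" "\<And>x. x \<notin> {a0..b0} \<Longrightarrow> \<psi>0 x = 0"
      using \<psi>0(1) unfolding test_function_def by blast
    have "\<exists>\<phi>. test_function \<phi> \<eta>"
    proof (rule test_function_antiderivative[of \<eta> "min a a0" "max b b0"])
      show "continuous_on UNIV \<eta>"
        unfolding \<eta>_def by (intro continuous_intros test_function_continuous[OF \<psi>] test_function_continuous[OF \<psi>0(1)])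
      show "0 < min a a0" "min a a0 < max b b0" "max b b0 < pi"
        using ab ab0 by auto
      show "\<eta> x = 0" if "x \<notin> {min a a0..max b b0}" for x
      proof -
        from that have "x \<notin> {a..b}" "x \<notin> {a0..b0}"
          by auto
        then show ?thesis
          using ab(4) ab0(4) by (simp add: \<eta>_def)
      qed
      have \<eta>_int: "integrable I_meas \<eta>"
        unfolding \<eta>_def using int1[OF \<psi>] int1[OF \<psi>0(1)] by simp
      have "(\<integral>x. \<eta> x \<partial>I_meas) = m - m / m0 * m0"
        unfolding \<eta>_def m_def m0_def using int1[OF \<psi>] int1[OF \<psi>0(1)]
        by (subst Bochner_Integration.integral_diff) auto
      also have "\<dots> = 0"
        using \<psi>0(2) by (simp add: m0_def)
      finally show "integral {0..pi} \<eta> = 0"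
        using I_meas_integral_eq[OF \<eta>_int] by simp
    qed
    then obtain \<phi> where \<phi>: "test_function \<phi> \<eta>" ..
    have "0 = (\<integral>x. \<eta> x *\<^sub>R h x \<partial>I_meas)"
      using weak \<phi> by (simp add: weak_derivative_def)
    also have "\<dots> = (\<integral>x. \<psi> x *\<^sub>R h x - (m / m0) *\<^sub>R (\<psi>0 x *\<^sub>R h x) \<partial>I_meas)"
      by (simp add: \<eta>_def scaleR_diff_left)
    also have "\<dots> = (\<integral>x. \<psi> x *\<^sub>R h x \<partial>I_meas) - m *\<^sub>R c"
      using int2[OF \<psi> h] int2[OF \<psi>0(1) h]
      by (subst Bochner_Integration.integral_diff) (auto simp: c_def divide_inverse simp del: scaleR_scaleR, simp)
    also have "m *\<^sub>R c = (\<integral>x. \<psi> x *\<^sub>R c \<partial>I_meas)"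
      using int1[OF \<psi>] by (simp add: m_def)
    also have "(\<integral>x. \<psi> x *\<^sub>R h x \<partial>I_meas) - \<dots> = (\<integral>x. \<psi> x *\<^sub>R (h x - c) \<partial>I_meas)"
      using int2[OF \<psi> h] int2[OF \<psi>, of "\<lambda>_. c"] by (simp add: scaleR_diff_right)
    finally show "(\<integral>x. \<psi> x *\<^sub>R (h x - c) \<partial>I_meas) = 0" ..
  qed
  then have "AE x in I_meas. h x = c"
    by (auto elim: eventually_mono)
  then show ?thesis
    by (rule exI[where x = c])
qed

lemma weak_derivative_imp_primitive:
  assumes f: "integrable I_meas f" and g: "integrable I_meas g" and weak: "weak_derivative f g"
  shows "\<exists>c. AE x in I_meas. f x = c + integral {0..x} g"
proof -
  let ?G = "\<lambda>x. integral {0..x} g"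
  have G: "integrable I_meas ?G"
    by (intro integrable_I_meas_continuous continuous_on_primitive g)
  have "weak_derivative (\<lambda>x. f x - ?G x) (\<lambda>_. 0)"
    unfolding weak_derivative_def
  proof (intro allI impI)
    fix \<phi> \<phi>' assume \<phi>: "test_function \<phi> \<phi>'"
    note int = integrable_I_meas_continuous_scaleR[OF test_function_continuous(2)[OF \<phi>]]
    have "(\<integral>x. \<phi>' x *\<^sub>R f x \<partial>I_meas) = (\<integral>x. \<phi>' x *\<^sub>R ?G x \<partial>I_meas)"
      using weak weak_derivative_primitive[OF g] \<phi> by (simp add: weak_derivative_def)
    then show "(\<integral>x. \<phi>' x *\<^sub>R (f x - ?G x) \<partial>I_meas) = - (\<integral>x. \<phi> x *\<^sub>R 0 \<partial>I_meas)"
      using int[OF f] int[OF G] by (simp add: scaleR_diff_right)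
  qed
  then have "\<exists>c. AE x in I_meas. f x - ?G x = c"
    by (rule AE_const_if_weak_derivative_zero[rotated]) (use f G in simp)
  then obtain c where "AE x in I_meas. f x - ?G x = c"
    by (rule exE)
  then have "AE x in I_meas. f x = c + ?G x"
    by eventually_elim (simp add: diff_eq_eq)
  then show ?thesis
    by (rule exI[where x = c])
qed

section \<open>The Hilbert space\<close>

lemma L2_of_eq_iff:
  assumes "square_integrable f" "square_integrable g"
  shows "L2_of f = L2_of g \<longleftrightarrow> (AE x in I_meas. f x = g x)"
  using Quotient_rel[OF Quotient_L2, of f g] assms by auto

lemma L2_cases:
  obtains f where "square_integrable f" "F = L2_of f"
  by (induction F rule: L2.abs_induct) auto

lemma L2_ex_representative: "\<exists>f. square_integrable f \<and> F = L2_of f"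
  by (rule L2_cases[of F]) auto

lemma L2_of_add:
  "square_integrable f \<Longrightarrow> square_integrable g \<Longrightarrow> L2_of f + L2_of g = L2_of (\<lambda>x. f x + g x)"
  by (rule plus_L2.abs_eq) auto

lemma L2_of_scaleR:
  "square_integrable f \<Longrightarrow> r *\<^sub>R L2_of f = L2_of (\<lambda>x. r *\<^sub>R f x)"
  by (rule scaleR_L2.abs_eq) auto

lemma L2_of_diag_mult:
  "square_integrable f \<Longrightarrow> diag_mult a b (L2_of f) = L2_of (\<lambda>x. (a * fst (f x), b * snd (f x)))"
  by (rule diag_mult.abs_eq) auto

lemma L2_of_scaleC:
  "square_integrable f \<Longrightarrow> c *\<^sub>C L2_of f = L2_of (\<lambda>x. (c * fst (f x), c * snd (f x)))"
  by (simp add: scaleC_def L2_of_diag_mult)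

lemma L2_of_inner:
  "square_integrable f \<Longrightarrow> square_integrable g \<Longrightarrow> L2_of f \<bullet> L2_of g = (\<integral>x. f x \<bullet> g x \<partial>I_meas)"
  by (rule inner_L2.abs_eq) auto

lemma square_integrable_diff:
  assumes "square_integrable f" "square_integrable g"
  shows "square_integrable (\<lambda>x. f x - g x)"
  using square_integrable_add[OF assms(1) square_integrable_scaleR[OF assms(2), of "-1"]] by simp

lemma L2_of_diff:
  assumes "square_integrable f" "square_integrable g"
  shows "L2_of f - L2_of g = L2_of (\<lambda>x. f x - g x)"
proof -
  have "L2_of f - L2_of g = L2_of f + (- 1) *\<^sub>R L2_of g"
    by simp
  also have "\<dots> = L2_of (\<lambda>x. f x + (- 1) *\<^sub>R g x)"
    by (simp only: L2_of_scaleR L2_of_add square_integrable_scaleR assms)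
  also have "\<dots> = L2_of (\<lambda>x. f x - g x)"
    by simp
  finally show ?thesis .
qed

lemma norm_L2_of_squared:
  assumes "square_integrable f"
  shows "(norm (L2_of f))\<^sup>2 = (\<integral>x. (norm (f x))\<^sup>2 \<partial>I_meas)"
  by (simp add: power2_norm_eq_inner L2_of_inner assms)

lemma measure_I_meas: "measure I_meas (space I_meas) = pi"
  by (simp add: measure_restrict_space)

lemma square_integrable_bounded:
  assumes [measurable]: "f \<in> borel_measurable I_meas"
    and bound: "\<And>x. x \<in> {0<..<pi} \<Longrightarrow> norm (f x) \<le> K"
  shows "square_integrable f" "norm (L2_of f) \<le> sqrt pi * K"
proof -
  interpret finite_measure I_meas by (rule finite_measure_I_meas)
  have bound2: "AE x in I_meas. (norm (f x))\<^sup>2 \<le> K\<^sup>2"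
    using AE_I_meas_mem by eventually_elim (auto intro!: power_mono bound)
  have int: "integrable I_meas (\<lambda>x. (norm (f x))\<^sup>2)"
    by (rule integrable_const_bound[of _ "K\<^sup>2"]) (use bound2 in auto)
  then show sq: "square_integrable f"
    by (simp add: square_integrable_def)
  have "K \<ge> 0"
    using bound[of 1] pi_gt3 norm_ge_zero[of "f 1"] by (smt (verit) greaterThanLessThan_iff)
  have "(norm (L2_of f))\<^sup>2 \<le> (\<integral>x. K\<^sup>2 \<partial>I_meas)"
    unfolding norm_L2_of_squared[OF sq] by (rule integral_mono_AE[OF int _ bound2]) simp
  also have "\<dots> = (sqrt pi * K)\<^sup>2"
    using measure_I_meas by (simp add: power_mult_distrib)
  finally show "norm (L2_of f) \<le> sqrt pi * K"
    by (rule power2_le_imp_le) (use \<open>K \<ge> 0\<close> in simp)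
qed

lemma square_integrable_continuous:
  assumes "continuous_on {0..pi} f"
  shows "square_integrable f"
proof -
  obtain K where "\<And>x. x \<in> {0..pi} \<Longrightarrow> norm (f x) \<le> K"
    using continuous_bounded_interval[OF assms] by blast
  then show ?thesis
    by (intro square_integrable_bounded(1)[of _ K] measurable_I_meas_continuous assms) auto
qed


text \<open>Cauchy--Schwarz for \<open>norm f\<close> and the constant 1, both carried by the first component.\<close>

lemma L1_le_L2:
  assumes "square_integrable f"
  shows "integrable I_meas f" "(\<integral>x. norm (f x) \<partial>I_meas) \<le> sqrt pi * norm (L2_of f)"
proof -
  define g where "g x = (complex_of_real (norm (f x)), 0 :: complex)" for x
  define e where "e = (\<lambda>x :: real. (1 :: complex, 0 :: complex))"
  have "continuous_on UNIV (\<lambda>p :: complex \<times> complex. (complex_of_real (norm p), 0 :: complex))"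
    by (intro continuous_intros)
  from borel_measurable_continuous_on[OF this square_integrable_measurable[OF assms]]
  have "g \<in> borel_measurable I_meas"
    by (simp only: g_def[abs_def])
  then have g: "square_integrable g"
    using assms by (simp add: square_integrable_def g_def norm_Pair)
  have e_meas: "e \<in> borel_measurable I_meas"
    unfolding e_def by (rule measurable_const) simp
  have e_norm: "norm (e x) \<le> 1" for x
    by (simp add: e_def norm_Pair)
  note e = square_integrable_bounded[OF e_meas e_norm]
  have "integrable I_meas (\<lambda>x. g x \<bullet> e x)"
    by (rule square_integrable_inner[OF g e(1)])
  then have int: "integrable I_meas (\<lambda>x. norm (f x))"
    by (simp add: g_def e_def)
  then show "integrable I_meas f"
    by (rule integrable_norm_cancel) (rule square_integrable_measurable[OF assms])
  have "(\<integral>x. norm (f x) \<partial>I_meas) = L2_of g \<bullet> L2_of e"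
    unfolding L2_of_inner[OF g e(1)] by (simp add: g_def e_def)
  also have "\<dots> \<le> norm (L2_of g) * norm (L2_of e)"
    by (rule norm_cauchy_schwarz)
  also have "\<dots> \<le> norm (L2_of g) * sqrt pi"
    using e(2) by (intro mult_left_mono) auto
  also have "norm (L2_of g) = norm (L2_of f)"
    by (rule power2_eq_imp_eq)
       (simp_all add: norm_L2_of_squared[OF g] norm_L2_of_squared[OF assms] g_def norm_Pair)
  finally show "(\<integral>x. norm (f x) \<partial>I_meas) \<le> sqrt pi * norm (L2_of f)"
    by (simp add: mult.commute)
qed

lemma L2_Cauchy_AE_limit:
  assumes f: "\<And>n. square_integrable (f n)" and cauchy: "Cauchy (\<lambda>n. L2_of (f n))"
  obtains r F where "strict_mono r" "F \<in> borel_measurable I_meas"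
    "AE x in I_meas. (\<lambda>k. f (r k) x) \<longlonglongrightarrow> F x"
proof -
  note [measurable] = square_integrable_measurable[OF f]
  obtain r :: "nat \<Rightarrow> nat" where r: "strict_mono r" "AE x in I_meas. Cauchy (\<lambda>k. f (r k) x)"
  proof (rule cauchy_L1_AE_cauchy_subseq)
    show "integrable I_meas (f n)" for n
      by (rule L1_le_L2(1)[OF f])
    fix e :: real assume "e > 0"
    then obtain N where N: "\<And>i j. i \<ge> N \<Longrightarrow> j \<ge> N \<Longrightarrow> norm (L2_of (f i) - L2_of (f j)) < e / sqrt pi"
      using cauchy unfolding Cauchy_iff by (metis divide_pos_pos pi_gt_zero real_sqrt_gt_zero)
    show "\<exists>N. \<forall>i\<ge>N. \<forall>j\<ge>N. (\<integral>x. norm (f i x - f j x) \<partial>I_meas) < e"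
    proof (intro exI allI impI)
      fix i j assume "i \<ge> N" "j \<ge> N"
      then have "sqrt pi * norm (L2_of (f i) - L2_of (f j)) < e"
        using N by (simp add: pos_less_divide_eq mult.commute)
      then show "(\<integral>x. norm (f i x - f j x) \<partial>I_meas) < e"
        using L1_le_L2(2)[OF square_integrable_diff[OF f f], of i j]
        by (simp add: L2_of_diff f)
    qed
  qed
  show ?thesis
  proof (rule that[OF r(1)])
    show "(\<lambda>x. lim (\<lambda>k. f (r k) x)) \<in> borel_measurable I_meas"
      by measurable
    show "AE x in I_meas. (\<lambda>k. f (r k) x) \<longlonglongrightarrow> lim (\<lambda>k. f (r k) x)"
      using r(2) by eventually_elim (simp add: Cauchy_convergent_iff convergent_LIMSEQ_iff)
  qed
qed

text \<open>The Riesz--Fischer theorem. A Cauchy sequence in \<open>L\<^sup>2\<close> is Cauchy in \<open>L\<^sup>1\<close>, hence has a subsequence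
  converging almost everywhere, and Fatou's lemma bounds the distance to the pointwise limit. Through
  this instance the bounded operators on \<open>L2\<close> form a Banach space, in which continuous functions are
  integrable.\<close>

instance L2 :: banach
proof
  fix X :: "nat \<Rightarrow> L2" assume X: "Cauchy X"
  have "\<exists>f. square_integrable f \<and> X n = L2_of f" for n
    by (rule L2_ex_representative)
  then obtain f where f: "\<And>n. square_integrable (f n)" "\<And>n. X n = L2_of (f n)"
    by metis
  then have "X = (\<lambda>n. L2_of (f n))"
    by auto
  with X have "Cauchy (\<lambda>n. L2_of (f n))"
    by simp
  with f(1) obtain r F where r: "strict_mono r" and F[measurable]: "F \<in> borel_measurable I_meas"
    and lim: "AE x in I_meas. (\<lambda>k. f (r k) x) \<longlonglongrightarrow> F x"
    by (rule L2_Cauchy_AE_limit)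
  note [measurable] = square_integrable_measurable[OF f(1)]
  have close: "square_integrable (\<lambda>x. f n x - F x) \<and> norm (L2_of (\<lambda>x. f n x - F x)) \<le> e"
    if N: "\<And>m. m \<ge> n \<Longrightarrow> norm (X n - X m) \<le> e" for n e
  proof -
    have e: "e \<ge> 0"
      using N[of n] by simp
    have lim2: "AE x in I_meas. liminf (\<lambda>k. ennreal ((norm (f n x - f (r k) x))\<^sup>2)) = ennreal ((norm (f n x - F x))\<^sup>2)"
      using lim by eventually_elim (auto intro!: lim_imp_Liminf tendsto_intros)
    have step: "(\<integral>\<^sup>+x. ennreal ((norm (f n x - f (r k) x))\<^sup>2) \<partial>I_meas) \<le> ennreal (e\<^sup>2)" if "k \<ge> n" for k
    proof -
      have sq: "square_integrable (\<lambda>x. f n x - f (r k) x)"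
        by (rule square_integrable_diff[OF f(1) f(1)])
      have "(norm (L2_of (\<lambda>x. f n x - f (r k) x)))\<^sup>2 \<le> e\<^sup>2"
        using N[of "r k"] that seq_suble[OF r, of k]
        by (intro power_mono) (auto simp: f L2_of_diff)
      then show ?thesis
        using sq unfolding norm_L2_of_squared[OF sq]
        by (subst nn_integral_eq_integral) (auto simp: square_integrable_def ennreal_leI)
    qed
    have "(\<integral>\<^sup>+x. ennreal ((norm (f n x - F x))\<^sup>2) \<partial>I_meas)
        = (\<integral>\<^sup>+x. liminf (\<lambda>k. ennreal ((norm (f n x - f (r k) x))\<^sup>2)) \<partial>I_meas)"
      using lim2 by (intro nn_integral_cong_AE) (auto elim: eventually_mono)
    also have "\<dots> \<le> liminf (\<lambda>k. \<integral>\<^sup>+x. ennreal ((norm (f n x - f (r k) x))\<^sup>2) \<partial>I_meas)"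
      by (rule nn_integral_liminf) measurable
    also have "\<dots> \<le> ennreal (e\<^sup>2)"
      using step by (intro Liminf_le) (auto simp: eventually_sequentially)
    finally have le: "(\<integral>\<^sup>+x. ennreal ((norm (f n x - F x))\<^sup>2) \<partial>I_meas) \<le> ennreal (e\<^sup>2)" .
    have int: "integrable I_meas (\<lambda>x. (norm (f n x - F x))\<^sup>2)"
      by (rule integrableI_bounded) (use le_less_trans[OF le] in auto)
    then have sq: "square_integrable (\<lambda>x. f n x - F x)"
      by (simp add: square_integrable_def)
    have "(norm (L2_of (\<lambda>x. f n x - F x)))\<^sup>2 \<le> e\<^sup>2"
      using le int unfolding norm_L2_of_squared[OF sq]
      by (subst (asm) nn_integral_eq_integral) (auto simp: ennreal_le_iff)
    then show ?thesis
      using sq power2_le_imp_le[OF _ e] by blast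
  qed
  have close': "\<exists>N. \<forall>n\<ge>N. square_integrable (\<lambda>x. f n x - F x) \<and> norm (L2_of (\<lambda>x. f n x - F x)) \<le> e"
    if "e > 0" for e
  proof -
    from X that obtain N where "\<And>m n. m \<ge> N \<Longrightarrow> n \<ge> N \<Longrightarrow> norm (X m - X n) < e"
      unfolding Cauchy_iff by metis
    then show ?thesis
      by (intro exI[of _ N] allI impI close) (auto intro: less_imp_le)
  qed
  obtain N where "square_integrable (\<lambda>x. f N x - F x)"
    using close'[of 1] by auto
  from square_integrable_diff[OF f(1)[of N] this] have sqF: "square_integrable F"
    by simp
  have "X \<longlonglongrightarrow> L2_of F"
  proof (rule LIMSEQ_I)
    fix e :: real assume "e > 0"
    then obtain N where "\<forall>n\<ge>N. norm (L2_of (\<lambda>x. f n x - F x)) \<le> e / 2"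
      using close'[of "e / 2"] by auto
    then have "\<forall>n\<ge>N. norm (X n - L2_of F) \<le> e / 2"
      by (simp add: f L2_of_diff sqF)
    with \<open>e > 0\<close> show "\<exists>N. \<forall>n\<ge>N. norm (X n - L2_of F) < e"
      by (intro exI[of _ N]) auto
  qed
  then show "convergent X"
    by (rule convergentI)
qed

lemma norm_scaleC: "norm (c *\<^sub>C f) = cmod c * norm f"
proof (rule L2_cases[of f])
  fix g assume g: "square_integrable g" "f = L2_of g"
  note sq = square_integrable_diag[OF g(1), of c c]
  have "(norm (c *\<^sub>C f))\<^sup>2 = (\<integral>x. (cmod c)\<^sup>2 * (norm (g x))\<^sup>2 \<partial>I_meas)"
    by (simp add: g L2_of_scaleC norm_L2_of_squared[OF sq] norm_prod_def norm_mult
        power_mult_distrib distrib_left)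
  also have "\<dots> = (cmod c * norm f)\<^sup>2"
    by (simp add: g norm_L2_of_squared power_mult_distrib)
  finally show ?thesis
    by simp
qed

text \<open>The Hermitian inner product, linear in its second argument, recovered from its real part.\<close>

definition cinner :: "L2 \<Rightarrow> L2 \<Rightarrow> complex" where
  "cinner h f = Complex (f \<bullet> h) (f \<bullet> (\<i> *\<^sub>C h))"

lemma bounded_linear_cinner: "bounded_linear (cinner h)"
proof -
  have "cinner h = (\<lambda>f. of_real (f \<bullet> h) + \<i> * of_real (f \<bullet> (\<i> *\<^sub>C h)))"
    by (auto simp: cinner_def complex_eq_iff)
  moreover have "bounded_linear (\<lambda>f. complex_of_real (f \<bullet> h) + \<i> * complex_of_real (f \<bullet> (\<i> *\<^sub>C h)))"
    by (intro bounded_linear_add bounded_linear_const_mult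
        bounded_linear_compose[OF bounded_linear_of_real] bounded_linear_inner_left)
  ultimately show ?thesis
    by simp
qed

lemma norm_cinner_le: "cmod (cinner h f) \<le> 2 * norm h * norm f"
proof -
  have "cmod (cinner h f) \<le> \<bar>f \<bullet> h\<bar> + \<bar>f \<bullet> (\<i> *\<^sub>C h)\<bar>"
    using cmod_le[of "cinner h f"] by (simp add: cinner_def)
  also have "\<dots> \<le> norm f * norm h + norm f * norm (\<i> *\<^sub>C h)"
    by (intro add_mono Cauchy_Schwarz_ineq2)
  finally show ?thesis
    by (simp add: norm_scaleC algebra_simps)
qed

lemma cinner_L2_of:
  assumes f: "square_integrable f" and h: "square_integrable h"
  shows "integrable I_meas (\<lambda>x. fst (f x) * cnj (fst (h x)) + snd (f x) * cnj (snd (h x)))" (is "integrable _ ?p")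
    and "cinner (L2_of h) (L2_of f) = (\<integral>x. fst (f x) * cnj (fst (h x)) + snd (f x) * cnj (snd (h x)) \<partial>I_meas)"
proof -
  let ?ih = "\<lambda>x. (\<i> * fst (h x), \<i> * snd (h x))"
  note ih = square_integrable_diag[OF h, of \<i> \<i>]
  have p: "?p = (\<lambda>x. of_real (f x \<bullet> h x) + \<i> * of_real (f x \<bullet> ?ih x))"
    by (auto simp: complex_eq_iff inner_prod_def inner_complex_def)
  note int = square_integrable_inner[OF f h] square_integrable_inner[OF f ih]
  show "integrable I_meas ?p"
    unfolding p using int
    by (intro Bochner_Integration.integrable_add integrable_mult_right integrable_of_real)
  show "cinner (L2_of h) (L2_of f) = (\<integral>x. ?p x \<partial>I_meas)"
    unfolding p using int f h ih
    by (subst Bochner_Integration.integral_add)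
       (auto simp: cinner_def L2_of_scaleC L2_of_inner complex_eq_iff)
qed

lemma cinner_scaleC: "cinner h (c *\<^sub>C f) = c * cinner h f"
proof (rule L2_cases[of f], rule L2_cases[of h])
  fix f' h' assume f: "square_integrable f'" "f = L2_of f'" and h: "square_integrable h'" "h = L2_of h'"
  show ?thesis
    unfolding f(2) h(2) L2_of_scaleC[OF f(1)] cinner_L2_of(2)[OF square_integrable_diag[OF f(1)] h(1)]
      cinner_L2_of(2)[OF f(1) h(1)]
    by (simp add: mult.assoc flip: distrib_left)
qed

section \<open>Weak derivatives in the Hilbert space\<close>

lemma square_integrable_components:
  assumes "square_integrable f"
  shows "integrable I_meas (\<lambda>x. fst (f x))" "integrable I_meas (\<lambda>x. snd (f x))"
  using L1_le_L2(1)[OF assms]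
  by (auto intro: integrable_bounded_linear[OF bounded_linear_fst] integrable_bounded_linear[OF bounded_linear_snd])

lemma has_weak_deriv_L2_of:
  assumes f: "square_integrable f" and g: "square_integrable g"
  shows "has_weak_deriv (L2_of f) (L2_of g) \<longleftrightarrow>
    weak_derivative (\<lambda>x. fst (f x)) (\<lambda>x. fst (g x)) \<and> weak_derivative (\<lambda>x. snd (f x)) (\<lambda>x. snd (g x))"
proof -
  have pair: "fst (\<integral>x. \<phi> x *\<^sub>R h x \<partial>I_meas) = (\<integral>x. \<phi> x *\<^sub>R fst (h x) \<partial>I_meas)"
      "snd (\<integral>x. \<phi> x *\<^sub>R h x \<partial>I_meas) = (\<integral>x. \<phi> x *\<^sub>R snd (h x) \<partial>I_meas)"
    if "continuous_on {0..pi} \<phi>" "square_integrable h" for \<phi> :: "real \<Rightarrow> real" and h :: "real \<Rightarrow> complex \<times> complex"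
  proof -
    have "integrable I_meas (\<lambda>x. \<phi> x *\<^sub>R h x)"
      by (rule integrable_I_meas_continuous_scaleR[OF that(1) L1_le_L2(1)[OF that(2)]])
    then show "fst (\<integral>x. \<phi> x *\<^sub>R h x \<partial>I_meas) = (\<integral>x. \<phi> x *\<^sub>R fst (h x) \<partial>I_meas)"
      "snd (\<integral>x. \<phi> x *\<^sub>R h x \<partial>I_meas) = (\<integral>x. \<phi> x *\<^sub>R snd (h x) \<partial>I_meas)"
      using integral_bounded_linear[OF bounded_linear_fst] integral_bounded_linear[OF bounded_linear_snd]
      by fastforce+
  qed
  have "((\<integral>x. \<phi>' x *\<^sub>R f x \<partial>I_meas) = - (\<integral>x. \<phi> x *\<^sub>R g x \<partial>I_meas)) \<longleftrightarrow>
      (\<integral>x. \<phi>' x *\<^sub>R fst (f x) \<partial>I_meas) = - (\<integral>x. \<phi> x *\<^sub>R fst (g x) \<partial>I_meas) \<and>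
      (\<integral>x. \<phi>' x *\<^sub>R snd (f x) \<partial>I_meas) = - (\<integral>x. \<phi> x *\<^sub>R snd (g x) \<partial>I_meas)"
    if "test_function \<phi> \<phi>'" for \<phi> \<phi>'
    using pair[OF test_function_continuous(2)[OF that] f] pair[OF test_function_continuous(1)[OF that] g]
    by (simp add: prod_eq_iff)
  then show ?thesis
    using f g by (subst has_weak_deriv.abs_eq) (auto simp: weak_derivative_def)
qed

lemma weak_derivative_unique:
  assumes g: "integrable I_meas g" and h: "integrable I_meas h"
    and "weak_derivative f g" "weak_derivative f h"
  shows "AE x in I_meas. g x = h x"
proof -
  have "AE x in I_meas. g x - h x = 0"
  proof (rule fundamental_lemma_calculus_of_variations)
    fix \<phi> \<phi>' assume \<phi>: "test_function \<phi> \<phi>'"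
    note int = integrable_I_meas_continuous_scaleR[OF test_function_continuous(1)[OF \<phi>]]
    have "(\<integral>x. \<phi> x *\<^sub>R g x \<partial>I_meas) = (\<integral>x. \<phi> x *\<^sub>R h x \<partial>I_meas)"
      using assms(3,4)[unfolded weak_derivative_def, rule_format, OF \<phi>] by simp
    then show "(\<integral>x. \<phi> x *\<^sub>R (g x - h x) \<partial>I_meas) = 0"
      using int[OF g] int[OF h] by (simp add: scaleR_diff_right)
  qed (use g h in simp)
  then show ?thesis
    by eventually_elim simp
qed

lemma weak_deriv_eqI:
  assumes "has_weak_deriv f g"
  shows "weak_deriv f = g"
  unfolding weak_deriv_def
proof (rule the_equality[where P = "has_weak_deriv f", OF assms])
  fix h assume h: "has_weak_deriv f h"
  obtain f' where f': "square_integrable f'" "f = L2_of f'"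
    by (rule L2_cases)
  obtain g' where g': "square_integrable g'" "g = L2_of g'"
    by (rule L2_cases)
  obtain h' where h': "square_integrable h'" "h = L2_of h'"
    by (rule L2_cases)
  have "AE x in I_meas. fst (h' x) = fst (g' x)" "AE x in I_meas. snd (h' x) = snd (g' x)"
    using assms h f' g' h'
    by (auto intro!: weak_derivative_unique square_integrable_components simp: has_weak_deriv_L2_of)
  then have "AE x in I_meas. h' x = g' x"
    by eventually_elim (simp add: prod_eq_iff)
  then show "h = g"
    using g' h' by (simp add: L2_of_eq_iff)
qed

lemma weak_derivative_add:
  assumes "integrable I_meas f" "integrable I_meas g" "integrable I_meas f'" "integrable I_meas g'"
    and "weak_derivative f f'" "weak_derivative g g'"
  shows "weak_derivative (\<lambda>x. f x + g x) (\<lambda>x. f' x + g' x)"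
  unfolding weak_derivative_def
proof (intro allI impI)
  fix \<phi> \<phi>' assume \<phi>: "test_function \<phi> \<phi>'"
  note int = integrable_I_meas_continuous_scaleR[OF test_function_continuous(1)[OF \<phi>]]
    integrable_I_meas_continuous_scaleR[OF test_function_continuous(2)[OF \<phi>]]
  show "(\<integral>x. \<phi>' x *\<^sub>R (f x + g x) \<partial>I_meas) = - (\<integral>x. \<phi> x *\<^sub>R (f' x + g' x) \<partial>I_meas)"
    using assms(5,6) \<phi> by (simp add: scaleR_add_right int assms(1-4) weak_derivative_def)
qed

lemma weak_derivative_cmult:
  assumes "weak_derivative f f'"
  shows "weak_derivative (\<lambda>x. c * f x) (\<lambda>x. c * f' x)"
  using assms by (simp add: weak_derivative_def flip: mult_scaleR_right)

lemma has_weak_deriv_add: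
  assumes "has_weak_deriv F F'" "has_weak_deriv G G'"
  shows "has_weak_deriv (F + G) (F' + G')"
proof -
  obtain f f' g g' where f: "square_integrable f" "F = L2_of f" and f': "square_integrable f'" "F' = L2_of f'"
    and g: "square_integrable g" "G = L2_of g" and g': "square_integrable g'" "G' = L2_of g'"
    using L2_ex_representative[of F] L2_ex_representative[of F']
      L2_ex_representative[of G] L2_ex_representative[of G'] by auto
  then show ?thesis
    using assms
    by (auto simp: has_weak_deriv_L2_of L2_of_add square_integrable_add
        intro!: weak_derivative_add square_integrable_components)
qed

lemma has_weak_deriv_scaleC:
  assumes "has_weak_deriv F F'"
  shows "has_weak_deriv (c *\<^sub>C F) (c *\<^sub>C F')"
proof -
  obtain f f' where f: "square_integrable f" "F = L2_of f" and f': "square_integrable f'" "F' = L2_of f'"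
    using L2_ex_representative[of F] L2_ex_representative[of F'] by auto
  then show ?thesis
    using assms
    by (auto simp: has_weak_deriv_L2_of L2_of_scaleC square_integrable_diag intro!: weak_derivative_cmult)
qed

section \<open>The operator\<close>

lemma L_domI:
  assumes "continuous_on {0..pi} F" "has_weak_deriv (L2_of F) g"
    and "fst (F 0) = snd (F 0)" "fst (F pi) = snd (F pi)"
  shows "L2_of F \<in> L_dom" "L_op u (L2_of F) = diag_mult u (cnj u) g"
  using assms by (auto simp: L_dom_def W12_def L_op_def weak_deriv_eqI)

text \<open>The continuous representative and the weak derivative of an element of the domain, together.\<close>

lemma L_domE:
  assumes "f \<in> L_dom"
  obtains F g where "continuous_on {0..pi} F" "f = L2_of F" "square_integrable F"
    "square_integrable g" "has_weak_deriv f (L2_of g)"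
    "weak_deriv f = L2_of g"
    "fst (F 0) = snd (F 0)" "fst (F pi) = snd (F pi)"
proof -
  from assms obtain F G where *: "continuous_on {0..pi} F" "f = L2_of F" "has_weak_deriv f G"
      "fst (F 0) = snd (F 0)" "fst (F pi) = snd (F pi)"
    by (auto simp: L_dom_def W12_def)
  moreover obtain g where "square_integrable g" "G = L2_of g"
    by (rule L2_cases)
  ultimately show ?thesis
    using that[of F g] square_integrable_continuous[OF *(1)] weak_deriv_eqI[of f G] by simp
qed

lemma diag_mult_add: "diag_mult a b (F + G) = diag_mult a b F + diag_mult a b G"
proof -
  obtain f g where f: "square_integrable f" "F = L2_of f" and g: "square_integrable g" "G = L2_of g"
    using L2_ex_representative[of F] L2_ex_representative[of G] by auto
  then show ?thesis
    by (simp add: L2_of_add L2_of_diag_mult square_integrable_add square_integrable_diag distrib_left)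
qed

lemma diag_mult_scaleC: "diag_mult a b (c *\<^sub>C F) = c *\<^sub>C diag_mult a b F"
proof -
  obtain f where f: "square_integrable f" "F = L2_of f"
    using L2_ex_representative[of F] by auto
  then show ?thesis
    by (simp add: L2_of_scaleC L2_of_diag_mult square_integrable_diag mult.left_commute)
qed

lemma L_dom_add:
  assumes "f \<in> L_dom" "g \<in> L_dom"
  shows "f + g \<in> L_dom" "L_op u (f + g) = L_op u f + L_op u g"
proof -
  obtain F f' where F: "continuous_on {0..pi} F" "f = L2_of F" "square_integrable F"
    "square_integrable f'" "has_weak_deriv f (L2_of f')"
    "weak_deriv f = L2_of f'"
    "fst (F 0) = snd (F 0)" "fst (F pi) = snd (F pi)"
    by (rule L_domE[OF assms(1)])
  obtain G g' where G: "continuous_on {0..pi} G" "g = L2_of G" "square_integrable G"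
    "square_integrable g'" "has_weak_deriv g (L2_of g')"
    "weak_deriv g = L2_of g'"
    "fst (G 0) = snd (G 0)" "fst (G pi) = snd (G pi)"
    by (rule L_domE[OF assms(2)])
  have sum: "f + g = L2_of (\<lambda>x. F x + G x)"
    using F G by (simp add: L2_of_add)
  have cont: "continuous_on {0..pi} (\<lambda>x. F x + G x)"
    using F(1) G(1) by (rule continuous_on_add)
  note * = L_domI[OF cont has_weak_deriv_add[OF F(5) G(5), unfolded sum]]
  show "f + g \<in> L_dom"
    unfolding sum by (rule *(1)) (use F(7,8) G(7,8) in simp_all)
  have "L_op u (f + g) = diag_mult u (cnj u) (L2_of f' + L2_of g')"
    unfolding sum by (rule *(2)) (use F(7,8) G(7,8) in simp_all)
  then show "L_op u (f + g) = L_op u f + L_op u g"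
    by (simp add: diag_mult_add L_op_def[of u f] L_op_def[of u g] F(6) G(6))
qed

lemma L_dom_scaleC:
  assumes "f \<in> L_dom"
  shows "c *\<^sub>C f \<in> L_dom" "L_op u (c *\<^sub>C f) = c *\<^sub>C L_op u f"
proof -
  obtain F f' where F: "continuous_on {0..pi} F" "f = L2_of F" "square_integrable F"
    "square_integrable f'" "has_weak_deriv f (L2_of f')"
    "weak_deriv f = L2_of f'"
    "fst (F 0) = snd (F 0)" "fst (F pi) = snd (F pi)"
    by (rule L_domE[OF assms(1)])
  have scale: "c *\<^sub>C f = L2_of (\<lambda>x. (c * fst (F x), c * snd (F x)))"
    using F by (simp add: L2_of_scaleC)
  have cont: "continuous_on {0..pi} (\<lambda>x. (c * fst (F x), c * snd (F x)))"
    by (intro continuous_intros F(1))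
  note * = L_domI[OF cont has_weak_deriv_scaleC[OF F(5), of c, unfolded scale]]
  show "c *\<^sub>C f \<in> L_dom"
    unfolding scale by (rule *(1)) (use F(7,8) in simp_all)
  have "L_op u (c *\<^sub>C f) = diag_mult u (cnj u) (c *\<^sub>C L2_of f')"
    unfolding scale by (rule *(2)) (use F(7,8) in simp_all)
  then show "L_op u (c *\<^sub>C f) = c *\<^sub>C L_op u f"
    by (simp add: diag_mult_scaleC L_op_def[of u f] F(6))
qed

text \<open>This pins down continuous representatives up to the end points, where the boundary conditions
  are imposed.\<close>

lemma continuous_AE_zero:
  fixes d :: "real \<Rightarrow> complex"
  assumes cont: "continuous_on {0..pi} d" and ae: "AE x in I_meas. d x = 0" and x: "x \<in> {0..pi}"
  shows "d x = 0"
proof -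
  have cont': "continuous_on {0..pi} (\<lambda>x. cmod (d x))"
    by (intro continuous_intros cont)
  have int: "integrable I_meas (\<lambda>x. cmod (d x))"
    using integrable_I_meas_continuous[OF cont] by (rule integrable_norm)
  have "(\<integral>x. cmod (d x) \<partial>I_meas) = 0"
    using ae by (intro integral_eq_zero_AE) (auto elim: eventually_mono)
  then have "integral {0..pi} (\<lambda>x. cmod (d x)) = 0"
    using I_meas_integral_eq[OF int] by simp
  then have "cmod (d x) = 0"
    using integral_eq_0_iff[OF cont'] x by simp
  then show ?thesis
    by simp
qed

lemma primitive_cong_AE:
  fixes g h :: "real \<Rightarrow> complex"
  assumes g: "integrable I_meas g" and h: "integrable I_meas h"
    and ae: "AE x in I_meas. g x = h x" and x: "x \<in> {0<..<pi}"
  shows "integral {0..x} g = integral {0..x} h"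
proof -
  note [measurable] = borel_measurable_integrable[OF g] borel_measurable_integrable[OF h]
  have "(\<integral>y. (if y \<le> x then g y else 0) \<partial>I_meas) = (\<integral>y. (if y \<le> x then h y else 0) \<partial>I_meas)"
    by (rule integral_cong_AE) (use ae in \<open>auto elim: eventually_mono\<close>)
  then show ?thesis
    using primitive_eq_lebesgue_integral(1)[OF g x] primitive_eq_lebesgue_integral(1)[OF h x] by simp
qed

text \<open>A weak solution is a primitive of its right-hand side, hence a classical solution.\<close>

lemma weak_exponential_ode:
  fixes y :: "real \<Rightarrow> complex"
  assumes cont: "continuous_on {0..pi} y" and h: "integrable I_meas h"
    and weak: "weak_derivative y h" and ae: "AE x in I_meas. h x = \<alpha> * y x" and x: "x \<in> {0..pi}"
  shows "y x = y 0 * exp (\<alpha> * of_real x)"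
proof -
  let ?h = "\<lambda>x. \<alpha> * y x"
  have cont_h: "continuous_on {0..pi} ?h"
    by (intro continuous_intros cont)
  have int_h: "integrable I_meas ?h"
    by (rule integrable_I_meas_continuous[OF cont_h])
  have "\<exists>c. AE x in I_meas. y x = c + integral {0..x} h"
    by (rule weak_derivative_imp_primitive[OF integrable_I_meas_continuous[OF cont] h weak])
  then obtain c where "AE x in I_meas. y x = c + integral {0..x} h"
    by (rule exE)
  with AE_I_meas_mem have "AE x in I_meas. y x - (c + integral {0..x} ?h) = 0"
    by eventually_elim (simp add: primitive_cong_AE[OF h int_h ae])
  moreover have "continuous_on {0..pi} (\<lambda>x. y x - (c + integral {0..x} ?h))"
    by (intro continuous_on_diff continuous_on_add continuous_on_const cont
        continuous_on_primitive[OF int_h])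
  ultimately have "y x - (c + integral {0..x} ?h) = 0" if "x \<in> {0..pi}" for x
    using continuous_AE_zero that by blast
  then have y: "y x = c + integral {0..x} ?h" if "x \<in> {0..pi}" for x
    using that by (metis eq_iff_diff_eq_0)
  define q where "q x = y x * exp (- (\<alpha> * of_real x))" for x
  have "(q has_vector_derivative 0) (at x within {0..pi})" if "x \<in> {0..pi}" for x
  proof -
    have "((\<lambda>x. integral {0..x} ?h) has_vector_derivative ?h x) (at x within {0..pi})"
      by (rule integral_has_vector_derivative[OF cont_h that])
    then have "((\<lambda>x. c + integral {0..x} ?h) has_vector_derivative ?h x) (at x within {0..pi})"
      using has_vector_derivative_add[OF has_vector_derivative_const] by fastforce
    then have dy: "(y has_vector_derivative ?h x) (at x within {0..pi})"
      by (rule has_vector_derivative_transform[OF that, rotated]) (simp add: y)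
    have de: "((\<lambda>x. exp (- (\<alpha> * of_real x))) has_vector_derivative - \<alpha> * exp (- (\<alpha> * of_real x))) (at x within {0..pi})"
      by (rule has_vector_derivative_real_field) (auto intro!: derivative_eq_intros)
    show ?thesis
      using has_vector_derivative_mult[OF dy de] by (simp add: q_def[abs_def] algebra_simps)
  qed
  then have "\<exists>c. \<forall>x\<in>{0..pi}. q x = c"
    by (intro has_derivative_zero_constant) (auto simp: has_vector_derivative_def)
  then have "q x = q 0"
    using x by auto
  then show ?thesis
    by (simp add: q_def exp_minus field_simps)
qed

section \<open>The resolvent\<close>

text \<open>The determinant of the boundary conditions on the solutions
  \<open>(a e\<^bsup>zx/u\<^esup>, b e\<^bsup>zx/cnj u\<^esup>)\<close> of \<open>z f - L f = 0\<close>: the condition at 0 forces \<open>a = b\<close>, and the one at \<open>\<pi>\<close>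
  then reads \<open>a char_det u z = 0\<close>.\<close>

definition char_det :: "complex \<Rightarrow> complex \<Rightarrow> complex" where
  "char_det u z = exp (z / u * pi) - exp (z / cnj u * pi)"

lemma inverse_diff_cnj:
  assumes "s > 0" "t > 0" "u = Complex s t"
  shows "1 / u - 1 / cnj u = - (2 * \<i> / of_real ((s\<^sup>2 + t\<^sup>2) / t))"
proof -
  have "u * cnj u = of_real (s\<^sup>2 + t\<^sup>2)"
    using complex_mult_cnj[of u] assms(3) by simp
  moreover have "cnj u - u = - (2 * \<i> * t)"
    using assms(3) by (simp add: complex_eq_iff)
  moreover have "u \<noteq> 0" "cnj u \<noteq> 0"
    using assms by (auto simp: complex_eq_iff)
  ultimately have "1 / u - 1 / cnj u = - (2 * \<i> * of_real t) / of_real (s\<^sup>2 + t\<^sup>2)"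
    by (metis diff_frac_eq mult_1)
  then show ?thesis
    by simp
qed

lemma char_det_eq_0_iff:
  assumes st: "s > 0" "t > 0" "u = Complex s t"
  shows "char_det u z = 0 \<longleftrightarrow> (\<exists>k. z = of_real (eigval s t k))"
proof -
  define c :: complex where "c = of_real ((s\<^sup>2 + t\<^sup>2) / t)"
  have pos: "s\<^sup>2 + t\<^sup>2 > 0"
    using st by (simp add: add_pos_pos)
  then have c: "c \<noteq> 0"
    unfolding c_def of_real_eq_0_iff using st by simp
  have diff: "z / u * pi - z / cnj u * pi = (- z / c * 2 * pi) * \<i>"
  proof -
    have "z / u * pi - z / cnj u * pi = z * pi * (1 / u - 1 / cnj u)"
      by (simp add: field_simps)
    then show ?thesis
      by (simp add: inverse_diff_cnj[OF st, folded c_def])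
  qed
  have "char_det u z = 0 \<longleftrightarrow> exp (z / u * pi) = exp (z / cnj u * pi)"
    by (simp add: char_det_def)
  also have "\<dots> \<longleftrightarrow> exp ((- z / c * 2 * pi) * \<i>) = 1"
    unfolding diff[symmetric] by (simp add: exp_diff)
  also have "\<dots> \<longleftrightarrow> (\<exists>k::int. (- z / c * 2 * pi) * \<i> = of_int (2 * k) * pi * \<i>)"
    unfolding exp_eq_1 by (simp add: complex_eq_iff)
  also have "\<dots> \<longleftrightarrow> (\<exists>k::int. z = - of_int k * c)"
  proof (rule arg_cong[where f = Ex], rule ext)
    fix k :: int
    have "(- z / c * 2 * pi) * \<i> = of_int (2 * k) * pi * \<i> \<longleftrightarrow> (2 * pi * \<i>) * (- z / c) = (2 * pi * \<i>) * of_int k"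
      by (simp add: mult_ac)
    also have "\<dots> \<longleftrightarrow> - z / c = of_int k"
      unfolding mult_cancel_left by simp
    also have "\<dots> \<longleftrightarrow> z = - of_int k * c"
      unfolding nonzero_divide_eq_eq[OF c] by (metis minus_minus mult_minus_left)
    finally show "(- z / c * 2 * pi) * \<i> = of_int (2 * k) * pi * \<i> \<longleftrightarrow> z = - of_int k * c" .
  qed
  also have "\<dots> \<longleftrightarrow> (\<exists>k::int. z = of_int k * c)"
    by (metis minus_minus of_int_minus)
  also have "\<dots> \<longleftrightarrow> (\<exists>k. z = of_real (eigval s t k))"
    by (simp add: eigval_def c_def mult.commute)
  finally show ?thesis .
qed

lemma L_kernel_trivial:
  assumes u: "u \<noteq> 0" and z: "char_det u z \<noteq> 0"
    and f: "f \<in> L_dom" and eq: "z *\<^sub>C f - L_op u f = 0"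
  shows "f = 0"
proof -
  obtain F g where F: "continuous_on {0..pi} F" "f = L2_of F" "square_integrable F"
    "square_integrable g" "has_weak_deriv f (L2_of g)" "weak_deriv f = L2_of g"
    "fst (F 0) = snd (F 0)" "fst (F pi) = snd (F pi)"
    by (rule L_domE[OF f])
  have "L2_of (\<lambda>x. (z * fst (F x), z * snd (F x))) = L2_of (\<lambda>x. (u * fst (g x), cnj u * snd (g x)))"
    using eq F by (simp add: L_op_def L2_of_scaleC L2_of_diag_mult)
  then have "AE x in I_meas. (z * fst (F x), z * snd (F x)) = (u * fst (g x), cnj u * snd (g x))"
    using F by (simp only: L2_of_eq_iff square_integrable_diag)
  then have eqs: "AE x in I_meas. z * fst (F x) = u * fst (g x) \<and> z * snd (F x) = cnj u * snd (g x)"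
    by simp
  have ae: "AE x in I_meas. fst (g x) = z / u * fst (F x)" "AE x in I_meas. snd (g x) = z / cnj u * snd (F x)"
    using u by (auto intro!: eventually_mono[OF eqs] simp: nonzero_eq_divide_eq mult.commute)
  have weak: "weak_derivative (\<lambda>x. fst (F x)) (\<lambda>x. fst (g x))" "weak_derivative (\<lambda>x. snd (F x)) (\<lambda>x. snd (g x))"
    using F by (simp_all add: has_weak_deriv_L2_of)
  note int = square_integrable_components[OF F(4)]
  have exps: "fst (F x) = fst (F 0) * exp (z / u * of_real x)" "snd (F x) = snd (F 0) * exp (z / cnj u * of_real x)"
    if "x \<in> {0..pi}" for x
    using weak_exponential_ode[OF continuous_on_fst[OF F(1)] int(1) weak(1) ae(1) that]
      weak_exponential_ode[OF continuous_on_snd[OF F(1)] int(2) weak(2) ae(2) that] by auto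
  have "fst (F 0) * exp (z / u * pi) = fst (F 0) * exp (z / cnj u * pi)"
    using exps[of pi] F(7,8) by auto
  then have "fst (F 0) * char_det u z = 0"
    by (simp add: char_det_def right_diff_distrib)
  then have "fst (F 0) = 0"
    using z by simp
  then have "F x = 0" if "x \<in> {0..pi}" for x
    using exps[OF that] F(7) by (simp add: prod_eq_iff)
  then have "AE x in I_meas. F x = 0"
    by (intro eventually_mono[OF AE_I_meas_mem]) simp
  then show ?thesis
    unfolding F(2) zero_L2.abs_eq using F(3) square_integrable_zero by (simp add: L2_of_eq_iff)
qed

lemma norm_primitive_le:
  assumes h: "integrable I_meas h" and x: "x \<in> {0..pi}"
  shows "cmod (integral {0..x} h) \<le> (\<integral>x. cmod (h x) \<partial>I_meas)"
proof -
  have n: "integrable I_meas (\<lambda>x. cmod (h x))"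
    using h by (rule integrable_norm)
  have int: "h integrable_on {0..x}" "(\<lambda>x. cmod (h x)) integrable_on {0..x}" "(\<lambda>x. cmod (h x)) integrable_on {0..pi}"
    using x by (auto intro: integrable_I_meas_imp_integrable_on h n)
  have "cmod (integral {0..x} h) \<le> integral {0..x} (\<lambda>x. cmod (h x))"
    by (rule integral_norm_bound_integral[OF int(1,2)]) simp
  also have "\<dots> \<le> integral {0..pi} (\<lambda>x. cmod (h x))"
    using x by (intro integral_subset_le int) auto
  finally show ?thesis
    by (simp add: I_meas_integral_eq[OF n])
qed

lemma cmod_exp_le:
  assumes "x \<in> {0..pi}"
  shows "cmod (exp (w * of_real x)) \<le> exp (cmod w * pi)"
proof -
  have "cmod (exp (w * of_real x)) \<le> exp (cmod (w * of_real x))"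
    by (rule norm_exp)
  also have "\<dots> \<le> exp (cmod w * pi)"
    using assms by (simp add: norm_mult mult_left_mono)
  finally show ?thesis .
qed

lemma integral_cmod_weighted_le:
  assumes h: "integrable I_meas h" and bound: "\<And>x. x \<in> {0..pi} \<Longrightarrow> cmod (w x) \<le> K"
    and w: "continuous_on {0..pi} w"
  shows "(\<integral>x. cmod (w x * h x) \<partial>I_meas) \<le> K * (\<integral>x. cmod (h x) \<partial>I_meas)"
proof -
  have "(\<integral>x. cmod (w x * h x) \<partial>I_meas) \<le> (\<integral>x. K * cmod (h x) \<partial>I_meas)"
  proof (rule integral_mono_AE)
    show "integrable I_meas (\<lambda>x. cmod (w x * h x))"
      by (rule integrable_norm[OF integrable_I_meas_continuous_mult[OF w h]])
    show "integrable I_meas (\<lambda>x. K * cmod (h x))"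
      using h by simp
    show "AE x in I_meas. cmod (w x * h x) \<le> K * cmod (h x)"
      using AE_I_meas_mem
      by eventually_elim (auto simp: norm_mult intro!: mult_right_mono bound)
  qed
  then show ?thesis
    by simp
qed

text \<open>\<open>F a\<close> solves \<open>z y - v y' = g\<close> with \<open>y(0) = a\<close>. The bound on \<open>A\<close> makes the solution operator bounded.\<close>

lemma variation_of_constants:
  fixes g :: "real \<Rightarrow> complex" and v z :: complex
  assumes g: "integrable I_meas g" and v: "v \<noteq> 0"
  defines "A \<equiv> \<lambda>x. integral {0..x} (\<lambda>y. - 1 / v * exp (- (z / v) * of_real y) * g y)"
  defines "F \<equiv> \<lambda>a x. exp (z / v * of_real x) * (a + A x)"
  shows "continuous_on {0..pi} (F a)"
    and "weak_derivative (F a) (\<lambda>x. z / v * F a x - g x / v)"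
    and "x \<in> {0..pi} \<Longrightarrow> cmod (A x) \<le> 1 / cmod v * exp (cmod (z / v) * pi) * (\<integral>x. cmod (g x) \<partial>I_meas)"
proof -
  let ?w = "\<lambda>y. - 1 / v * exp (- (z / v) * of_real y)"
  have w: "continuous_on {0..pi} ?w"
    by (intro continuous_intros) (use v in auto)
  have h: "integrable I_meas (\<lambda>y. ?w y * g y)"
    by (rule integrable_I_meas_continuous_mult[OF w g])
  show "continuous_on {0..pi} (F a)"
    unfolding F_def A_def by (intro continuous_intros continuous_on_primitive[OF h]) (use v in auto)
  have "weak_derivative (F a) (\<lambda>x. z / v * F a x + exp (z / v * of_real x) * (?w x * g x))"
    unfolding F_def A_def by (rule weak_derivative_exp_primitive[OF h])
  also have "(\<lambda>x. z / v * F a x + exp (z / v * of_real x) * (?w x * g x)) = (\<lambda>x. z / v * F a x - g x / v)"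
    by (rule ext) (simp add: exp_minus)
  finally show "weak_derivative (F a) (\<lambda>x. z / v * F a x - g x / v)" .
  assume x: "x \<in> {0..pi}"
  have "cmod (A x) \<le> (\<integral>x. cmod (?w x * g x) \<partial>I_meas)"
    unfolding A_def by (rule norm_primitive_le[OF h x])
  also have "\<dots> \<le> (1 / cmod v * exp (cmod (z / v) * pi)) * (\<integral>x. cmod (g x) \<partial>I_meas)"
  proof (rule integral_cmod_weighted_le[OF g _ w])
    fix x assume "x \<in> {0..pi}"
    from cmod_exp_le[OF this, of "- (z / v)"]
    have "cmod (exp (- (z / v) * of_real x)) \<le> exp (cmod (z / v) * pi)"
      by (simp only: norm_minus_cancel)
    then show "cmod (- 1 / v * exp (- (z / v) * of_real x)) \<le> 1 / cmod v * exp (cmod (z / v) * pi)"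
      unfolding norm_mult by (intro mult_mono) (auto simp: norm_divide)
  qed
  finally show "cmod (A x) \<le> 1 / cmod v * exp (cmod (z / v) * pi) * (\<integral>x. cmod (g x) \<partial>I_meas)" .
qed

lemma norm_L2_of_components_le:
  assumes F: "continuous_on {0..pi} F"
    and "\<And>x. x \<in> {0..pi} \<Longrightarrow> cmod (fst (F x)) \<le> K" "\<And>x. x \<in> {0..pi} \<Longrightarrow> cmod (snd (F x)) \<le> K"
  shows "norm (L2_of F) \<le> sqrt pi * (2 * K)"
proof (rule square_integrable_bounded(2)[OF measurable_I_meas_continuous[OF F]])
  fix x :: real assume "x \<in> {0<..<pi}"
  then have "cmod (fst (F x)) \<le> K" "cmod (snd (F x)) \<le> K"
    using assms(2,3) by auto
  then show "norm (F x) \<le> 2 * K"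
    using norm_Pair_le[of "fst (F x)" "snd (F x)"] by simp
qed

text \<open>Both components start from the same value \<open>a\<close> at 0, which is then determined by the condition at
  \<open>\<pi>\<close>. The constant \<open>K\<close> bounds the solution operator, first in the supremum norm and then in \<open>L\<^sup>2\<close>.\<close>

lemma L_solution_exists:
  assumes u: "u \<noteq> 0" and z: "char_det u z \<noteq> 0"
  shows "\<exists>K. \<forall>g. \<exists>f\<in>L_dom. z *\<^sub>C f - L_op u f = g \<and> norm f \<le> norm g * K"
proof -
  \<comment> \<open>\<open>M\<close> bounds all exponentials that occur, and \<open>B\<close> times the norm of \<open>g\<close> bounds the integrals \<open>A1\<close>, \<open>A2\<close>.\<close>
  define M where "M = max (exp (cmod (z / u) * pi)) (exp (cmod (z / cnj u) * pi))"
  define B where "B = M * sqrt pi / cmod u"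
  define K where "K = sqrt pi * (2 * (M * (2 * M * B / cmod (char_det u z) + B)))"
  have M: "M > 0"
    by (simp add: M_def less_max_iff_disj)
  have "\<exists>f\<in>L_dom. z *\<^sub>C f - L_op u f = g \<and> norm f \<le> norm g * K" for g
  proof -
    obtain g' where g': "square_integrable g'" "g = L2_of g'"
      using L2_ex_representative[of g] by auto
    note g_int = square_integrable_components[OF g'(1)]
    have cu: "cnj u \<noteq> 0"
      using u by simp
    define A1 where "A1 x = integral {0..x} (\<lambda>y. - 1 / u * exp (- (z / u) * of_real y) * fst (g' y))" for x
    define A2 where "A2 x = integral {0..x} (\<lambda>y. - 1 / cnj u * exp (- (z / cnj u) * of_real y) * snd (g' y))" for x
    define a where "a = (exp (z / cnj u * pi) * A2 pi - exp (z / u * pi) * A1 pi) / char_det u z"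
    define F where "F x = (exp (z / u * of_real x) * (a + A1 x), exp (z / cnj u * of_real x) * (a + A2 x))" for x
    define G where "G x = (z / u * fst (F x) - fst (g' x) / u, z / cnj u * snd (F x) - snd (g' x) / cnj u)" for x
    note V1 = variation_of_constants[OF g_int(1) u, where z = z, folded A1_def]
    note V2 = variation_of_constants[OF g_int(2) cu, where z = z, folded A2_def]
    have F_cont: "continuous_on {0..pi} F"
      unfolding F_def using V1(1) V2(1) by (intro continuous_on_Pair)
    have F_sq: "square_integrable F"
      by (rule square_integrable_continuous[OF F_cont])
    have G_sq: "square_integrable G"
    proof -
      have "G = (\<lambda>x. (z / u * fst (F x), z / cnj u * snd (F x)) - (1 / u * fst (g' x), 1 / cnj u * snd (g' x)))"
        by (auto simp: G_def)
      then show ?thesis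
        by (simp only: square_integrable_diff square_integrable_diag F_sq g'(1))
    qed
    have weak: "has_weak_deriv (L2_of F) (L2_of G)"
      using V1(2) V2(2) by (simp add: has_weak_deriv_L2_of[OF F_sq G_sq] F_def G_def)
    have bc0: "fst (F 0) = snd (F 0)"
      by (simp add: F_def A1_def A2_def)
    have bc1: "fst (F pi) = snd (F pi)"
    proof -
      have "a * char_det u z = exp (z / cnj u * pi) * A2 pi - exp (z / u * pi) * A1 pi"
        using z by (simp add: a_def)
      then show ?thesis
        by (simp add: F_def char_det_def algebra_simps)
    qed
    note dom = L_domI[OF F_cont weak bc0 bc1]
    have pointwise: "(\<lambda>x. (z * fst (F x), z * snd (F x)) - (u * fst (G x), cnj u * snd (G x))) = g'"
      using u by (intro ext) (simp add: G_def prod_eq_iff right_diff_distrib)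
    have "z *\<^sub>C L2_of F - L_op u (L2_of F) = g"
      unfolding dom(2) L2_of_scaleC[OF F_sq] L2_of_diag_mult[OF G_sq] g'(2)
        L2_of_diff[OF square_integrable_diag[OF F_sq] square_integrable_diag[OF G_sq]] pointwise ..
    moreover have "norm (L2_of F) \<le> norm g * K"
    proof -
      have le: "cmod (fst (g' x)) \<le> norm (g' x)" "cmod (snd (g' x)) \<le> norm (g' x)" for x
        by (metis norm_fst_le norm_snd_le prod.collapse)+
      note g_norm = integrable_norm[OF L1_le_L2(1)[OF g'(1)]]
      have int_fst: "(\<integral>x. cmod (fst (g' x)) \<partial>I_meas) \<le> sqrt pi * norm g"
        using integral_mono[OF integrable_norm[OF g_int(1)] g_norm le(1)] L1_le_L2(2)[OF g'(1)] unfolding g'(2)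
        by (rule order_trans)
      have int_snd: "(\<integral>x. cmod (snd (g' x)) \<partial>I_meas) \<le> sqrt pi * norm g"
        using integral_mono[OF integrable_norm[OF g_int(2)] g_norm le(2)] L1_le_L2(2)[OF g'(1)] unfolding g'(2)
        by (rule order_trans)
      have A1: "cmod (A1 x) \<le> B * norm g" if "x \<in> {0..pi}" for x
      proof -
        have "cmod (A1 x) \<le> 1 / cmod u * exp (cmod (z / u) * pi) * (sqrt pi * norm g)"
          by (rule order_trans[OF V1(3)[OF that] mult_left_mono[OF int_fst]]) simp
        also have "\<dots> \<le> 1 / cmod u * M * (sqrt pi * norm g)"
          by (intro mult_right_mono mult_left_mono) (auto simp: M_def)
        finally show ?thesis
          by (simp add: B_def field_simps)
      qed
      have A2: "cmod (A2 x) \<le> B * norm g" if "x \<in> {0..pi}" for x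
      proof -
        have "cmod (A2 x) \<le> 1 / cmod (cnj u) * exp (cmod (z / cnj u) * pi) * (sqrt pi * norm g)"
          by (rule order_trans[OF V2(3)[OF that] mult_left_mono[OF int_snd]]) simp
        also have "\<dots> \<le> 1 / cmod u * M * (sqrt pi * norm g)"
          unfolding complex_mod_cnj by (intro mult_right_mono mult_left_mono) (auto simp: M_def)
        finally show ?thesis
          by (simp add: B_def field_simps)
      qed
      have e: "cmod (exp (z / u * of_real x)) \<le> M" "cmod (exp (z / cnj u * of_real x)) \<le> M"
        if "x \<in> {0..pi}" for x
        using cmod_exp_le[OF that, of "z / u"] cmod_exp_le[OF that, of "z / cnj u"]
        by (auto simp: M_def le_max_iff_disj)
      have pi: "pi \<in> {0..pi}"
        by simp
      have "cmod (exp (z / cnj u * pi) * A2 pi - exp (z / u * pi) * A1 pi)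
          \<le> cmod (exp (z / cnj u * pi) * A2 pi) + cmod (exp (z / u * pi) * A1 pi)"
        by (rule norm_triangle_ineq4)
      also have "\<dots> \<le> M * (B * norm g) + M * (B * norm g)"
        unfolding norm_mult using M
        by (intro add_mono mult_mono e[OF pi] A1[OF pi] A2[OF pi]) auto
      finally have a: "cmod a \<le> 2 * M * B / cmod (char_det u z) * norm g"
        using z by (simp add: a_def norm_divide field_simps)
      have "norm (L2_of F) \<le> sqrt pi * (2 * (M * (2 * M * B / cmod (char_det u z) * norm g + B * norm g)))"
      proof (rule norm_L2_of_components_le[OF F_cont])
        fix x assume x: "x \<in> {0..pi}"
        show "cmod (fst (F x)) \<le> M * (2 * M * B / cmod (char_det u z) * norm g + B * norm g)"
          unfolding F_def fst_conv norm_mult using M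
          by (intro mult_mono e[OF x] order_trans[OF norm_triangle_ineq] add_mono a A1[OF x]) auto
        show "cmod (snd (F x)) \<le> M * (2 * M * B / cmod (char_det u z) * norm g + B * norm g)"
          unfolding F_def snd_conv norm_mult using M
          by (intro mult_mono e[OF x] order_trans[OF norm_triangle_ineq] add_mono a A2[OF x]) auto
      qed
      also have "\<dots> = norm g * K"
        by (simp add: K_def algebra_simps)
      finally show ?thesis .
    qed
    ultimately show ?thesis
      using dom(1) by blast
  qed
  then show ?thesis
    by blast
qed

lemma scaleR_eq_scaleC: "r *\<^sub>R f = of_real r *\<^sub>C f"
proof -
  obtain g where "square_integrable g" "f = L2_of g"
    using L2_ex_representative[of f] by auto
  then show ?thesis
    by (auto simp: L2_of_scaleR L2_of_scaleC scaleR_prod_def scaleR_conv_of_real)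
qed

lemma scaleC_scaleC: "a *\<^sub>C b *\<^sub>C f = (a * b) *\<^sub>C f"
proof -
  obtain g where "square_integrable g" "f = L2_of g"
    using L2_ex_representative[of f] by auto
  then show ?thesis
    by (simp add: L2_of_scaleC square_integrable_diag mult.assoc)
qed

lemma scaleC_diff_left: "(a - b) *\<^sub>C f = a *\<^sub>C f - b *\<^sub>C f"
proof -
  obtain g where "square_integrable g" "f = L2_of g"
    using L2_ex_representative[of f] by auto
  then show ?thesis
    by (simp add: L2_of_scaleC L2_of_diff square_integrable_diag left_diff_distrib)
qed

lemma scaleC_diff_right: "a *\<^sub>C (f - g) = a *\<^sub>C f - a *\<^sub>C g"
  by (rule linear_diff[OF bounded_linear.linear[OF bounded_linear_scaleC]])

lemma scaleC_add_right: "a *\<^sub>C (f + g) = a *\<^sub>C f + a *\<^sub>C g"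
  by (rule linear_add[OF bounded_linear.linear[OF bounded_linear_scaleC]])

lemma resolvent_set_L:
  assumes u: "u \<noteq> 0" and z: "char_det u z \<noteq> 0"
  shows "z \<in> resolvent_set L_dom (L_op u)"
proof -
  let ?T = "\<lambda>f. z *\<^sub>C f - L_op u f"
  obtain K where K: "\<And>g. \<exists>f\<in>L_dom. ?T f = g \<and> norm f \<le> norm g * K"
    using L_solution_exists[OF assms] by blast
  have add: "f + g \<in> L_dom" "?T (f + g) = ?T f + ?T g" if "f \<in> L_dom" "g \<in> L_dom" for f g
    using L_dom_add[OF that] by (auto simp: scaleC_add_right)
  have scale: "r *\<^sub>R f \<in> L_dom" "?T (r *\<^sub>R f) = r *\<^sub>R ?T f" if "f \<in> L_dom" for f r
    using L_dom_scaleC(1)[OF that, of "of_real r"] L_dom_scaleC(2)[OF that, of u "of_real r"]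
    by (auto simp: scaleR_eq_scaleC scaleC_scaleC scaleC_diff_right mult.commute)
  have inj: "inj_on ?T L_dom"
  proof (rule inj_onI)
    fix f g assume fg: "f \<in> L_dom" "g \<in> L_dom" "?T f = ?T g"
    have "f + (- 1) *\<^sub>R g = 0"
    proof (rule L_kernel_trivial[OF assms])
      show "f + (- 1) *\<^sub>R g \<in> L_dom"
        by (intro add scale fg)
      show "?T (f + (- 1) *\<^sub>R g) = 0"
        using add(2)[OF fg(1) scale(1)[OF fg(2)], of "- 1"] scale(2)[OF fg(2), of "- 1"] fg(3) by simp
    qed
    then show "f = g"
      by simp
  qed
  moreover have "?T ` L_dom = UNIV"
    using K by (auto simp: image_iff) metis
  ultimately have bij: "bij_betw ?T L_dom UNIV"
    by (simp add: bij_betw_def)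
  let ?R = "the_inv_into L_dom ?T"
  have R: "?R g = f" if "f \<in> L_dom" "?T f = g" for f g
    using the_inv_into_f_f[OF inj that(1)] that(2) by simp
  have ex: "\<exists>f\<in>L_dom. ?T f = g \<and> ?R g = f \<and> norm f \<le> norm g * K" for g
    using K[of g] R by blast
  have "bounded_linear ?R"
  proof (rule bounded_linear_intro)
    fix g h :: L2 and r :: real
    obtain f where f: "f \<in> L_dom" "?T f = g" "?R g = f" "norm f \<le> norm g * K"
      using ex[of g] by blast
    obtain f' where f': "f' \<in> L_dom" "?T f' = h" "?R h = f'"
      using ex[of h] by blast
    show "?R (g + h) = ?R g + ?R h"
      using R[OF add(1)[OF f(1) f'(1)]] add(2)[OF f(1) f'(1)] f f' by simp
    show "?R (r *\<^sub>R g) = r *\<^sub>R ?R g"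
      using R[OF scale(1)[OF f(1)]] scale(2)[OF f(1)] f by simp
    show "norm (?R g) \<le> norm g * K"
      using f by simp
  qed
  with bij show ?thesis
    by (simp add: resolvent_set_def)
qed

section \<open>Contour integrals of the resolvent\<close>

lemma resolvent_eqI:
  assumes z: "z \<in> resolvent_set D A" and f: "f \<in> D" "z *\<^sub>C f - A f = g"
  shows "blinfun_apply (resolvent D A z) g = f"
proof -
  from z have "inj_on (\<lambda>f. z *\<^sub>C f - A f) D" "bounded_linear (the_inv_into D (\<lambda>f. z *\<^sub>C f - A f))"
    by (auto simp: resolvent_set_def bij_betw_def)
  then show ?thesis
    using f the_inv_into_f_f[of "\<lambda>f. z *\<^sub>C f - A f" D f]
    by (simp add: resolvent_def bounded_linear_Blinfun_apply)
qed

lemma resolvent_solves: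
  fixes g :: L2
  assumes z: "z \<in> resolvent_set D A"
  defines "f \<equiv> blinfun_apply (resolvent D A z) g"
  shows "f \<in> D" "z *\<^sub>C f - A f = g"
proof -
  from z have "bij_betw (\<lambda>f. z *\<^sub>C f - A f) D UNIV"
    by (simp add: resolvent_set_def)
  then have "g \<in> (\<lambda>f. z *\<^sub>C f - A f) ` D"
    by (simp add: bij_betw_def)
  then obtain f' where "f' \<in> D" "z *\<^sub>C f' - A f' = g"
    by auto
  moreover from this have "f = f'"
    unfolding f_def by (rule resolvent_eqI[OF z])
  ultimately show "f \<in> D" "z *\<^sub>C f - A f = g"
    by auto
qed

lemma resolvent_identity:
  assumes z: "z \<in> resolvent_set D A" and w: "w \<in> resolvent_set D A"
  shows "resolvent D A w - resolvent D A z
    = resolvent D A z o\<^sub>L scaleC_blinfun (z - w) o\<^sub>L resolvent D A w"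
proof (rule blinfun_eqI)
  fix g
  let ?R = "\<lambda>z. blinfun_apply (resolvent D A z)"
  note R = resolvent_solves[OF w, of g]
  have "z *\<^sub>C ?R w g - A (?R w g) = (z - w) *\<^sub>C ?R w g + g"
    using R(2) by (simp add: scaleC_diff_left algebra_simps)
  then have "?R z ((z - w) *\<^sub>C ?R w g + g) = ?R w g"
    by (rule resolvent_eqI[OF z R(1)])
  then have "?R z ((z - w) *\<^sub>C ?R w g) + ?R z g = ?R w g"
    by (simp only: blinfun.add_right)
  then show "blinfun_apply (resolvent D A w - resolvent D A z) g
      = blinfun_apply (resolvent D A z o\<^sub>L scaleC_blinfun (z - w) o\<^sub>L resolvent D A w) g"
    by (simp add: blinfun.diff_left scaleC_blinfun.rep_eq diff_eq_eq)
qed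

lemma norm_scaleC_blinfun_le: "norm (scaleC_blinfun c) \<le> cmod c"
  by (rule norm_blinfun_bound) (simp_all add: scaleC_blinfun.rep_eq norm_scaleC)

lemma bounded_linear_scaleC_blinfun: "bounded_linear scaleC_blinfun"
proof (rule bounded_linear_intro[of _ 1])
  fix a b :: complex and r :: real
  have "(a + b) *\<^sub>C f = a *\<^sub>C f + b *\<^sub>C f" for f
    using scaleC_diff_left[of "a + b" b f] by simp
  then show "scaleC_blinfun (a + b) = scaleC_blinfun a + scaleC_blinfun b"
    by (intro blinfun_eqI) (simp add: scaleC_blinfun.rep_eq blinfun.add_left)
  show "scaleC_blinfun (r *\<^sub>R a) = r *\<^sub>R scaleC_blinfun a"
    by (intro blinfun_eqI)
       (simp add: scaleC_blinfun.rep_eq blinfun.scaleR_left scaleR_eq_scaleC scaleC_scaleC scaleR_conv_of_real)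
  show "norm (scaleC_blinfun a) \<le> norm a * 1"
    using norm_scaleC_blinfun_le[of a] by simp
qed

text \<open>By the resolvent identity, \<open>R w - R z\<close> is bounded by \<open>\<parallel>R z\<parallel> \<bar>z - w\<bar> \<parallel>R w\<parallel>\<close>. As soon as
  \<open>\<parallel>R z\<parallel> \<bar>z - w\<bar> < 1/2\<close>, this gives \<open>\<parallel>R w\<parallel> \<le> 2 \<parallel>R z\<parallel>\<close>, and a Lipschitz bound follows.\<close>

lemma continuous_on_resolvent: "continuous_on (resolvent_set D A) (resolvent D A)"
  unfolding continuous_on_def
proof
  fix z assume z: "z \<in> resolvent_set D A"
  let ?R = "resolvent D A"
  define K where "K = norm (?R z)"
  have K: "K \<ge> 0"
    by (simp add: K_def)
  have bound: "norm (?R w - ?R z) \<le> K * cmod (z - w) * norm (?R w)" if "w \<in> resolvent_set D A" for w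
  proof -
    have "norm (?R w - ?R z) \<le> norm (?R z o\<^sub>L scaleC_blinfun (z - w)) * norm (?R w)"
      unfolding resolvent_identity[OF z that] by (rule norm_blinfun_compose)
    also have "\<dots> \<le> (norm (?R z) * norm (scaleC_blinfun (z - w))) * norm (?R w)"
      by (intro mult_right_mono norm_blinfun_compose) simp
    also have "\<dots> \<le> (K * cmod (z - w)) * norm (?R w)"
      unfolding K_def by (intro mult_right_mono mult_left_mono norm_scaleC_blinfun_le) auto
    finally show ?thesis .
  qed
  have lim: "((\<lambda>w. K * cmod (z - w)) \<longlongrightarrow> 0) (at z within resolvent_set D A)"
    by (rule tendsto_eq_intros refl | simp)+
  then have "\<forall>\<^sub>F w in at z within resolvent_set D A. K * cmod (z - w) < 1 / 2"
    by (rule order_tendstoD) simp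
  moreover have "\<forall>\<^sub>F w in at z within resolvent_set D A. w \<in> resolvent_set D A"
    by (simp add: eventually_at_filter)
  ultimately have "\<forall>\<^sub>F w in at z within resolvent_set D A.
      norm (?R w - ?R z) \<le> (K * cmod (z - w)) * (2 * K)"
  proof eventually_elim
    case (elim w)
    have "norm (?R w) \<le> norm (?R z) + norm (?R w - ?R z)"
      using norm_triangle_ineq[of "?R z" "?R w - ?R z"] by simp
    also have "\<dots> \<le> K + K * cmod (z - w) * norm (?R w)"
      using bound[OF elim(2)] by (simp add: K_def)
    also have "\<dots> \<le> K + 1 / 2 * norm (?R w)"
      using elim(1) by (intro add_left_mono mult_right_mono) auto
    finally have "norm (?R w) \<le> 2 * K"
      by simp
    then have "K * cmod (z - w) * norm (?R w) \<le> K * cmod (z - w) * (2 * K)"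
      using K by (intro mult_left_mono) auto
    with bound[OF elim(2)] show ?case
      by (rule order_trans)
  qed
  moreover have "((\<lambda>w. (K * cmod (z - w)) * (2 * K)) \<longlongrightarrow> 0) (at z within resolvent_set D A)"
    by (rule tendsto_mult_left_zero[OF lim])
  ultimately have "((\<lambda>w. ?R w - ?R z) \<longlongrightarrow> 0) (at z within resolvent_set D A)"
    by (rule Lim_null_comparison)
  then show "(?R \<longlongrightarrow> ?R z) (at z within resolvent_set D A)"
    by (rule LIM_zero_cancel)
qed

text \<open>The operator-valued integral exists by continuity, so bounded functionals can be taken inside.
  Integrability is essential: the integral of a non-integrable function is 0 by convention.\<close>

lemma cinner_op_contour_integral:
  assumes r: "r > 0" and sphere: "sphere \<mu> r \<subseteq> resolvent_set D A"
  shows "((\<lambda>z. cinner h (blinfun_apply (resolvent D A z) f)) has_contour_integral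
      cinner h (blinfun_apply (op_contour_integral (circlepath \<mu> r) (resolvent D A)) f)) (circlepath \<mu> r)"
proof -
  let ?\<gamma> = "circlepath \<mu> r"
  let ?d = "\<lambda>x. vector_derivative ?\<gamma> (at x within {0..1})"
  let ?T = "\<lambda>x. scaleC_blinfun (?d x) o\<^sub>L resolvent D A (?\<gamma> x)"
  have d: "?d x = 2 * pi * \<i> * r * exp (2 * of_real pi * \<i> * x)" if "x \<in> {0..1}" for x
    using that by (intro vector_derivative_within_cbox[of 0 1, simplified] has_vector_derivative_circlepath) auto
  have "continuous_on {0..1} ?d"
    by (subst continuous_on_cong[OF refl d]) (auto intro!: continuous_intros)
  then have cont_d: "continuous_on {0..1} (\<lambda>x. scaleC_blinfun (?d x))"
    by (rule bounded_linear.continuous_on[OF bounded_linear_scaleC_blinfun])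
  have "continuous_on {0..1} ?\<gamma>"
    using path_circlepath by (simp add: path_def)
  moreover have "?\<gamma> ` {0..1} \<subseteq> resolvent_set D A"
    using sphere r path_image_circlepath_nonneg[of r \<mu>] by (simp add: path_image_def)
  ultimately have "continuous_on {0..1} (\<lambda>x. resolvent D A (?\<gamma> x))"
    by (rule continuous_on_compose2[OF continuous_on_resolvent])
  with cont_d have "continuous_on {0..1} ?T"
    by (rule bounded_bilinear.continuous_on[OF bounded_bilinear_blinfun_compose])
  then have "?T integrable_on {0..1}"
    by (rule integrable_continuous_real)
  then have int: "(?T has_integral op_contour_integral ?\<gamma> (resolvent D A)) {0..1}"
    unfolding op_contour_integral_def by (rule integrable_integral)
  have "bounded_linear (\<lambda>T. cinner h (blinfun_apply T f))"
    by (rule bounded_linear_compose[OF bounded_linear_cinner blinfun.bounded_linear_left])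
  from has_integral_linear[OF int this]
  have "((\<lambda>x. cinner h (blinfun_apply (?T x) f)) has_integral
      cinner h (blinfun_apply (op_contour_integral ?\<gamma> (resolvent D A)) f)) {0..1}"
    by (simp add: o_def)
  then show ?thesis
    unfolding has_contour_integral_def
    by (simp add: scaleC_blinfun.rep_eq cinner_scaleC mult.commute)
qed

text \<open>The radius in the definition of the spectral projection is an arbitrary admissible one, so the
  conclusion can only provide some admissible \<open>r\<close>.\<close>

lemma cinner_spectral_projection:
  assumes isolated: "r0 > 0" "cball \<mu> r0 \<inter> spectrum D A \<subseteq> {\<mu>}"
  obtains r where "r > 0" "cball \<mu> r \<inter> spectrum D A \<subseteq> {\<mu>}"
    "\<And>h f. ((\<lambda>z. cinner h (blinfun_apply (resolvent D A z) f)) has_contour_integral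
       2 * of_real pi * \<i> * cinner h (blinfun_apply (spectral_projection D A \<mu>) f)) (circlepath \<mu> r)"
proof -
  define r where "r = (SOME r. r > 0 \<and> cball \<mu> r \<inter> spectrum D A \<subseteq> {\<mu>})"
  have r: "r > 0 \<and> cball \<mu> r \<inter> spectrum D A \<subseteq> {\<mu>}"
    unfolding r_def by (rule someI[where x = r0]) (use isolated in auto)
  then have sphere: "sphere \<mu> r \<subseteq> resolvent_set D A"
    by (auto simp: spectrum_def)
  have P: "spectral_projection D A \<mu> = scaleC_blinfun (1 / (2 * of_real pi * \<i>)) o\<^sub>L
      op_contour_integral (circlepath \<mu> r) (resolvent D A)"
    by (simp add: spectral_projection_def r_def Let_def)
  show ?thesis
  proof (rule that[of r])
    show "((\<lambda>z. cinner h (blinfun_apply (resolvent D A z) f)) has_contour_integral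
       2 * of_real pi * \<i> * cinner h (blinfun_apply (spectral_projection D A \<mu>) f)) (circlepath \<mu> r)" for h f
      using cinner_op_contour_integral[OF conjunct1[OF r] sphere, of h f]
      by (simp add: P scaleC_blinfun.rep_eq cinner_scaleC)
  qed (use r in auto)
qed

section \<open>Explicit solutions\<close>

lemma weak_derivative_classical:
  fixes f f' :: "real \<Rightarrow> complex"
  assumes deriv: "\<And>x. x \<in> {0..pi} \<Longrightarrow> (f has_vector_derivative f' x) (at x within {0..pi})"
    and cont: "continuous_on {0..pi} f'"
  shows "weak_derivative f f'"
  unfolding weak_derivative_def
proof (intro allI impI)
  fix \<phi> \<phi>' assume \<phi>: "test_function \<phi> \<phi>'"
  have int: "integrable I_meas f'"
    by (rule integrable_I_meas_continuous[OF cont])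
  have d\<phi>: "((\<lambda>x. complex_of_real (\<phi> x)) has_vector_derivative of_real (\<phi>' x)) (at x within {0..pi})" for x
    using \<phi> unfolding test_function_def
    by (intro bounded_linear.has_vector_derivative[OF bounded_linear_of_real])
       (metis has_field_derivative_at_within has_real_derivative_iff_has_vector_derivative)
  have f: "f x = f 0 + integral {0..x} f'" if "x \<in> {0<..<pi}" for x
  proof -
    have "(f' has_integral (f x - f 0)) {0..x}"
      using that
      by (intro fundamental_theorem_of_calculus has_vector_derivative_within_subset[OF deriv]) auto
    then show ?thesis
      by (simp add: integral_unique)
  qed
  have "(\<integral>x. \<phi>' x *\<^sub>R f x \<partial>I_meas) = (\<integral>x. of_real (\<phi>' x) * (f 0 + integral {0..x} f') \<partial>I_meas)"
    by (rule Bochner_Integration.integral_cong) (auto simp: scaleR_conv_of_real f)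
  also have "\<dots> = - (\<integral>x. of_real (\<phi> x) * f' x \<partial>I_meas)"
    by (rule integration_by_parts_primitive[OF int d\<phi>])
       (auto intro!: continuous_intros test_function_continuous[OF \<phi>] simp: test_function_ends[OF \<phi>])
  finally show "(\<integral>x. \<phi>' x *\<^sub>R f x \<partial>I_meas) = - (\<integral>x. \<phi> x *\<^sub>R f' x \<partial>I_meas)"
    by (simp add: scaleR_conv_of_real)
qed

text \<open>Used twice: with \<open>c = 0\<close> for the eigenfunctions, and with \<open>c = 1/z\<close> for the resolvent applied to
  \<open>(1, 0)\<close>.\<close>

lemma L_exponential_pair:
  fixes u z a b c :: complex
  assumes u: "u \<noteq> 0"
    and bc: "c + a = b" "c + a * exp (z / u * pi) = b * exp (z / cnj u * pi)"
  defines "F \<equiv> \<lambda>x. (c + a * exp (z / u * of_real x), b * exp (z / cnj u * of_real x))"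
  shows "L2_of F \<in> L_dom" and "z *\<^sub>C L2_of F - L_op u (L2_of F) = L2_of (\<lambda>x. (z * c, 0))"
    and "continuous_on {0..pi} F"
proof -
  have exp_deriv: "((\<lambda>x. d + a * exp (w * of_real x)) has_vector_derivative w * (a * exp (w * of_real x))) (at x within S)"
    for d a w :: complex and x S
    by (rule has_vector_derivative_real_field) (auto intro!: derivative_eq_intros)
  define G where "G x = (z / u * (a * exp (z / u * of_real x)), z / cnj u * (b * exp (z / cnj u * of_real x)))" for x :: real
  show F: "continuous_on {0..pi} F"
    unfolding F_def by (intro continuous_intros) (use u in auto)
  have G: "continuous_on {0..pi} G"
    unfolding G_def by (intro continuous_intros) (use u in auto)
  have sq: "square_integrable F" "square_integrable G"
    by (simp_all add: square_integrable_continuous F G)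
  have "weak_derivative (\<lambda>x. fst (F x)) (\<lambda>x. fst (G x))"
    unfolding F_def G_def fst_conv
    by (rule weak_derivative_classical[OF exp_deriv]) (intro continuous_intros, use u in auto)
  moreover have "weak_derivative (\<lambda>x. snd (F x)) (\<lambda>x. snd (G x))"
    unfolding F_def G_def snd_conv
    using weak_derivative_classical[OF exp_deriv[of 0 b "z / cnj u"]] u
    by (simp add: continuous_intros)
  ultimately have weak: "has_weak_deriv (L2_of F) (L2_of G)"
    by (simp add: has_weak_deriv_L2_of sq)
  have bc': "fst (F 0) = snd (F 0)" "fst (F pi) = snd (F pi)"
    using bc by (simp_all add: F_def)
  note dom = L_domI[OF F weak bc']
  show "L2_of F \<in> L_dom"
    by (rule dom(1))
  have pointwise: "(\<lambda>x. (z * fst (F x), z * snd (F x)) - (u * fst (G x), cnj u * snd (G x))) = (\<lambda>x. (z * c, 0))"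
    using u by (intro ext) (simp add: F_def G_def distrib_left)
  show "z *\<^sub>C L2_of F - L_op u (L2_of F) = L2_of (\<lambda>x. (z * c, 0))"
    unfolding dom(2) L2_of_scaleC[OF sq(1)] L2_of_diag_mult[OF sq(2)]
      L2_of_diff[OF square_integrable_diag[OF sq(1)] square_integrable_diag[OF sq(2)]] pointwise ..
qed

lemma integral_exp_I_meas:
  fixes w :: complex
  assumes "w \<noteq> 0"
  shows "(\<integral>x. exp (w * of_real x) \<partial>I_meas) = (exp (w * pi) - 1) / w"
proof -
  have cont: "continuous_on {0..pi} (\<lambda>x. exp (w * of_real x))"
    by (intro continuous_intros)
  have "((\<lambda>x. exp (w * of_real x)) has_integral (exp (w * of_real pi) / w - exp (w * of_real 0) / w)) {0..pi}"
  proof (rule fundamental_theorem_of_calculus)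
    show "((\<lambda>x. exp (w * of_real x) / w) has_vector_derivative exp (w * of_real x)) (at x within {0..pi})" for x
      by (rule has_vector_derivative_real_field) (use assms in \<open>auto intro!: derivative_eq_intros\<close>)
  qed simp
  then show ?thesis
    unfolding I_meas_integral_eq[OF integrable_I_meas_continuous[OF cont]]
    by (simp add: integral_unique diff_divide_distrib)
qed

text \<open>The function whose components along the eigenfunctions are shown to grow exponentially; it
  violates the boundary condition at 0.\<close>

definition unit_fun :: L2 where
  "unit_fun = L2_of (\<lambda>_. (1, 0))"

text \<open>Multiplying by its conjugate cancels the oscillation \<open>e\<^bsup>inx\<^esup>\<close> in the second component of the \<open>n\<close>th
  eigenfunction, so that the inner product is the integral of a positive exponential. The first
  component is 0 because the second component of the resolvent applied to \<open>(1, 0)\<close> is a pure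
  exponential.\<close>

definition probe :: "nat \<Rightarrow> L2" where
  "probe n = L2_of (\<lambda>x. (0, exp (\<i> * n * of_real x)))"

lemma norm_unit_fun: "norm unit_fun \<le> sqrt pi"
proof -
  have "(\<lambda>x::real. (1::complex, 0::complex)) \<in> borel_measurable I_meas"
    by (rule measurable_const) simp
  from square_integrable_bounded(2)[OF this, of 1] show ?thesis
    by (simp add: unit_fun_def norm_Pair)
qed

lemma probe_continuous: "continuous_on {0..pi} (\<lambda>x. (0 :: complex, exp (\<i> * of_nat n * complex_of_real x)))"
  by (intro continuous_intros)

lemma norm_probe: "norm (probe n) \<le> sqrt pi"
  using square_integrable_bounded(2)[OF measurable_I_meas_continuous[OF probe_continuous[of n]], of 1]
  by (simp add: probe_def norm_Pair)

lemma cinner_probe: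
  fixes b w :: complex and F :: "real \<Rightarrow> complex \<times> complex"
  assumes F: "continuous_on {0..pi} F" "\<And>x. snd (F x) = b * exp (w * of_real x)" and w: "w \<noteq> \<i> * n"
  shows "cinner (probe n) (L2_of F) = b * ((exp ((w - \<i> * n) * pi) - 1) / (w - \<i> * n))"
proof -
  have "cinner (probe n) (L2_of F) = (\<integral>x. b * exp ((w - \<i> * n) * of_real x) \<partial>I_meas)"
    unfolding probe_def
    by (subst cinner_L2_of(2)[OF square_integrable_continuous[OF F(1)] square_integrable_continuous[OF probe_continuous]])
       (simp add: F(2) exp_cnj left_diff_distrib exp_diff exp_minus field_simps)
  also have "\<dots> = b * ((exp ((w - \<i> * n) * pi) - 1) / (w - \<i> * n))"
    using integral_exp_I_meas[of "w - \<i> * n"] w by simp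
  finally show ?thesis .
qed

text \<open>\<open>R(z) (1, 0)\<close> is the particular solution \<open>(1/z, 0)\<close> plus \<open>(a e\<^bsup>zx/u\<^esup>, b e\<^bsup>zx/cnj u\<^esup>)\<close>, and the two boundary
  conditions determine \<open>a\<close> and \<open>b\<close>.\<close>

lemma cinner_probe_resolvent_unit_fun:
  fixes u z :: complex
  assumes u: "u \<noteq> 0" and z: "z \<noteq> 0" "char_det u z \<noteq> 0" and pole: "z / cnj u \<noteq> \<i> * n"
  shows "cinner (probe n) (blinfun_apply (resolvent L_dom (L_op u) z) unit_fun)
    = ((exp (z / u * pi) - 1) / z * ((exp ((z / cnj u - \<i> * n) * pi) - 1) / (z / cnj u - \<i> * n))) / char_det u z"
proof -
  define b where "b = (exp (z / u * pi) - 1) / (z * char_det u z)"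
  define a where "a = b - 1 / z"
  have "1 / z + a * exp (z / u * pi) = b * exp (z / cnj u * pi)"
  proof -
    have "b * char_det u z = (exp (z / u * pi) - 1) / z"
      using z by (simp add: b_def)
    then show ?thesis
      by (simp add: a_def char_det_def algebra_simps diff_divide_distrib)
  qed
  moreover have "1 / z + a = b"
    by (simp add: a_def)
  ultimately have *: "1 / z + a = b" "1 / z + a * exp (z / u * pi) = b * exp (z / cnj u * pi)"
    by blast+
  define F where "F x = (1 / z + a * exp (z / u * of_real x), b * exp (z / cnj u * of_real x))" for x :: real
  note sol = L_exponential_pair[OF u *, folded F_def]
  have "blinfun_apply (resolvent L_dom (L_op u) z) unit_fun = L2_of F"
    using resolvent_eqI[OF resolvent_set_L[OF u z(2)] sol(1,2)] z(1) by (simp add: unit_fun_def)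
  moreover have "snd (F x) = b * exp (z / cnj u * of_real x)" for x
    by (simp add: F_def)
  ultimately show ?thesis
    using cinner_probe[OF sol(3) _ pole, of b] by (simp add: b_def)
qed

section \<open>Eigenvalues and eigenfunctions\<close>

lemma eigval_div:
  assumes st: "s > 0" "t > 0" "u = Complex s t"
  shows "of_real (eigval s t n) / u = of_real (s * n / t) - \<i> * of_int n"
    and "of_real (eigval s t n) / cnj u = of_real (s * n / t) + \<i> * of_int n"
proof -
  have u: "u \<noteq> 0" "cnj u \<noteq> 0"
    using st by (auto simp: complex_eq_iff)
  show "of_real (eigval s t n) / u = of_real (s * n / t) - \<i> * of_int n"
    unfolding nonzero_divide_eq_eq[OF u(1)] using st
    by (simp add: complex_eq_iff eigval_def field_simps power2_eq_square)
  show "of_real (eigval s t n) / cnj u = of_real (s * n / t) + \<i> * of_int n"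
    unfolding nonzero_divide_eq_eq[OF u(2)] using st
    by (simp add: complex_eq_iff eigval_def field_simps power2_eq_square)
qed

lemma norm_exp_eigval:
  assumes st: "s > 0" "t > 0" "u = Complex s t"
  shows "cmod (exp (of_real (eigval s t n) / u * pi)) = exp (s * n / t * pi)"
    and "cmod (exp (- (of_real (eigval s t n) / u) * pi)) = exp (- (s * n / t * pi))"
  by (simp_all add: eigval_div(1)[OF st])

lemma eigval_diff: "eigval s t m - eigval s t n = eigval s t (m - n)"
  by (simp add: eigval_def diff_divide_distrib right_diff_distrib)

lemma dist_eigval:
  assumes "t > 0"
  shows "cmod (of_real (eigval s t m) - of_real (eigval s t n)) = (s\<^sup>2 + t\<^sup>2) / t * \<bar>real_of_int (m - n)\<bar>"
proof -
  have "cmod (of_real (eigval s t m) - of_real (eigval s t n)) = \<bar>eigval s t (m - n)\<bar>"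
    by (simp only: of_real_diff[symmetric] norm_of_real eigval_diff)
  then show ?thesis
    using assms by (simp add: eigval_def abs_mult)
qed

text \<open>The summand 0 and the factors 1 bring \<open>eigfun\<close> into the shape of \<open>L_exponential_pair\<close> and
  \<open>cinner_probe\<close>.\<close>

lemma eigfun_eq: "eigfun s t n = L2_of (\<lambda>x. (0 + 1 * exp (of_real (eigval s t n) / Complex s t * of_real x),
    1 * exp (of_real (eigval s t n) / cnj (Complex s t) * of_real x)))"
proof -
  have "of_real x * \<mu> / w = \<mu> / w * of_real x" for x and \<mu> w :: complex
    by simp
  then show ?thesis
    by (simp only: eigfun_def Let_def add_0 mult_1)
qed

lemma eigfun_eigenvector:
  assumes st: "s > 0" "t > 0" "u = Complex s t"
  shows "eigfun s t n \<in> L_dom"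
    and "of_real (eigval s t n) *\<^sub>C eigfun s t n - L_op u (eigfun s t n) = 0"
proof -
  have u: "Complex s t \<noteq> 0"
    using st by (auto simp: complex_eq_iff)
  have "char_det u (of_real (eigval s t n)) = 0"
    using char_det_eq_0_iff[OF st] by blast
  then have bc: "0 + 1 * exp (of_real (eigval s t n) / Complex s t * pi) = 1 * exp (of_real (eigval s t n) / cnj (Complex s t) * pi)"
    unfolding char_det_def st(3) by simp
  note sol = L_exponential_pair[OF u _ bc, folded eigfun_eq]
  show "eigfun s t n \<in> L_dom"
    using sol(1) by simp
  show "of_real (eigval s t n) *\<^sub>C eigfun s t n - L_op u (eigfun s t n) = 0"
    using sol(2) by (simp add: st(3) zero_L2.abs_eq zero_prod_def)
qed

lemma exp_quotient_of_real:
  fixes y :: real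
  assumes "y > 0"
  shows "cmod ((exp (of_real y * of_real pi) - 1) / of_real y) = (exp (y * pi) - 1) / y"
proof -
  have "exp (complex_of_real y * of_real pi) = of_real (exp (y * pi))"
    unfolding of_real_mult[symmetric] by (rule exp_of_real)
  then have "(exp (complex_of_real y * of_real pi) - 1) / of_real y = of_real ((exp (y * pi) - 1) / y)"
    by simp
  then have "cmod ((exp (of_real y * of_real pi) - 1) / of_real y) = \<bar>(exp (y * pi) - 1) / y\<bar>"
    by (simp only: norm_of_real)
  moreover have "(exp (y * pi) - 1) / y \<ge> 0"
    using assms by (intro divide_nonneg_pos) auto
  ultimately show ?thesis
    by (simp only: abs_of_nonneg)
qed

lemma cinner_probe_eigfun:
  assumes st: "s > 0" "t > 0" "u = Complex s t" and n: "n > 0"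
  shows "cmod (cinner (probe n) (eigfun s t (int n))) = (exp (s * n / t * pi) - 1) / (s * n / t)"
proof -
  let ?w = "of_real (eigval s t (int n)) / cnj (Complex s t) :: complex"
  have w: "?w - \<i> * n = of_real (s * n / t)"
    using eigval_div(2)[OF st(1,2) refl, of "int n"] by (simp del: complex_cnj)
  have cont: "continuous_on {0..pi} (\<lambda>x. (0 + 1 * exp (of_real (eigval s t (int n)) / Complex s t * complex_of_real x), 1 * exp (?w * of_real x)))"
    by (intro continuous_intros) (use st in \<open>auto simp: complex_eq_iff\<close>)
  have "s * n / t > 0"
    using st n by simp
  then have "?w \<noteq> \<i> * n"
    using w by (metis eq_iff_diff_eq_0 less_irrefl of_real_eq_0_iff)
  from cinner_probe[OF cont _ this, of 1]
  have "cinner (probe n) (eigfun s t (int n)) = (exp (of_real (s * n / t) * of_real pi) - 1) / of_real (s * n / t)"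
    unfolding eigfun_eq w by simp
  then show ?thesis
    using exp_quotient_of_real[OF \<open>s * n / t > 0\<close>] by simp
qed

lemma eigfun_nonzero:
  assumes st: "s > 0" "t > 0"
  shows "eigfun s t n \<noteq> 0"
proof
  let ?e1 = "\<lambda>x. 0 + 1 * exp (of_real (eigval s t n) / Complex s t * complex_of_real x)"
  let ?F = "\<lambda>x. (?e1 x, 1 * exp (of_real (eigval s t n) / cnj (Complex s t) * complex_of_real x))"
  assume "eigfun s t n = 0"
  then have eq: "L2_of ?F = L2_of (\<lambda>_. 0)"
    by (simp only: eigfun_eq zero_L2.abs_eq)
  have nz: "Complex s t \<noteq> 0" "cnj (Complex s t) \<noteq> 0"
    using st by (auto simp: complex_eq_iff)
  have cont1: "continuous_on {0..pi} ?e1"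
    by (intro continuous_intros nz)
  have cont: "continuous_on {0..pi} ?F"
    by (intro continuous_intros nz)
  have "AE x in I_meas. ?F x = 0"
    by (rule L2_of_eq_iff[THEN iffD1, OF square_integrable_continuous[OF cont] square_integrable_zero eq])
  then have "AE x in I_meas. ?e1 x = 0"
    by (rule eventually_mono) (simp add: zero_prod_def)
  then have "?e1 0 = 0"
    by (rule continuous_AE_zero[OF cont1]) simp
  then show False
    by simp
qed

lemma eigval_in_spectrum:
  assumes st: "s > 0" "t > 0" "u = Complex s t"
  shows "of_real (eigval s t n) \<in> spectrum L_dom (L_op u)"
proof (rule ccontr)
  assume "\<not> ?thesis"
  then have z: "of_real (eigval s t n) \<in> resolvent_set L_dom (L_op u)"
    by (simp add: spectrum_def)
  have "blinfun_apply (resolvent L_dom (L_op u) (of_real (eigval s t n))) 0 = eigfun s t n"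
    by (rule resolvent_eqI[OF z eigfun_eigenvector[OF st]])
  then show False
    using eigfun_nonzero[OF st(1,2)] by simp
qed

lemma spectrum_subset:
  assumes st: "s > 0" "t > 0" "u = Complex s t"
  shows "spectrum L_dom (L_op u) \<subseteq> range (\<lambda>k. of_real (eigval s t k))"
proof -
  have "u \<noteq> 0"
    using st by (auto simp: complex_eq_iff)
  then show ?thesis
    using resolvent_set_L char_det_eq_0_iff[OF st] by (fastforce simp: spectrum_def)
qed

section \<open>Growth of the spectral projections\<close>

text \<open>With \<open>q = s \<pi> / t\<close>, this is the lower bound \<open>(1 - e\<^bsup>-qn\<^esup>) / (2\<pi>n)\<close> for the modulus of the
  coefficient of \<open>(1, 0)\<close> along the \<open>n\<close>th eigenfunction, times the inner product
  \<open>(e\<^bsup>qn\<^esup> - 1) t / (sn)\<close> of that eigenfunction with \<open>probe n\<close>.\<close>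

definition growth :: "real \<Rightarrow> real \<Rightarrow> nat \<Rightarrow> real" where
  "growth s t n = (1 - exp (- (s * n / t * pi))) * (exp (s * n / t * pi) - 1) * t / (2 * pi * s * (real n)\<^sup>2)"

lemma cmod_inverse_diff_cnj:
  assumes st: "s > 0" "t > 0" "u = Complex s t"
  shows "cmod (1 / u - 1 / cnj u) = 2 * t / (s\<^sup>2 + t\<^sup>2)"
proof -
  have "(s\<^sup>2 + t\<^sup>2) / t > 0"
    using st by (simp add: add_pos_pos)
  then show ?thesis
    unfolding inverse_diff_cnj[OF st] norm_minus_cancel norm_divide norm_of_real
    using st(2) by (simp add: norm_mult)
qed

text \<open>Neighbouring eigenvalues have distance \<open>d\<close>. The first part shows that an admissible radius exists,
  the second that every admissible radius is smaller than \<open>d\<close>: otherwise the disc would contain the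
  next eigenvalue.\<close>

lemma eigval_isolated:
  assumes st: "s > 0" "t > 0" "u = Complex s t"
  defines "d \<equiv> (s\<^sup>2 + t\<^sup>2) / t"
  shows "cball (of_real (eigval s t n)) (d / 2) \<inter> spectrum L_dom (L_op u) \<subseteq> {of_real (eigval s t n)}"
    and "cball (of_real (eigval s t n)) r \<inter> spectrum L_dom (L_op u) \<subseteq> {of_real (eigval s t n)} \<Longrightarrow> r < d"
    and "z \<in> ball (of_real (eigval s t n)) d \<Longrightarrow> z \<noteq> of_real (eigval s t n) \<Longrightarrow> char_det u z \<noteq> 0"
proof -
  have d: "d > 0"
    using st by (simp add: d_def add_pos_pos)
  have far: "cmod (of_real (eigval s t n) - of_real (eigval s t k)) \<ge> d" if "k \<noteq> n" for k
  proof -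
    have "\<bar>real_of_int (n - k)\<bar> \<ge> 1"
      using that by linarith
    then show ?thesis
      using d unfolding dist_eigval[OF st(2)] d_def[symmetric] by (simp add: mult_le_cancel_left1)
  qed
  show "cball (of_real (eigval s t n)) (d / 2) \<inter> spectrum L_dom (L_op u) \<subseteq> {of_real (eigval s t n)}"
  proof
    fix z assume z: "z \<in> cball (of_real (eigval s t n)) (d / 2) \<inter> spectrum L_dom (L_op u)"
    then obtain k where k: "z = of_real (eigval s t k)"
      using spectrum_subset[OF st] by blast
    have "k = n"
    proof (rule ccontr)
      assume "k \<noteq> n"
      from far[OF this] z d show False
        by (simp add: k dist_norm)
    qed
    then show "z \<in> {of_real (eigval s t n)}"
      by (simp add: k)
  qed
  show "r < d" if "cball (of_real (eigval s t n)) r \<inter> spectrum L_dom (L_op u) \<subseteq> {of_real (eigval s t n)}"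
  proof (rule ccontr)
    assume "\<not> r < d"
    have dist: "cmod (of_real (eigval s t n) - of_real (eigval s t (n + 1))) = d"
      unfolding dist_eigval[OF st(2)] d_def by simp
    with \<open>\<not> r < d\<close> have "of_real (eigval s t (n + 1)) \<in> cball (complex_of_real (eigval s t n)) r"
      by (simp add: dist_norm)
    then have "of_real (eigval s t (n + 1)) = complex_of_real (eigval s t n)"
      using that eigval_in_spectrum[OF st, of "n + 1"] by blast
    then show False
      using dist d by simp
  qed
  show "char_det u z \<noteq> 0" if z: "z \<in> ball (of_real (eigval s t n)) d" "z \<noteq> of_real (eigval s t n)"
  proof
    assume "char_det u z = 0"
    then obtain k where k: "z = of_real (eigval s t k)"
      using char_det_eq_0_iff[OF st] by blast
    with z have "k \<noteq> n"
      by auto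
    from far[OF this] z(1) show False
      by (simp add: k dist_norm)
  qed
qed

lemma has_field_derivative_char_det:
  fixes u z :: complex
  shows "u \<noteq> 0 \<Longrightarrow> (char_det u has_field_derivative
      (pi / u * exp (z / u * pi) - pi / cnj u * exp (z / cnj u * pi))) (at z within S)"
  unfolding char_det_def[abs_def] by (auto intro!: derivative_eq_intros simp: mult.commute)

text \<open>Residue calculus for \<open>G / char_det u\<close> on the disc of radius \<open>d\<close> around the eigenvalue. The denominators
  of \<open>G\<close> vanish at 0 and at \<open>i n cnj u\<close>; the latter has imaginary part \<open>sn\<close>, and the assumption \<open>large\<close>
  keeps it outside the disc.\<close>

lemma cinner_probe_spectral_projection:
  fixes s t :: real and u \<mu> :: complex and n :: nat
  assumes st: "s > 0" "t > 0" "u = Complex s t" and n: "n > 0" and large: "s * n \<ge> (s\<^sup>2 + t\<^sup>2) / t"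
  defines "\<mu> \<equiv> of_real (eigval s t (int n))"
  shows "cinner (probe n) (blinfun_apply (spectral_projection L_dom (L_op u) \<mu>) unit_fun)
    = ((exp (\<mu> / u * pi) - 1) / \<mu> * ((exp ((\<mu> / cnj u - \<i> * n) * pi) - 1) / (\<mu> / cnj u - \<i> * n)))
      / (pi * (1 / u - 1 / cnj u) * exp (\<mu> / u * pi))"
proof -
  define d where "d = (s\<^sup>2 + t\<^sup>2) / t"
  define G where "G z = (exp (z / u * pi) - 1) / z * ((exp ((z / cnj u - \<i> * n) * pi) - 1) / (z / cnj u - \<i> * n))" for z
  have u: "u \<noteq> 0" "cnj u \<noteq> 0"
    using st by (auto simp: complex_eq_iff)
  have d: "d > 0"
    using st by (simp add: d_def add_pos_pos)
  note isolated = eigval_isolated[OF st, where n = "int n", folded \<mu>_def d_def]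
  have nonzero: "z \<noteq> 0" if "z \<in> ball \<mu> d" for z
  proof
    assume "z = 0"
    moreover have "cmod \<mu> = d * n"
      using dist_eigval[OF st(2), of s "int n" 0] by (simp add: \<mu>_def d_def eigval_def)
    moreover have "d * n \<ge> d"
      using n d by (simp add: mult_le_cancel_left1)
    ultimately show False
      using that by simp
  qed
  have pole: "z / cnj u - \<i> * n \<noteq> 0" if "z \<in> ball \<mu> d" for z
  proof
    assume "z / cnj u - \<i> * n = 0"
    then have "z = \<i> * n * cnj u"
      using u(2) by (simp add: field_simps)
    then have "Im (\<mu> - z) = - (s * n)"
      by (simp add: \<mu>_def st(3))
    then have "cmod (\<mu> - z) \<ge> s * n"
      using abs_Im_le_cmod[of "\<mu> - z"] by simp
    with that large show False
      by (simp add: dist_norm d_def)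
  qed
  have G_holo: "G holomorphic_on ball \<mu> d"
    unfolding G_def[abs_def] using nonzero pole u
    by (intro holomorphic_intros) auto
  have det_holo: "char_det u holomorphic_on ball \<mu> d"
    unfolding char_det_def[abs_def] using u by (intro holomorphic_intros) auto
  have det_0: "char_det u \<mu> = 0"
    using char_det_eq_0_iff[OF st] by (auto simp: \<mu>_def)
  then have "exp (\<mu> / cnj u * pi) = exp (\<mu> / u * pi)"
    by (simp add: char_det_def)
  then have deriv: "(char_det u has_field_derivative (pi * (1 / u - 1 / cnj u) * exp (\<mu> / u * pi))) (at \<mu>)"
    using has_field_derivative_char_det[OF u(1), of \<mu> UNIV] by (simp add: algebra_simps)
  have "cmod (1 / u - 1 / cnj u) > 0"
    unfolding cmod_inverse_diff_cnj[OF st] using st by (simp add: add_pos_pos)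
  then have deriv_nz: "pi * (1 / u - 1 / cnj u) * exp (\<mu> / u * pi) \<noteq> 0"
    by simp
  have pos: "s * n * pi / t > 0"
    using st n by simp
  have G_nz: "G \<mu> \<noteq> 0"
  proof -
    have "cmod (exp (\<mu> / u * pi)) > 1" "cmod (exp ((\<mu> / cnj u - \<i> * n) * pi)) > 1"
      using norm_exp_eigval(1)[OF st, of "int n"] eigval_div(2)[OF st, of "int n"] pos
      by (simp_all add: \<mu>_def)
    then have "exp (\<mu> / u * pi) \<noteq> 1" "exp ((\<mu> / cnj u - \<i> * n) * pi) \<noteq> 1"
      by (metis less_irrefl norm_one)+
    moreover have "\<mu> \<in> ball \<mu> d"
      using d by simp
    ultimately show ?thesis
      using nonzero[of \<mu>] pole[of \<mu>] by (simp add: G_def)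
  qed
  have residue: "residue (\<lambda>z. G z / char_det u z) \<mu> = G \<mu> / (pi * (1 / u - 1 / cnj u) * exp (\<mu> / u * pi))"
    by (rule residue_simple_pole_deriv[OF G_holo det_holo _ _ _ deriv G_nz det_0 deriv_nz]) (use d in auto)
  obtain r where r: "r > 0" "cball \<mu> r \<inter> spectrum L_dom (L_op u) \<subseteq> {\<mu>}"
    "\<And>h f. ((\<lambda>z. cinner h (blinfun_apply (resolvent L_dom (L_op u) z) f)) has_contour_integral
       2 * of_real pi * \<i> * cinner h (blinfun_apply (spectral_projection L_dom (L_op u) \<mu>) f)) (circlepath \<mu> r)"
    using cinner_spectral_projection[OF _ isolated(1)] d by (metis half_gt_zero)
  have "r < d"
    by (rule isolated(2)[OF r(2)])
  then have sub: "cball \<mu> r \<subseteq> ball \<mu> d"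
    by auto
  have "((\<lambda>z. G z / char_det u z) has_contour_integral 2 * pi * \<i> * residue (\<lambda>z. G z / char_det u z) \<mu>) (circlepath \<mu> r)"
  proof (rule base_residue[OF open_ball _ r(1) _ sub])
    show "(\<lambda>z. G z / char_det u z) holomorphic_on ball \<mu> d - {\<mu>}"
      using G_holo det_holo isolated(3)
      by (intro holomorphic_on_divide) (auto intro: holomorphic_on_subset)
  qed (use d in auto)
  moreover have "((\<lambda>z. G z / char_det u z) has_contour_integral
      2 * of_real pi * \<i> * cinner (probe n) (blinfun_apply (spectral_projection L_dom (L_op u) \<mu>) unit_fun)) (circlepath \<mu> r)"
  proof (rule has_contour_integral_eq[OF r(3)])
    fix z assume "z \<in> path_image (circlepath \<mu> r)"
    then have "z \<in> ball \<mu> d" "z \<noteq> \<mu>"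
      using sub r(1) by (auto simp: path_image_circlepath_nonneg)
    then show "cinner (probe n) (blinfun_apply (resolvent L_dom (L_op u) z) unit_fun) = G z / char_det u z"
      unfolding G_def using nonzero pole isolated(3) u
      by (intro cinner_probe_resolvent_unit_fun) auto
  qed
  ultimately have "residue (\<lambda>z. G z / char_det u z) \<mu>
      = cinner (probe n) (blinfun_apply (spectral_projection L_dom (L_op u) \<mu>) unit_fun)"
    using has_contour_integral_unique by fastforce
  then show ?thesis
    unfolding residue by (simp only: G_def)
qed

lemma growth_le_norm_spectral_projection:
  fixes s t :: real and u :: complex and n :: nat
  assumes st: "s > 0" "t > 0" "u = Complex s t" and n: "n > 0" and large: "s * n \<ge> (s\<^sup>2 + t\<^sup>2) / t"
  shows "growth s t n \<le> 2 * pi * norm (spectral_projection L_dom (L_op u) (of_real (eigval s t (int n))))"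
proof -
  define \<mu> where "\<mu> = complex_of_real (eigval s t (int n))"
  define P where "P = spectral_projection L_dom (L_op u) \<mu>"
  define q where "q = s * n / t * pi"
  have pos: "s\<^sup>2 + t\<^sup>2 > 0"
    using st by (simp add: add_pos_pos)
  have q: "q > 0"
    using st n by (simp add: q_def)
  have e1: "cmod (exp (\<mu> / u * pi)) = exp q"
    using norm_exp_eigval(1)[OF st, of "int n"] by (simp add: \<mu>_def q_def)
  have e2: "\<mu> / cnj u - \<i> * n = of_real (s * n / t)"
    using eigval_div(2)[OF st, of "int n"] by (simp add: \<mu>_def)
  have e3: "cmod ((exp ((\<mu> / cnj u - \<i> * n) * pi) - 1) / (\<mu> / cnj u - \<i> * n)) = (exp q - 1) / (s * n / t)"
    unfolding e2 q_def by (rule exp_quotient_of_real) (use st n in simp)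
  have e4: "cmod \<mu> = (s\<^sup>2 + t\<^sup>2) / t * n"
    unfolding \<mu>_def norm_of_real using st pos by (simp add: eigval_def abs_mult abs_of_pos)
  have e5: "exp q - 1 \<le> cmod (exp (\<mu> / u * pi) - 1)"
    using norm_triangle_ineq2[of "exp (\<mu> / u * pi)" 1] e1 by simp
  have "growth s t n = (exp q - 1) / ((s\<^sup>2 + t\<^sup>2) / t * n) * ((exp q - 1) / (s * n / t)) / (pi * (2 * t / (s\<^sup>2 + t\<^sup>2)) * exp q)"
  proof -
    have alg: "((E - 1) / E) * (E - 1) * t / (2 * pi * s * m\<^sup>2)
        = (E - 1) / (N / t * m) * ((E - 1) / (s * m / t)) / (pi * (2 * t / N) * E)"
      if "E > 0" "N > 0" "m > 0" for E N m :: real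
      using that st by (simp add: field_simps power2_eq_square)
    have "1 - exp (- q) = (exp q - 1) / exp q"
      by (simp add: exp_minus field_simps)
    then show ?thesis
      using alg[of "exp q" "s\<^sup>2 + t\<^sup>2" "real n"] pos n by (simp only: growth_def q_def[symmetric]) simp
  qed
  also have "\<dots> \<le> cmod (exp (\<mu> / u * pi) - 1) / ((s\<^sup>2 + t\<^sup>2) / t * n) * ((exp q - 1) / (s * n / t)) / (pi * (2 * t / (s\<^sup>2 + t\<^sup>2)) * exp q)"
    using q st pos by (intro divide_right_mono mult_right_mono e5) auto
  also have "\<dots> = cmod (cinner (probe n) (blinfun_apply P unit_fun))"
    unfolding P_def \<mu>_def cinner_probe_spectral_projection[OF st n large]
    unfolding \<mu>_def[symmetric] norm_mult norm_divide[of _ "_ * _"] e3 e1 cmod_inverse_diff_cnj[OF st]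
    by (simp add: norm_divide norm_mult e4)
  also have "\<dots> \<le> 2 * norm (probe n) * norm (blinfun_apply P unit_fun)"
    by (rule norm_cinner_le)
  also have "\<dots> \<le> 2 * sqrt pi * (norm P * sqrt pi)"
    using norm_blinfun[of P unit_fun] norm_unit_fun norm_probe[of n]
    by (intro mult_mono order_trans[OF norm_blinfun mult_left_mono]) auto
  also have "\<dots> = 2 * pi * norm P"
    by simp
  finally show ?thesis
    by (simp add: P_def \<mu>_def)
qed

text \<open>Half of the rate \<open>s \<pi> / t\<close> is given away to absorb the factor \<open>n\<^bsup>-2\<^esup>\<close> and the constants.\<close>

lemma growth_exponential:
  assumes "s > 0" "t > 0"
  shows "\<forall>\<^sub>F n in sequentially. exp (s * pi / (2 * t) * real n) \<le> growth s t n"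
proof -
  define q where "q = s * pi / (2 * t)"
  define C where "C = t / (2 * pi * s)"
  have q: "q > 0" "C > 0"
    using assms by (simp_all add: q_def C_def)
  have "\<forall>\<^sub>F n in sequentially. exp (q * real n) \<le> (1 - exp (- (2 * q * n))) * (exp (2 * q * n) - 1) * C / (real n)\<^sup>2"
    using q by real_asymp
  then show ?thesis
    using assms by (simp add: growth_def q_def C_def field_simps)
qed

section \<open>Failure of the basis property\<close>

text \<open>The eigenfunctions of the adjoint operator. The outer conjugations cancel against the one in the
  inner product; the opposite signs of the components come from the boundary conditions
  \<open>cnj u g\<^sub>1 + u g\<^sub>2 = 0\<close> of the adjoint.\<close>

definition dual_eigfun :: "real \<Rightarrow> real \<Rightarrow> int \<Rightarrow> L2" where
  "dual_eigfun s t n = (let u = Complex s t; \<mu> = complex_of_real (eigval s t n) in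
     L2_of (\<lambda>x. (cnj (exp (- (\<mu> / u) * of_real x) / u), cnj (- exp (- (\<mu> / cnj u) * of_real x) / cnj u))))"

text \<open>For \<open>d \<noteq> 0\<close> the weights \<open>1/u\<close> and \<open>1/cnj u\<close> cancel the denominators of the two exponential integrals,
  and only their boundary terms at \<open>\<pi>\<close> survive, which form \<open>char_det u d\<close>.\<close>

lemma integral_exp_pair:
  fixes u d :: complex
  assumes u: "u \<noteq> 0"
  shows "(\<integral>x. exp (d / u * of_real x) / u - exp (d / cnj u * of_real x) / cnj u \<partial>I_meas)
    = (if d = 0 then pi * (1 / u - 1 / cnj u) else char_det u d / d)"
proof -
  interpret finite_measure I_meas by (rule finite_measure_I_meas)
  have int: "integrable I_meas (\<lambda>x. exp (w * complex_of_real x))" for w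
    by (intro integrable_I_meas_continuous continuous_intros)
  have split: "(\<integral>x. exp (d / u * of_real x) / u - exp (d / cnj u * of_real x) / cnj u \<partial>I_meas)
      = (\<integral>x. exp (d / u * of_real x) \<partial>I_meas) / u - (\<integral>x. exp (d / cnj u * of_real x) \<partial>I_meas) / cnj u"
    by (subst Bochner_Integration.integral_diff) (simp_all only: integrable_divide_zero int integral_divide_zero)
  show ?thesis
  proof (cases "d = 0")
    case True
    have "(\<integral>x. exp (0 * complex_of_real x) \<partial>I_meas) = pi"
      using measure_I_meas by (simp add: scaleR_conv_of_real)
    then show ?thesis
      unfolding split using True by (simp add: right_diff_distrib)
  next
    case False
    with u have "d / u \<noteq> 0" "d / cnj u \<noteq> 0"
      by simp_all
    from this[THEN integral_exp_I_meas] show ?thesis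
      unfolding split using u False by (simp add: char_det_def diff_divide_distrib)
  qed
qed

lemma cinner_dual_eigfun:
  assumes st: "s > 0" "t > 0" "u = Complex s t" and F: "continuous_on {0..pi} F"
  shows "cinner (dual_eigfun s t n) (L2_of F) =
    (\<integral>x. fst (F x) * (exp (- (of_real (eigval s t n) / u) * of_real x) / u)
        - snd (F x) * (exp (- (of_real (eigval s t n) / cnj u) * of_real x) / cnj u) \<partial>I_meas)"
proof -
  let ?G = "\<lambda>x. (cnj (exp (- (of_real (eigval s t n) / u) * of_real x) / u),
      cnj (- exp (- (of_real (eigval s t n) / cnj u) * of_real x) / cnj u))"
  have u: "u \<noteq> 0" "cnj u \<noteq> 0"
    using st by (auto simp: complex_eq_iff)
  have G: "continuous_on {0..pi} ?G"
    by (intro continuous_intros) (use u in auto)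
  have "dual_eigfun s t n = L2_of ?G"
    by (simp only: dual_eigfun_def Let_def st(3))
  then have "cinner (dual_eigfun s t n) (L2_of F) =
      (\<integral>x. fst (F x) * cnj (fst (?G x)) + snd (F x) * cnj (snd (?G x)) \<partial>I_meas)"
    by (simp only: cinner_L2_of(2)[OF square_integrable_continuous[OF F] square_integrable_continuous[OF G]])
  then show ?thesis
    by (simp only: fst_conv snd_conv complex_cnj_cnj minus_divide_left[symmetric] mult_minus_right
        add_uminus_conv_diff)
qed

text \<open>The inner product is \<open>integral_exp_pair\<close> at the difference of the eigenvalues, which is itself an
  eigenvalue and hence a zero of \<open>char_det u\<close>.\<close>

lemma eigfun_biorthogonal:
  assumes st: "s > 0" "t > 0" "u = Complex s t"
  shows "cinner (dual_eigfun s t n) (eigfun s t m) = (if m = n then pi * (1 / u - 1 / cnj u) else 0)"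
proof -
  define d where "d = complex_of_real (eigval s t (m - n))"
  have u: "u \<noteq> 0" "cnj u \<noteq> 0"
    using st by (auto simp: complex_eq_iff)
  have d: "d = of_real (eigval s t m) - of_real (eigval s t n)"
    by (simp only: d_def of_real_diff[symmetric] eigval_diff)
  have d0: "d = 0 \<longleftrightarrow> m = n"
    using st by (simp add: d_def eigval_def add_pos_pos less_imp_neq[symmetric] del: of_real_divide of_real_mult)
  have F: "continuous_on {0..pi} (\<lambda>x. (0 + 1 * exp (of_real (eigval s t m) / u * complex_of_real x),
      1 * exp (of_real (eigval s t m) / cnj u * complex_of_real x)))"
    by (intro continuous_intros) (use u in auto)
  have prod: "exp (a / v * of_real x) * (exp (- (b / v) * of_real x) / v) = exp ((a - b) / v * of_real x) / v"
    for a b v :: complex and x :: real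
  proof -
    have "exp (a / v * of_real x) * exp (- (b / v) * of_real x) = exp ((a - b) / v * of_real x)"
      unfolding exp_add[symmetric] by (simp add: diff_divide_distrib left_diff_distrib)
    then show ?thesis
      by (simp add: times_divide_eq_right)
  qed
  have "cinner (dual_eigfun s t n) (eigfun s t m)
      = (\<integral>x. exp (d / u * of_real x) / u - exp (d / cnj u * of_real x) / cnj u \<partial>I_meas)"
    unfolding eigfun_eq st(3)[symmetric] cinner_dual_eigfun[OF st F]
    by (simp only: fst_conv snd_conv add_0 mult_1 prod d)
  also have "\<dots> = (if d = 0 then pi * (1 / u - 1 / cnj u) else char_det u d / d)"
    by (rule integral_exp_pair[OF u(1)])
  also have "\<dots> = (if m = n then pi * (1 / u - 1 / cnj u) else 0)"
    using char_det_eq_0_iff[OF st, of d] d0 by (auto simp: d_def)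
  finally show ?thesis .
qed

lemma cinner_dual_unit_fun:
  assumes st: "s > 0" "t > 0" "u = Complex s t" and n: "n \<noteq> 0"
  shows "cinner (dual_eigfun s t n) unit_fun
    = (1 - exp (- (of_real (eigval s t n) / u) * pi)) / of_real (eigval s t n)"
proof -
  define \<mu> where "\<mu> = complex_of_real (eigval s t n)"
  have u: "u \<noteq> 0"
    using st by (auto simp: complex_eq_iff)
  have "s\<^sup>2 + t\<^sup>2 > 0"
    using st by (simp add: add_pos_pos)
  then have \<mu>: "\<mu> \<noteq> 0"
    unfolding \<mu>_def of_real_eq_0_iff using st n by (simp add: eigval_def)
  have "cinner (dual_eigfun s t n) unit_fun = (\<integral>x. exp (- (\<mu> / u) * of_real x) / u \<partial>I_meas)"
    unfolding unit_fun_def cinner_dual_eigfun[OF st continuous_on_const]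
    by (simp only: fst_conv snd_conv mult_1 mult_zero_left diff_zero \<mu>_def)
  also have "\<dots> = (exp (- (\<mu> / u) * pi) - 1) / (- (\<mu> / u)) / u"
  proof -
    have "- (\<mu> / u) \<noteq> 0"
      using \<mu> u by simp
    from integral_exp_I_meas[OF this] show ?thesis
      by (simp only: integral_divide_zero)
  qed
  also have "\<dots> = (1 - exp (- (\<mu> / u) * pi)) / \<mu>"
    using \<mu> u by (simp add: field_simps)
  finally show ?thesis
    by (simp only: \<mu>_def)
qed

lemma expansion_coefficient:
  assumes st: "s > 0" "t > 0" "u = Complex s t" and inj: "inj \<sigma>"
    and sums: "(\<lambda>k. a k *\<^sub>C eigfun s t (\<sigma> k)) sums f"
  shows "a k * (pi * (1 / u - 1 / cnj u)) = cinner (dual_eigfun s t (\<sigma> k)) f"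
proof -
  have "(\<lambda>j. cinner (dual_eigfun s t (\<sigma> k)) (a j *\<^sub>C eigfun s t (\<sigma> j))) sums cinner (dual_eigfun s t (\<sigma> k)) f"
    by (rule bounded_linear.sums[OF bounded_linear_cinner sums])
  also have "(\<lambda>j. cinner (dual_eigfun s t (\<sigma> k)) (a j *\<^sub>C eigfun s t (\<sigma> j)))
      = (\<lambda>j. if j = k then a j * (pi * (1 / u - 1 / cnj u)) else 0)"
    by (auto simp: cinner_scaleC eigfun_biorthogonal[OF st] inj_eq[OF inj])
  finally show ?thesis
    using sums_single[of k "\<lambda>j. a j * (pi * (1 / u - 1 / cnj u))"] sums_unique2 by blast
qed

lemma growth_le_norm_expansion_term:
  fixes n :: nat
  assumes st: "s > 0" "t > 0" "u = Complex s t" and inj: "inj \<sigma>"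
    and sums: "(\<lambda>k. a k *\<^sub>C eigfun s t (\<sigma> k)) sums unit_fun"
    and k: "\<sigma> k = int n" and n: "n > 0"
  shows "growth s t n \<le> 2 * sqrt pi * norm (a k *\<^sub>C eigfun s t (\<sigma> k))"
proof -
  define N where "N = s\<^sup>2 + t\<^sup>2"
  define q where "q = s * n / t * pi"
  have N: "N > 0"
    using st by (simp add: N_def add_pos_pos)
  have q: "q > 0"
    using st n by (simp add: q_def)
  have "a k * (pi * (1 / u - 1 / cnj u)) = (1 - exp (- (of_real (eigval s t (int n)) / u) * pi)) / of_real (eigval s t (int n))"
    unfolding expansion_coefficient[OF st inj sums] k by (rule cinner_dual_unit_fun[OF st]) (use n in simp)
  then have "cmod (a k * (pi * (1 / u - 1 / cnj u)))
      = cmod (1 - exp (- (of_real (eigval s t (int n)) / u) * pi)) / \<bar>eigval s t (int n)\<bar>"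
    by (simp only: norm_divide norm_of_real)
  also have "cmod (a k * (pi * (1 / u - 1 / cnj u))) = cmod (a k) * (pi * (2 * t / N))"
    unfolding norm_mult cmod_inverse_diff_cnj[OF st] by (simp add: N_def)
  also have "\<bar>eigval s t (int n)\<bar> = N / t * n"
    using st N by (simp add: eigval_def abs_mult N_def)
  finally have coeff: "cmod (a k) * (pi * (2 * t / N))
      = cmod (1 - exp (- (of_real (eigval s t (int n)) / u) * pi)) / (N / t * n)" .
  have "1 - exp (- q) \<le> cmod (1 - exp (- (of_real (eigval s t (int n)) / u) * pi))"
    using norm_triangle_ineq2[of 1 "exp (- (of_real (eigval s t (int n)) / u) * pi)"]
      norm_exp_eigval(2)[OF st, of "int n"] by (simp add: q_def)
  then have "(1 - exp (- q)) / (N / t * n) \<le> cmod (a k) * (pi * (2 * t / N))"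
    unfolding coeff using st N n by (intro divide_right_mono) auto
  then have a: "(1 - exp (- q)) / (N / t * n) / (pi * (2 * t / N)) \<le> cmod (a k)"
    using st N by (subst pos_divide_le_eq) auto
  have "growth s t n = (1 - exp (- q)) / (N / t * n) / (pi * (2 * t / N)) * ((exp q - 1) / (s * n / t))"
    unfolding growth_def q_def[symmetric] using st n N by (simp add: field_simps power2_eq_square)
  also have "\<dots> \<le> cmod (a k) * ((exp q - 1) / (s * n / t))"
    using q st by (intro mult_right_mono a) auto
  also have "\<dots> = cmod (cinner (probe n) (a k *\<^sub>C eigfun s t (\<sigma> k)))"
    unfolding cinner_scaleC norm_mult k cinner_probe_eigfun[OF st n] q_def ..
  also have "\<dots> \<le> 2 * norm (probe n) * norm (a k *\<^sub>C eigfun s t (\<sigma> k))"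
    by (rule norm_cinner_le)
  also have "\<dots> \<le> 2 * sqrt pi * norm (a k *\<^sub>C eigfun s t (\<sigma> k))"
    by (intro mult_right_mono mult_left_mono norm_probe) auto
  finally show ?thesis .
qed

text \<open>A convergent series has terms tending to zero, but a bijective enumeration reaches arbitrarily large
  positive indices \<open>n\<close> arbitrarily late, and there the terms are at least \<open>growth s t n / (2 \<surd>\<pi>)\<close>.\<close>

lemma eigfun_expansion_diverges:
  assumes st: "s > 0" "t > 0" and bij: "bij \<sigma>"
  shows "\<not> (\<lambda>k. a k *\<^sub>C eigfun s t (\<sigma> k)) sums unit_fun"
proof
  assume sums: "(\<lambda>k. a k *\<^sub>C eigfun s t (\<sigma> k)) sums unit_fun"
  then have "(\<lambda>k. a k *\<^sub>C eigfun s t (\<sigma> k)) \<longlonglongrightarrow> 0"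
    by (intro summable_LIMSEQ_zero sums_summable)
  then have "(\<lambda>k. norm (a k *\<^sub>C eigfun s t (\<sigma> k))) \<longlonglongrightarrow> 0"
    by (rule tendsto_norm_zero)
  then have "\<forall>\<^sub>F k in sequentially. norm (a k *\<^sub>C eigfun s t (\<sigma> k)) < 1 / (2 * sqrt pi)"
    by (rule order_tendstoD) simp
  then obtain K where K: "\<And>k. k \<ge> K \<Longrightarrow> norm (a k *\<^sub>C eigfun s t (\<sigma> k)) < 1 / (2 * sqrt pi)"
    by (auto simp: eventually_sequentially)
  obtain M where M: "\<And>n. n \<ge> M \<Longrightarrow> exp (s * pi / (2 * t) * real n) \<le> growth s t n"
    using growth_exponential[OF st] by (auto simp: eventually_sequentially)
  have "inj_on (\<lambda>n. inv \<sigma> (int n)) {M + 1..}"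
    using bij by (auto intro!: inj_onI dest!: injD[OF bij_is_inj[OF bij_imp_bij_inv[OF bij]]])
  then have "infinite ((\<lambda>n. inv \<sigma> (int n)) ` {M + 1..})"
    using infinite_Ici finite_imageD by blast
  then obtain n where n: "n \<ge> M + 1" "inv \<sigma> (int n) \<ge> K"
    by (auto simp: infinite_nat_iff_unbounded_le)
  have "\<sigma> (inv \<sigma> (int n)) = int n"
    using bij by (simp add: bij_is_surj surj_f_inv_f)
  from growth_le_norm_expansion_term[OF st refl bij_is_inj[OF bij] sums this] n(1)
  have "growth s t n \<le> 2 * sqrt pi * norm (a (inv \<sigma> (int n)) *\<^sub>C eigfun s t (\<sigma> (inv \<sigma> (int n))))"
    by simp
  also have "\<dots> < 2 * sqrt pi * (1 / (2 * sqrt pi))"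
    by (intro mult_strict_left_mono K n) auto
  also have "\<dots> = 1"
    by simp
  also have "1 \<le> exp (s * pi / (2 * t) * real n)"
    using st by simp
  also have "\<dots> \<le> growth s t n"
    using M n(1) by simp
  finally show False
    by simp
qed

theorem theorem20:
  fixes s t :: real and u :: complex
  assumes "s > 0" and "t > 0" and "u = Complex s t"
  shows "(\<exists>C>0. \<exists>c>0. \<forall>\<^sub>F n in sequentially.
            norm (spectral_projection L_dom (L_op u) (complex_of_real (eigval s t (int n))))
              \<ge> C * exp (c * real n))
       \<and> (\<forall>\<sigma> :: nat \<Rightarrow> int. bij \<sigma> \<longrightarrow> \<not> schauder_basis (\<lambda>k. eigfun s t (\<sigma> k)))"
proof (intro conjI allI impI)
  have "\<forall>\<^sub>F n in sequentially. (s\<^sup>2 + t\<^sup>2) / t \<le> s * real n"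
    using assms(1) by real_asymp
  then have "\<forall>\<^sub>F n in sequentially. 1 / (2 * pi) * exp (s * pi / (2 * t) * real n)
      \<le> norm (spectral_projection L_dom (L_op u) (complex_of_real (eigval s t (int n))))"
    using growth_exponential[OF assms(1,2)] eventually_gt_at_top[of 0]
  proof eventually_elim
    case (elim n)
    show ?case
      using order_trans[OF elim(2) growth_le_norm_spectral_projection[OF assms elim(3,1)]]
      by (simp add: pos_divide_le_eq mult.commute)
  qed
  moreover have "1 / (2 * pi) > 0" "s * pi / (2 * t) > 0"
    using assms by simp_all
  ultimately show "\<exists>C>0. \<exists>c>0. \<forall>\<^sub>F n in sequentially.
      norm (spectral_projection L_dom (L_op u) (complex_of_real (eigval s t (int n)))) \<ge> C * exp (c * real n)"
    by blast
next
  fix \<sigma> :: "nat \<Rightarrow> int" assume "bij \<sigma>"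
  then show "\<not> schauder_basis (\<lambda>k. eigfun s t (\<sigma> k))"
    unfolding schauder_basis_def using eigfun_expansion_diverges[OF assms(1,2)] by blast
qed

end
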